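(* Let $E$ be an arbitrary directed graph, let $K$ be a field, and let $P$ be a prime ideal of the Leavitt path algebra $L=L_K(E)$. If $P$ is locally closed, then $P$ is rational.
   Context: Ideals are two-sided. A directed graph $E=(E^0,E^1,r,s)$ consists of sets $E^0$ (vertices), $E^1$ (edges) and maps $r,s:E^1\to E^0$; no cardinality restrictions are imposed. A vertex is regular if it emits a non-empty finite set of edges. Leavitt path algebra: $L_K(E)$ is the $K$-algebra (not necessarily unital) generated by pairwise orthogonal idempotents $\{v: v\in E^0\}$ and elements $\{e,e^*: e\in E^1\}$ subject to: $s(e)e=e=e\,r(e)$; $r(e)e^*=e^*=e^*s(e)$; $e^*e=r(e)$ and $e^*f=0$ for $e\ne f$ in $E^1$; and $v=\sum_{s(e)=v}ee^*$ for every regular vertex $v$. Locally closed: a prime ideal $P$ of a ring $R$ is locally closed if $P$ is not the intersection of all the prime ideals of $R$ properly containing $P$ (the intersection of an empty family of ideals of $R$ is $R$). Extended centroid: for a prime $K$-algebra $A$, the Martindale ring of quotients $Frac(A)$ consists of equivalence classes of pairs $(I,f)$ with $I$ a non-zero ideal of $A$ and $f\in Hom_A(I_A,A_A)$ a right $A$-module homomorphism, where $(I,f)\sim(J,g)$ if $f=g$ on $I\cap J$, with $(I,f)+(J,g)=(I\cap J,f+g)$ and $(I,f)\cdot(J,g)=(IJ,f\circ g)$. The extended centroid $C(A)$ is the center of $Frac(A)$; equivalently, it consists of the classes $[(I,f)]$ with $0\neq I$ an ideal of $A$ and $f:I\to A$ an $(A,A)$-bimodule homomorphism. It is a field extension of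 $K$. Rational: a prime ideal $P$ of a $K$-algebra $R$ is rational if the extended centroid of $R/P$ is an algebraic extension of $K$. *)

theory Defs
  imports "Graph_Theory.Digraph" "HOL-Algebra.Ideal_Product" "HOL-Algebra.Finite_Extensions"
begin

text \<open>
  Rings need not be unital here. They are represented by the record types of HOL-Algebra, but the
  locale \<^locale>\<open>ring\<close> and the predicates built on it (such as \<^locale>\<open>ideal\<close>) demand a unit, so the
  notions below are stated for bare records. The field \<^const>\<open>one\<close> of a free algebra, of a
  Leavitt path algebra and of their quotients is a placeholder that is never referred to. The base
  field is a type of class \<^class>\<open>field\<close>.
\<close>

section \<open>Ideals of rings without unit\<close>

definition two_sided_ideal :: "'a set \<Rightarrow> ('a, 'm) ring_scheme \<Rightarrow> bool" where
  "two_sided_ideal I R \<longleftrightarrow>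
     additive_subgroup I R \<and>
     (\<forall>a\<in>I. \<forall>x\<in>carrier R. x \<otimes>\<^bsub>R\<^esub> a \<in> I \<and> a \<otimes>\<^bsub>R\<^esub> x \<in> I)"

definition prime_two_sided_ideal :: "'a set \<Rightarrow> ('a, 'm) ring_scheme \<Rightarrow> bool" where
  "prime_two_sided_ideal P R \<longleftrightarrow>
     two_sided_ideal P R \<and> P \<noteq> carrier R \<and>
     (\<forall>I J. two_sided_ideal I R \<longrightarrow> two_sided_ideal J R \<longrightarrow> I \<cdot>\<^bsub>R\<^esub> J \<subseteq> P \<longrightarrow> I \<subseteq> P \<or> J \<subseteq> P)"

text \<open>Intersecting with the carrier makes the intersection of the empty family the whole ring.\<close>

definition locally_closed_ideal :: "'a set \<Rightarrow> ('a, 'm) ring_scheme \<Rightarrow> bool" where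
  "locally_closed_ideal P R \<longleftrightarrow>
     P \<noteq> carrier R \<inter> \<Inter>{Q. prime_two_sided_ideal Q R \<and> P \<subset> Q}"


section \<open>Algebras presented by generators and relations\<close>

text \<open>
  The free non-unital algebra on \<open>S\<close>: finitely supported coefficient functions on the non-empty
  words over \<open>S\<close>, multiplied by convolution along concatenation.
\<close>

definition free_algebra :: "'x set \<Rightarrow> ('k :: field, 'x list \<Rightarrow> 'k) module" where
  "free_algebra S =
     \<lparr> carrier = {f. finite {w. f w \<noteq> 0} \<and> {w. f w \<noteq> 0} \<subseteq> lists S - {[]}},
       monoid.mult = (\<lambda>f g w. \<Sum>i\<le>length w. f (take i w) * g (drop i w)),
       one = (\<lambda>w. 0),
       zero = (\<lambda>w. 0),
       add = (\<lambda>f g w. f w + g w),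
       smult = (\<lambda>c f w. c * f w) \<rparr>"

definition free_gen :: "'x \<Rightarrow> 'x list \<Rightarrow> 'k :: field" where
  "free_gen x = (\<lambda>w. if w = [x] then 1 else 0)"

text \<open>
  In a non-unital algebra a ring ideal need not be a subspace, so closure under scalars
  has to be required.
\<close>

definition algebra_ideal_generated :: "('k, 'a, 'm) module_scheme \<Rightarrow> 'a set \<Rightarrow> 'a set" where
  "algebra_ideal_generated A S =
     carrier A \<inter> \<Inter>{I. two_sided_ideal I A \<and> (\<forall>c. \<forall>x\<in>I. c \<odot>\<^bsub>A\<^esub> x \<in> I) \<and> S \<subseteq> I}"

text \<open>The ring operations are those of \<^term>\<open>A Quot I\<close>, written as a record with scalars.\<close>

definition quotient_algebra :: "('k, 'a, 'm) module_scheme \<Rightarrow> 'a set \<Rightarrow> ('k, 'a set) module" where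
  "quotient_algebra A I =
     \<lparr> carrier = carrier (A Quot I),
       monoid.mult = monoid.mult (A Quot I),
       one = one (A Quot I),
       zero = zero (A Quot I),
       add = add (A Quot I),
       smult = (\<lambda>c U. \<Union>x\<in>U. I +>\<^bsub>A\<^esub> (c \<odot>\<^bsub>A\<^esub> x)) \<rparr>"


section \<open>Leavitt path algebras\<close>

text \<open>
  In a directed graph \<open>E\<close>, the source and range maps are \<^term>\<open>tail E\<close> and \<^term>\<open>head E\<close>;
  \<^term>\<open>verts E\<close> and \<^term>\<open>arcs E\<close> may be empty or of any cardinality.
\<close>

definition regular_vertex :: "('v, 'e) pre_digraph \<Rightarrow> 'v \<Rightarrow> bool" where
  "regular_vertex E v \<longleftrightarrow> v \<in> verts E \<and> out_arcs E v \<noteq> {} \<and> finite (out_arcs E v)"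

datatype ('v, 'e) lpa_gen = Vertex 'v | Edge 'e | Ghost 'e

definition lpa_gens :: "('v, 'e) pre_digraph \<Rightarrow> ('v, 'e) lpa_gen set" where
  "lpa_gens E = Vertex ` verts E \<union> Edge ` arcs E \<union> Ghost ` arcs E"

text \<open>
  An element \<open>a \<ominus> b\<close> below encodes the relation \<open>a = b\<close>, and a bare product \<open>a \<otimes> b\<close>
  the relation \<open>a \<otimes> b = \<zero>\<close>.
\<close>

inductive_set lpa_relators :: "('v, 'e) pre_digraph \<Rightarrow> (('v, 'e) lpa_gen list \<Rightarrow> 'k :: field) set"
  for E :: "('v, 'e) pre_digraph"
  where
  vertex_idem: "v \<in> verts E \<Longrightarrow>
    (free_gen (Vertex v) \<otimes>\<^bsub>free_algebra (lpa_gens E)\<^esub> free_gen (Vertex v))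
      \<ominus>\<^bsub>free_algebra (lpa_gens E)\<^esub> free_gen (Vertex v) \<in> lpa_relators E"
| vertex_orth: "\<lbrakk>v \<in> verts E; w \<in> verts E; v \<noteq> w\<rbrakk> \<Longrightarrow>
    free_gen (Vertex v) \<otimes>\<^bsub>free_algebra (lpa_gens E)\<^esub> free_gen (Vertex w) \<in> lpa_relators E"
| edge_source: "e \<in> arcs E \<Longrightarrow>
    (free_gen (Vertex (tail E e)) \<otimes>\<^bsub>free_algebra (lpa_gens E)\<^esub> free_gen (Edge e))
      \<ominus>\<^bsub>free_algebra (lpa_gens E)\<^esub> free_gen (Edge e) \<in> lpa_relators E"
| edge_range: "e \<in> arcs E \<Longrightarrow>
    (free_gen (Edge e) \<otimes>\<^bsub>free_algebra (lpa_gens E)\<^esub> free_gen (Vertex (head E e)))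
      \<ominus>\<^bsub>free_algebra (lpa_gens E)\<^esub> free_gen (Edge e) \<in> lpa_relators E"
| ghost_range: "e \<in> arcs E \<Longrightarrow>
    (free_gen (Vertex (head E e)) \<otimes>\<^bsub>free_algebra (lpa_gens E)\<^esub> free_gen (Ghost e))
      \<ominus>\<^bsub>free_algebra (lpa_gens E)\<^esub> free_gen (Ghost e) \<in> lpa_relators E"
| ghost_source: "e \<in> arcs E \<Longrightarrow>
    (free_gen (Ghost e) \<otimes>\<^bsub>free_algebra (lpa_gens E)\<^esub> free_gen (Vertex (tail E e)))
      \<ominus>\<^bsub>free_algebra (lpa_gens E)\<^esub> free_gen (Ghost e) \<in> lpa_relators E"
| ghost_edge_same: "e \<in> arcs E \<Longrightarrow>
    (free_gen (Ghost e) \<otimes>\<^bsub>free_algebra (lpa_gens E)\<^esub> free_gen (Edge e))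
      \<ominus>\<^bsub>free_algebra (lpa_gens E)\<^esub> free_gen (Vertex (head E e)) \<in> lpa_relators E"
| ghost_edge_distinct: "\<lbrakk>e \<in> arcs E; f \<in> arcs E; e \<noteq> f\<rbrakk> \<Longrightarrow>
    free_gen (Ghost e) \<otimes>\<^bsub>free_algebra (lpa_gens E)\<^esub> free_gen (Edge f) \<in> lpa_relators E"
| regular_sum: "regular_vertex E v \<Longrightarrow>
    free_gen (Vertex v) \<ominus>\<^bsub>free_algebra (lpa_gens E)\<^esub>
      (\<Oplus>\<^bsub>free_algebra (lpa_gens E)\<^esub>e\<in>out_arcs E v.
         free_gen (Edge e) \<otimes>\<^bsub>free_algebra (lpa_gens E)\<^esub> free_gen (Ghost e)) \<in> lpa_relators E"

definition leavitt_path_algebra ::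
    "('v, 'e) pre_digraph \<Rightarrow> ('k :: field, (('v, 'e) lpa_gen list \<Rightarrow> 'k) set) module" where
  "leavitt_path_algebra E =
     quotient_algebra (free_algebra (lpa_gens E))
       (algebra_ideal_generated (free_algebra (lpa_gens E)) (lpa_relators E))"


section \<open>Martindale ring of quotients, extended centroid, rational ideals\<close>

definition right_module_homs :: "('a, 'm) ring_scheme \<Rightarrow> 'a set \<Rightarrow> ('a \<Rightarrow> 'a) set" where
  "right_module_homs A I =
     {f \<in> I \<rightarrow> carrier A.
        (\<forall>x\<in>I. \<forall>y\<in>I. f (x \<oplus>\<^bsub>A\<^esub> y) = f x \<oplus>\<^bsub>A\<^esub> f y) \<and>
        (\<forall>x\<in>I. \<forall>a\<in>carrier A. f (x \<otimes>\<^bsub>A\<^esub> a) = f x \<otimes>\<^bsub>A\<^esub> a)}"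

text \<open>
  A homomorphism on \<open>I\<close> is a total function whose values outside \<open>I\<close> are irrelevant:
  the equivalence below only compares values on the intersection of the domains.
\<close>

definition martindale_pairs :: "('a, 'm) ring_scheme \<Rightarrow> ('a set \<times> ('a \<Rightarrow> 'a)) set" where
  "martindale_pairs A =
     {(I, f). two_sided_ideal I A \<and> I \<noteq> {\<zero>\<^bsub>A\<^esub>} \<and> f \<in> right_module_homs A I}"

definition martindale_rel ::
    "('a, 'm) ring_scheme \<Rightarrow> (('a set \<times> ('a \<Rightarrow> 'a)) \<times> ('a set \<times> ('a \<Rightarrow> 'a))) set" where
  "martindale_rel A =
     {((I, f), (J, g)). (I, f) \<in> martindale_pairs A \<and> (J, g) \<in> martindale_pairs A \<and>
        (\<forall>x\<in>I \<inter> J. f x = g x)}"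

text \<open>
  The composite \<open>f \<circ> g\<close> is taken on \<open>J I\<close>, not \<open>I J\<close>: as \<open>g\<close> is right linear on \<open>J\<close>, it maps
  \<open>J I\<close> into \<open>I\<close>, where \<open>f\<close> is defined.
\<close>

definition martindale_ring ::
    "('a, 'm) ring_scheme \<Rightarrow> ('a set \<times> ('a \<Rightarrow> 'a)) set ring" where
  "martindale_ring A =
     \<lparr> carrier = martindale_pairs A // martindale_rel A,
       monoid.mult = (\<lambda>U W. \<Union>(I, f)\<in>U. \<Union>(J, g)\<in>W. martindale_rel A `` {(J \<cdot>\<^bsub>A\<^esub> I, f \<circ> g)}),
       one = martindale_rel A `` {(carrier A, \<lambda>x. x)},
       zero = martindale_rel A `` {(carrier A, \<lambda>x. \<zero>\<^bsub>A\<^esub>)},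
       add = (\<lambda>U W. \<Union>(I, f)\<in>U. \<Union>(J, g)\<in>W.
                martindale_rel A `` {(I \<inter> J, \<lambda>x. f x \<oplus>\<^bsub>A\<^esub> g x)}) \<rparr>"

definition ring_center :: "('a, 'm) ring_scheme \<Rightarrow> 'a set" where
  "ring_center R = {x \<in> carrier R. \<forall>y\<in>carrier R. x \<otimes>\<^bsub>R\<^esub> y = y \<otimes>\<^bsub>R\<^esub> x}"

definition extended_centroid :: "('a, 'm) ring_scheme \<Rightarrow> ('a set \<times> ('a \<Rightarrow> 'a)) set ring" where
  "extended_centroid A = (martindale_ring A) \<lparr> carrier := ring_center (martindale_ring A) \<rparr>"

text \<open>The canonical copy of the base field: scalars act on \<open>A\<close> by multiplication.\<close>

definition centroid_scalars ::
    "('k, 'a, 'm) module_scheme \<Rightarrow> ('a set \<times> ('a \<Rightarrow> 'a)) set set" where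
  "centroid_scalars A = range (\<lambda>c. martindale_rel A `` {(carrier A, \<lambda>x. c \<odot>\<^bsub>A\<^esub> x)})"

definition rational_ideal :: "'a set \<Rightarrow> ('k, 'a, 'm) module_scheme \<Rightarrow> bool" where
  "rational_ideal P A \<longleftrightarrow>
     (\<forall>z\<in>carrier (extended_centroid (quotient_algebra A P)).
        ring.algebraic (extended_centroid (quotient_algebra A P))
          (centroid_scalars (quotient_algebra A P)) z)"

end

theory Submission
  imports Defs "HOL-Computational_Algebra.Polynomial_Factorial"
    "HOL-Computational_Algebra.Formal_Power_Series"
begin

text \<open>
  Let \<open>A\<close> be the quotient of the Leavitt path algebra by a prime ideal \<open>P\<close>. It is a prime algebra
  spanned by the products \<open>\<alpha> \<beta>\<^sup>*\<close> of a path with a ghost path. An element of the extended centroid is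
  represented by a bimodule homomorphism \<open>f\<close> from a nonzero ideal \<open>I\<close> of \<open>A\<close> to \<open>A\<close>, and it is
  determined by what it does to a single nonzero element. So it is algebraic over \<open>K\<close> as soon as
  some nonzero \<open>y \<in> A\<close> satisfies a nontrivial relation \<open>\<Sum> c\<^sub>j f\<^sup>j y = 0\<close>
  (\<open>extended_centroid_algebraic\<close>). There are two reasons why such a relation can exist.

  \<^item> \<open>A\<close> may have a corner \<open>g A g\<close> which is a commutative ring of fractions of \<open>K[x]\<close>
  (\<open>monogenic_corner\<close>). If \<open>x\<close> is algebraic over \<open>K\<close>, then this domain is algebraic over \<open>K\<close>, and
  since \<open>f\<close> acts on it by multiplication with a fraction, \<open>f\<close> is algebraic. If \<open>x\<close> is
  transcendental, then Euclid's argument gives, for each nonzero \<open>a \<in> A\<close>, an irreducible polynomial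
  whose multiples in the corner form a prime ideal that misses some \<open>g s a t g\<close>. This prime spreads to
  a nonzero prime ideal of \<open>A\<close> without \<open>a\<close> (\<open>ex_prime_avoiding_if_transcendental\<close>). Then \<open>P\<close> is an
  intersection of larger primes, so this case contradicts local closedness.

  \<^item> If there is no such corner, then each nonzero element can be compressed, multiplying by a ghost
  path on the left and a path on the right, to \<open>k s + \<gamma>\<close> with a scalar \<open>k \<noteq> 0\<close>, a vertex \<open>s\<close> and a
  combination \<open>\<gamma>\<close> of closed paths of positive length at \<open>s\<close> (\<open>reduction\<close>). As every vertex has two
  different paths of the same length, a path \<open>\<beta>\<close> from \<open>s\<close> can leave all the cycles in \<open>\<gamma>\<close>, and then
  \<open>\<beta>\<^sup>* \<gamma> \<beta> = 0\<close>. Applied to a value of \<open>f\<close>, this shows that \<open>f\<close> multiplies some vertex by a scalar.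

  The two situations are exhaustive (\<open>centroid_alternative\<close>). Discard the vertices and edges that
  vanish in \<open>A\<close>. If some vertex \<open>v\<close> emits only finitely many of the remaining edges and
  \<open>g = v - \<Sum> e e\<^sup>*\<close> is nonzero, then \<open>g A g = K g\<close>. If there is no such gap and some vertex \<open>u\<close> has only
  one path of each length, then the monomials of \<open>u A u\<close> depend only on their degree, so that the
  corner at \<open>u\<close> is \<open>K\<close> or a quotient of a Laurent polynomial ring. Otherwise the reduction applies.
\<close>

section \<open>Polynomials over a field and subgroups of the integers\<close>
text \<open>
  Euclid's argument: a factor of \<open>1 + X p\<close> divides neither \<open>X\<close> nor \<open>p\<close>, and
  \<open>1 + X p\<close> is not constant.
\<close>
lemma exists_prime_poly_avoiding:
  fixes p :: "'k :: field poly"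
  assumes "p \<noteq> 0"
  shows "\<exists>f. prime_elem f \<and> \<not> f dvd [:0, 1:] \<and> \<not> f dvd p"
proof -
  let ?P = "\<lambda>f. f dvd 1 + [:0, 1:] * p \<and> Polynomial.degree f > 0"
  \<comment> \<open>A nonconstant divisor of least degree is irreducible.\<close>
  have "?P (1 + [:0, 1:] * p)"
    using assms by (simp add: one_pCons)
  then obtain f where f: "?P f" and min: "\<And>g. ?P g \<Longrightarrow> Polynomial.degree f \<le> Polynomial.degree g"
    using ex_has_least_nat[of ?P _ Polynomial.degree] by blast
  have nz: "f \<noteq> 0" using f by auto
  have "Factorial_Ring.irreducible f"
  proof (rule Factorial_Ring.irreducibleI)
    show "f \<noteq> 0" by (fact nz)
    show "\<not> f dvd 1" using f nz by (auto simp: is_unit_iff_degree)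
    fix a b assume ab: "f = a * b"
    have a0: "a \<noteq> 0" "b \<noteq> 0" using ab nz by auto
    have deg: "Polynomial.degree f = Polynomial.degree a + Polynomial.degree b"
      using a0 ab by (simp add: degree_mult_eq)
    have "Polynomial.degree a = 0 \<or> Polynomial.degree b = 0"
    proof (rule ccontr)
      assume pos: "\<not> ?thesis"
      have "a dvd f" using ab by simp
      then have "a dvd 1 + [:0, 1:] * p" using f dvd_trans by blast
      then have "Polynomial.degree f \<le> Polynomial.degree a" using min[of a] pos by simp
      with deg pos show False by simp
    qed
    then show "a dvd 1 \<or> b dvd 1"
      using a0 by (auto simp: is_unit_iff_degree)
  qed
  then have "prime_elem f" by (rule field_poly_irreducible_imp_prime)
  moreover have "\<not> f dvd 1" using f nz by (auto simp: is_unit_iff_degree)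
  moreover have "f dvd 1" if "f dvd [:0, 1:] * p"
    using f that dvd_add_left_iff by blast
  ultimately show ?thesis by (meson dvd_mult dvd_mult2)
qed

interpretation poly_vs: vector_space "smult :: 'k :: field \<Rightarrow> 'k poly \<Rightarrow> 'k poly"
  by standard (auto simp: smult_add_left smult_add_right)

text \<open>
  The residues modulo \<open>f\<close> form a space of dimension \<open>degree f\<close>, so any \<open>degree f + 1\<close> of them are
  linearly dependent. The coefficients of the relation are collected in a polynomial.
\<close>
lemma exists_relation_modulo_poly:
  fixes f :: "'k :: field poly" and q :: "nat \<Rightarrow> 'k poly"
  assumes "f \<noteq> 0"
  shows "\<exists>c. c \<noteq> 0 \<and> Polynomial.degree c \<le> Polynomial.degree f \<and>
             f dvd (\<Sum>i\<le>Polynomial.degree c. smult (Polynomial.coeff c i) (q i))"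
proof -
  define d where "d = Polynomial.degree f"
  define h where "h i = q i mod f" for i
  let ?T = "(\<lambda>j. Polynomial.monom (1 :: 'k) j) ` {..<d}"
  have cardT: "finite ?T" "card ?T \<le> d"
    using card_image_le[of "{..<d}"] by auto
  have mon: "Polynomial.monom 1 j \<in> ?T" if "j < d" for j
    using that by simp
  have inT: "h i \<in> poly_vs.span ?T" for i
  proof (cases "h i = 0")
    case True then show ?thesis by (simp add: poly_vs.span_zero)
  next
    case False
    then have dg: "Polynomial.degree (h i) < d"
      using degree_mod_less[OF assms, of "q i"] by (auto simp: h_def d_def)
    have "h i = (\<Sum>j\<le>Polynomial.degree (h i). Polynomial.monom (Polynomial.coeff (h i) j) j)"
      by (simp add: poly_as_sum_of_monoms)
    also have "\<dots> = (\<Sum>j\<le>Polynomial.degree (h i). smult (Polynomial.coeff (h i) j) (Polynomial.monom 1 j))"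
      by (simp add: smult_monom)
    also have "\<dots> \<in> poly_vs.span ?T"
      using dg by (intro poly_vs.span_sum poly_vs.span_scale poly_vs.span_base mon) auto
    finally show ?thesis .
  qed
  have "\<exists>u. (\<exists>i\<le>d. u i \<noteq> 0) \<and> (\<Sum>i\<le>d. smult (u i) (h i)) = 0"
  \<comment> \<open>Dependence of a set does not see repetitions, so two equal residues are a case of their own.\<close>
  proof (cases "inj_on h {..d}")
    case False
    then obtain i j where ij: "i \<le> d" "j \<le> d" "i \<noteq> j" "h i = h j" by (auto simp: inj_on_def)
    define u :: "nat \<Rightarrow> 'k" where "u k = (if k = i then 1 else if k = j then - 1 else 0)" for k
    have "(\<Sum>k\<le>d. smult (u k) (h k)) = (\<Sum>k\<in>{i, j}. smult (u k) (h k))"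
      using ij by (intro sum.mono_neutral_right) (auto simp: u_def)
    also have "\<dots> = 0" using ij by (simp add: u_def)
    finally show ?thesis using ij by (intro exI[of _ u]) (auto simp: u_def)
  next
    case True
    have "poly_vs.dependent (h ` {..d})"
    proof (rule ccontr)
      assume "\<not> ?thesis"
      then have "card (h ` {..d}) \<le> card ?T"
        using poly_vs.independent_span_bound[OF cardT(1)] inT by blast
      with card_image[OF True] cardT(2) show False by simp
    qed
    then obtain u where "\<exists>v\<in>h ` {..d}. u v \<noteq> 0" and "(\<Sum>v\<in>h ` {..d}. smult (u v) v) = 0"
      by (auto simp: poly_vs.dependent_finite)
    then show ?thesis
      using True by (intro exI[of _ "u \<circ> h"]) (auto simp: sum.reindex)
  qed
  then obtain u i where ui: "i \<le> d" "u i \<noteq> 0" and su: "(\<Sum>i\<le>d. smult (u i) (h i)) = 0" by blast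
  define c where "c = (\<Sum>i\<le>d. Polynomial.monom (u i) i)"
  have cc: "Polynomial.coeff c j = (if j \<le> d then u j else 0)" for j
    by (auto simp: c_def coeff_sum)
  have c0: "c \<noteq> 0" using ui cc[of i] by auto
  have dc: "Polynomial.degree c \<le> d" by (rule degree_le) (simp add: cc)
  have "(\<Sum>i\<le>Polynomial.degree c. smult (Polynomial.coeff c i) (q i)) =
        (\<Sum>i\<le>d. smult (Polynomial.coeff c i) (q i))"
    using dc by (intro sum.mono_neutral_left) (auto simp: coeff_eq_0)
  also have "\<dots> = (\<Sum>i\<le>d. smult (u i) (q i))" by (simp add: cc)
  also have "\<dots> = (\<Sum>i\<le>d. smult (u i) (q i)) - (\<Sum>i\<le>d. smult (u i) (h i))" by (simp add: su)
  also have "\<dots> = (\<Sum>i\<le>d. smult (u i) (q i - h i))"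
    by (simp add: sum_subtractf smult_diff_right)
  also have "f dvd \<dots>"
    by (intro dvd_sum dvd_smult) (simp add: h_def minus_mod_eq_mult_div)
  finally show ?thesis using c0 dc by (auto simp: d_def)
qed

lemma int_subgroup_cyclic:
  fixes D :: "int set"
  assumes "0 \<in> D" "\<And>a b. a \<in> D \<Longrightarrow> b \<in> D \<Longrightarrow> a + b \<in> D" "\<And>a. a \<in> D \<Longrightarrow> - a \<in> D"
  shows "\<exists>m\<in>D. \<forall>a\<in>D. m dvd a"
proof (cases "\<exists>a\<in>D. a > 0")
  case False
  have "a = 0" if "a \<in> D" for a
  proof -
    have "\<not> a > 0" "\<not> - a > 0" using False assms(3)[OF that] that by blast+
    then show ?thesis by simp
  qed
  then show ?thesis using assms(1) by (intro bexI[of _ 0]) auto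
next
  case True
  then obtain a where a: "a \<in> D" "a > 0" by blast
  define n where "n = (LEAST n. n > 0 \<and> int n \<in> D)"
  have n: "n > 0 \<and> int n \<in> D"
    unfolding n_def by (rule LeastI[of _ "nat a"]) (use a in auto)
  have mult: "int k * int n \<in> D" for k
  proof (induct k)
    case 0 show ?case using assms(1) by simp
  next
    case (Suc k)
    have "int (Suc k) * int n = int k * int n + int n" by (simp add: distrib_right)
    then show ?case using assms(2)[OF Suc conjunct2[OF n]] by (simp only:)
  qed
  have mult': "j * int n \<in> D" for j :: int
  proof (cases "j \<ge> 0")
    case True then show ?thesis using mult[of "nat j"] by simp
  next
    case False then show ?thesis using assms(3)[OF mult[of "nat (- j)"]] by simp
  qed
  have "int n dvd b" if b: "b \<in> D" for b
  proof (rule ccontr)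
    assume "\<not> ?thesis"
    then have "b mod int n \<noteq> 0" by (simp add: mod_eq_0_iff_dvd)
    moreover have "b mod int n \<ge> 0" "b mod int n < int n" using n by simp_all
    ultimately have r: "b mod int n > 0" "b mod int n < int n" by linarith+
    have "b + (- (b div int n)) * int n \<in> D" by (intro assms(2) b mult')
    also have "b + (- (b div int n)) * int n = b mod int n"
      using div_mult_mod_eq[of b "int n"] by linarith
    finally have "b mod int n \<in> D" .
    then have "n \<le> nat (b mod int n)" using r unfolding n_def by (intro Least_le) auto
    with r show False by linarith
  qed
  then show ?thesis using n by blast
qed

section \<open>Algebras without unit and their spans\<close>
locale nonunital_algebra = abelian_group A
  for A :: "('k :: field, 'a, 'm) module_scheme" (structure) +
  assumes m_closed [simp, intro]: "\<lbrakk>x \<in> carrier A; y \<in> carrier A\<rbrakk> \<Longrightarrow> x \<otimes> y \<in> carrier A"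
    and m_assoc: "\<lbrakk>x \<in> carrier A; y \<in> carrier A; z \<in> carrier A\<rbrakk> \<Longrightarrow> (x \<otimes> y) \<otimes> z = x \<otimes> (y \<otimes> z)"
    and l_distr: "\<lbrakk>x \<in> carrier A; y \<in> carrier A; z \<in> carrier A\<rbrakk> \<Longrightarrow> (x \<oplus> y) \<otimes> z = x \<otimes> z \<oplus> y \<otimes> z"
    and r_distr: "\<lbrakk>x \<in> carrier A; y \<in> carrier A; z \<in> carrier A\<rbrakk> \<Longrightarrow> z \<otimes> (x \<oplus> y) = z \<otimes> x \<oplus> z \<otimes> y"
    and smult_closed [simp, intro]: "x \<in> carrier A \<Longrightarrow> c \<odot> x \<in> carrier A"
    and smult_l_distr: "x \<in> carrier A \<Longrightarrow> (c + d) \<odot> x = c \<odot> x \<oplus> d \<odot> x"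
    and smult_r_distr: "\<lbrakk>x \<in> carrier A; y \<in> carrier A\<rbrakk> \<Longrightarrow> c \<odot> (x \<oplus> y) = c \<odot> x \<oplus> c \<odot> y"
    and smult_smult: "x \<in> carrier A \<Longrightarrow> c \<odot> (d \<odot> x) = (c * d) \<odot> x"
    and smult_one [simp]: "x \<in> carrier A \<Longrightarrow> 1 \<odot> x = x"
    and smult_mult_l: "\<lbrakk>x \<in> carrier A; y \<in> carrier A\<rbrakk> \<Longrightarrow> (c \<odot> x) \<otimes> y = c \<odot> (x \<otimes> y)"
    and smult_mult_r: "\<lbrakk>x \<in> carrier A; y \<in> carrier A\<rbrakk> \<Longrightarrow> x \<otimes> (c \<odot> y) = c \<odot> (x \<otimes> y)"
begin

lemma l_null [simp]: "x \<in> carrier A \<Longrightarrow> \<zero> \<otimes> x = \<zero>"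
  using l_distr[of \<zero> \<zero> x] add.l_cancel_one[of "\<zero> \<otimes> x" "\<zero> \<otimes> x"] by simp

lemma r_null [simp]: "x \<in> carrier A \<Longrightarrow> x \<otimes> \<zero> = \<zero>"
  using r_distr[of \<zero> \<zero> x] add.l_cancel_one[of "x \<otimes> \<zero>" "x \<otimes> \<zero>"] by simp

lemma smult_zero [simp]: "x \<in> carrier A \<Longrightarrow> 0 \<odot> x = \<zero>"
  using smult_l_distr[of x 0 0] add.l_cancel_one[of "0 \<odot> x" "0 \<odot> x"] by simp

lemma smult_null [simp]: "c \<odot> \<zero> = \<zero>"
  using smult_r_distr[of \<zero> \<zero> c] add.l_cancel_one[of "c \<odot> \<zero>" "c \<odot> \<zero>"] by simp

lemma uminus_smult: "x \<in> carrier A \<Longrightarrow> \<ominus> x = (- 1) \<odot> x"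
  using smult_l_distr[of x 1 "- 1"] by (intro minus_equality) (simp_all add: a_comm)

lemma l_minus: "\<lbrakk>x \<in> carrier A; y \<in> carrier A\<rbrakk> \<Longrightarrow> (\<ominus> x) \<otimes> y = \<ominus> (x \<otimes> y)"
  by (simp add: uminus_smult smult_mult_l)

lemma r_minus: "\<lbrakk>x \<in> carrier A; y \<in> carrier A\<rbrakk> \<Longrightarrow> x \<otimes> (\<ominus> y) = \<ominus> (x \<otimes> y)"
  by (simp add: uminus_smult smult_mult_r)

lemma smult_eq_zero: "\<lbrakk>x \<in> carrier A; c \<odot> x = \<zero>; c \<noteq> 0\<rbrakk> \<Longrightarrow> x = \<zero>"
  using smult_smult[of x "inverse c" c] by simp

lemma two_sided_idealI:
  assumes "I \<subseteq> carrier A" "\<zero> \<in> I"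
    and "\<And>x y. x \<in> I \<Longrightarrow> y \<in> I \<Longrightarrow> x \<oplus> y \<in> I"
    and "\<And>x. x \<in> I \<Longrightarrow> \<ominus> x \<in> I"
    and "\<And>x a. x \<in> I \<Longrightarrow> a \<in> carrier A \<Longrightarrow> a \<otimes> x \<in> I"
    and "\<And>x a. x \<in> I \<Longrightarrow> a \<in> carrier A \<Longrightarrow> x \<otimes> a \<in> I"
  shows "two_sided_ideal I A"
proof -
  have "subgroup I (add_monoid A)"
    using assms by (auto intro!: add.subgroupI simp: a_inv_def[symmetric])
  then show ?thesis
    using assms by (auto simp: two_sided_ideal_def additive_subgroup_def)
qed

lemma two_sided_ideal_carrier: "two_sided_ideal (carrier A) A"
  by (rule two_sided_idealI) auto

context
  fixes I assumes I: "two_sided_ideal I A"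
begin

lemma ideal_additive_subgroup: "additive_subgroup I A"
  using I by (simp add: two_sided_ideal_def)

lemma ideal_carrier: "x \<in> I \<Longrightarrow> x \<in> carrier A"
  using additive_subgroup.a_Hcarr[OF ideal_additive_subgroup] .

lemma ideal_zero: "\<zero> \<in> I"
  using additive_subgroup.zero_closed[OF ideal_additive_subgroup] .

lemma ideal_add: "x \<in> I \<Longrightarrow> y \<in> I \<Longrightarrow> x \<oplus> y \<in> I"
  using additive_subgroup.a_closed[OF ideal_additive_subgroup] .

lemma ideal_uminus: "x \<in> I \<Longrightarrow> \<ominus> x \<in> I"
  using additive_subgroup.a_inv_closed[OF ideal_additive_subgroup] .

lemma ideal_mult_l: "x \<in> I \<Longrightarrow> a \<in> carrier A \<Longrightarrow> a \<otimes> x \<in> I"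
  using I by (auto simp: two_sided_ideal_def)

lemma ideal_mult_r: "x \<in> I \<Longrightarrow> a \<in> carrier A \<Longrightarrow> x \<otimes> a \<in> I"
  using I by (auto simp: two_sided_ideal_def)

lemma ideal_ex_nonzero: "I \<noteq> {\<zero>} \<Longrightarrow> \<exists>x\<in>I. x \<noteq> \<zero>"
  using ideal_zero by blast

end

end

text \<open>
  As an inductive set, the span gives an induction principle that spares finite sums: every
  statement about combinations of paths below is proved for one monomial and for a sum.
\<close>
inductive_set lin_span :: "('k, 'a, 'm) module_scheme \<Rightarrow> 'a set \<Rightarrow> 'a set"
  for A and S where
  zero: "\<zero>\<^bsub>A\<^esub> \<in> lin_span A S"
| gen: "s \<in> S \<Longrightarrow> c \<odot>\<^bsub>A\<^esub> s \<in> lin_span A S"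
| add: "\<lbrakk>x \<in> lin_span A S; y \<in> lin_span A S\<rbrakk> \<Longrightarrow> x \<oplus>\<^bsub>A\<^esub> y \<in> lin_span A S"

lemma lin_span_mono:
  assumes "x \<in> lin_span A S" "S \<subseteq> T"
  shows "x \<in> lin_span A T"
  using assms(1) by induct (use assms(2) in \<open>auto intro: lin_span.intros\<close>)

lemma (in nonunital_algebra) lin_span_closed:
  assumes "S \<subseteq> carrier A" "x \<in> lin_span A S"
  shows "x \<in> carrier A"
  using assms(2) by induct (use assms(1) in auto)

lemma (in nonunital_algebra) lin_span_base: "S \<subseteq> carrier A \<Longrightarrow> s \<in> S \<Longrightarrow> s \<in> lin_span A S"
  using lin_span.gen[of s S A 1] by (simp add: subset_iff)

lemma (in nonunital_algebra) lin_span_smult: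
  assumes "S \<subseteq> carrier A" "x \<in> lin_span A S"
  shows "c \<odot> x \<in> lin_span A S"
  using assms(2)
proof induct
  case zero then show ?case by (simp add: lin_span.zero)
next
  case (gen s d)
  then show ?case using assms(1) smult_smult[of s c d] lin_span.gen[of s S A "c * d"] by auto
next
  case (add x y)
  then show ?case using lin_span_closed[OF assms(1)] by (simp add: smult_r_distr lin_span.add)
qed

context nonunital_algebra
begin

lemma lin_span_mult:
  assumes S: "S \<subseteq> carrier A" and mult: "\<And>x y. x \<in> S \<Longrightarrow> y \<in> S \<Longrightarrow> x \<otimes> y \<in> lin_span A S"
    and x: "x \<in> lin_span A S" and y: "y \<in> lin_span A S"
  shows "x \<otimes> y \<in> lin_span A S"
  using x
proof induct
  case zero
  then show ?case using lin_span_closed[OF S y] by (simp add: lin_span.zero)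
next
  case (gen s c)
  have s: "s \<in> carrier A" using gen S by auto
  have "s \<otimes> y \<in> lin_span A S"
    using y
  proof induct
    case zero then show ?case using s by (simp add: lin_span.zero)
  next
    case (gen t d)
    then have "t \<in> carrier A" using S by auto
    then show ?case using s lin_span_smult[OF S mult[OF \<open>s \<in> S\<close> gen]] by (simp add: smult_mult_r)
  next
    case (add p q)
    then show ?case using s lin_span_closed[OF S] by (simp add: r_distr lin_span.add)
  qed
  then show ?case using s lin_span_closed[OF S y] lin_span_smult[OF S] by (simp add: smult_mult_l)
next
  case (add p q)
  then show ?case using lin_span_closed[OF S] y by (simp add: l_distr lin_span.add)
qed

lemma lin_span_mult_right:
  assumes S: "S \<subseteq> carrier A" and T: "T \<subseteq> carrier A" and b: "b \<in> carrier A"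
    and base: "\<And>s. s \<in> S \<Longrightarrow> s \<otimes> b \<in> lin_span A T" and a: "a \<in> lin_span A S"
  shows "a \<otimes> b \<in> lin_span A T"
  using a
proof induct
  case zero then show ?case using b by (simp add: lin_span.zero)
next
  case (gen s c)
  then have "s \<in> carrier A" using S by blast
  then show ?case using b lin_span_smult[OF T base[OF gen]] by (simp add: smult_mult_l)
next
  case (add x y)
  then show ?case using b lin_span_closed[OF S] by (simp add: l_distr lin_span.add)
qed

lemma lin_span_mult_left:
  assumes S: "S \<subseteq> carrier A" and T: "T \<subseteq> carrier A" and b: "b \<in> carrier A"
    and base: "\<And>s. s \<in> S \<Longrightarrow> b \<otimes> s \<in> lin_span A T" and a: "a \<in> lin_span A S"
  shows "b \<otimes> a \<in> lin_span A T"
  using a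
proof induct
  case zero then show ?case using b by (simp add: lin_span.zero)
next
  case (gen s c)
  then have "s \<in> carrier A" using S by blast
  then show ?case using b lin_span_smult[OF T base[OF gen]] by (simp add: smult_mult_r)
next
  case (add x y)
  then show ?case using b lin_span_closed[OF S] by (simp add: r_distr lin_span.add)
qed

lemma lin_span_commute:
  assumes S: "S \<subseteq> carrier A" and comm: "\<And>s t. s \<in> S \<Longrightarrow> t \<in> S \<Longrightarrow> s \<otimes> t = t \<otimes> s"
    and x: "x \<in> lin_span A S" and y: "y \<in> lin_span A S"
  shows "x \<otimes> y = y \<otimes> x"
  using x
proof induct
  case zero then show ?case using lin_span_closed[OF S y] by simp
next
  case (gen s c)
  have s: "s \<in> carrier A" using gen S by blast
  have "s \<otimes> y = y \<otimes> s"
    using y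
  proof induct
    case zero then show ?case using s by simp
  next
    case (gen t d)
    then have "t \<in> carrier A" using S by blast
    then show ?case using s comm[OF \<open>s \<in> S\<close> gen] by (simp add: smult_mult_l smult_mult_r)
  next
    case (add p q)
    then show ?case using s lin_span_closed[OF S] by (simp add: l_distr r_distr)
  qed
  then show ?case using s lin_span_closed[OF S y] by (simp add: smult_mult_l smult_mult_r)
next
  case (add p q)
  then show ?case using lin_span_closed[OF S] y by (simp add: l_distr r_distr)
qed

lemma lin_span_empty: "x \<in> lin_span A {} \<Longrightarrow> x = \<zero>"
  by (induct rule: lin_span.induct) auto

end

section \<open>Bimodule homomorphisms and the algebraicity of their action\<close>
definition bimodule_homs :: "('a, 'm) ring_scheme \<Rightarrow> 'a set \<Rightarrow> ('a \<Rightarrow> 'a) set" where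
  "bimodule_homs A I =
     {f \<in> right_module_homs A I. \<forall>i\<in>I. \<forall>a\<in>carrier A. f (a \<otimes>\<^bsub>A\<^esub> i) = a \<otimes>\<^bsub>A\<^esub> f i}"

text \<open>
  The relation \<open>f y = y'\<close>, written so that \<open>y\<close> may lie outside the domain \<open>I\<close> of \<open>f\<close>: since \<open>f\<close> is left
  linear, \<open>y (f i) = f (y i)\<close>. In this form it survives the shrinking of domains in sums and products
  of homomorphisms.
\<close>
definition acts :: "('a, 'm) ring_scheme \<Rightarrow> 'a set \<Rightarrow> ('a \<Rightarrow> 'a) \<Rightarrow> 'a \<Rightarrow> 'a \<Rightarrow> bool" where
  "acts A I f y y' \<longleftrightarrow> y \<in> carrier A \<and> y' \<in> carrier A \<and> (\<forall>i\<in>I. y \<otimes>\<^bsub>A\<^esub> f i = y' \<otimes>\<^bsub>A\<^esub> i)"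

text \<open>
  The combination of the values \<open>y\<close> with coefficients from a list, highest index first. This is the
  order of the coefficient lists of \<^const>\<open>ring.eval\<close>.
\<close>
fun comb :: "('k, 'a, 'm) module_scheme \<Rightarrow> 'k list \<Rightarrow> (nat \<Rightarrow> 'a) \<Rightarrow> 'a" where
  "comb A [] y = \<zero>\<^bsub>A\<^esub>"
| "comb A (c # cs) y = (c \<odot>\<^bsub>A\<^esub> y (length cs)) \<oplus>\<^bsub>A\<^esub> comb A cs y"

text \<open>
  The sequence \<open>y, f y, f\<^sup>2 y, \<dots>\<close> of a nonzero \<open>y\<close> satisfies a nontrivial linear relation.
\<close>
definition algebraic_action ::
    "('k :: field, 'a, 'm) module_scheme \<Rightarrow> 'a set \<Rightarrow> ('a \<Rightarrow> 'a) \<Rightarrow> bool" where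
  "algebraic_action A I f \<longleftrightarrow>
     (\<exists>y c. c \<noteq> 0 \<and> (\<forall>j. y j \<in> carrier A) \<and> y 0 \<noteq> \<zero>\<^bsub>A\<^esub> \<and>
        (\<forall>j<Polynomial.degree c. acts A I f (y j) (y (Suc j))) \<and>
        comb A (rev (coeffs c)) y = \<zero>\<^bsub>A\<^esub>)"

lemma (in nonunital_algebra) bimodule_homsD:
  assumes "f \<in> bimodule_homs A I"
  shows "i \<in> I \<Longrightarrow> f i \<in> carrier A"
    and "i \<in> I \<Longrightarrow> j \<in> I \<Longrightarrow> f (i \<oplus> j) = f i \<oplus> f j"
    and "i \<in> I \<Longrightarrow> a \<in> carrier A \<Longrightarrow> f (i \<otimes> a) = f i \<otimes> a"
    and "i \<in> I \<Longrightarrow> a \<in> carrier A \<Longrightarrow> f (a \<otimes> i) = a \<otimes> f i"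
  using assms by (auto simp: bimodule_homs_def right_module_homs_def)

lemma (in nonunital_algebra) acts_self:
  assumes "two_sided_ideal I A" "f \<in> bimodule_homs A I" "y \<in> I"
  shows "acts A I f y (f y)"
  unfolding acts_def using assms bimodule_homsD[OF assms(2)] ideal_carrier[OF assms(1)]
  by (metis)

lemma (in nonunital_algebra) acts_mult_r:
  assumes I: "two_sided_ideal I A" and f: "f \<in> bimodule_homs A I"
    and y: "acts A I f y y'" and r: "r \<in> carrier A"
  shows "acts A I f (y \<otimes> r) (y' \<otimes> r)"
proof -
  have c: "y \<in> carrier A" "y' \<in> carrier A" using y by (auto simp: acts_def)
  have "(y \<otimes> r) \<otimes> f i = (y' \<otimes> r) \<otimes> i" if i: "i \<in> I" for i
  proof -
    have ic: "i \<in> carrier A" "f i \<in> carrier A" "r \<otimes> i \<in> I"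
      using i r ideal_carrier[OF I] bimodule_homsD(1)[OF f] ideal_mult_l[OF I] by auto
    have "(y \<otimes> r) \<otimes> f i = y \<otimes> f (r \<otimes> i)"
      using c r ic i by (simp add: m_assoc bimodule_homsD(4)[OF f])
    also have "\<dots> = y' \<otimes> (r \<otimes> i)" using y ic(3) by (auto simp: acts_def)
    finally show ?thesis using c r ic by (simp add: m_assoc)
  qed
  then show ?thesis using c r by (auto simp: acts_def)
qed

lemma (in nonunital_algebra) algebraic_action_scalar:
  assumes "v \<noteq> \<zero>" "acts A I f v (k \<odot> v)"
  shows "algebraic_action A I f"
proof -
  have v: "v \<in> carrier A" using assms(2) by (simp add: acts_def)
  define y where "y j = (if j = 0 then v else k \<odot> v)" for j :: nat
  have "comb A (rev (coeffs [:- k, 1:])) y = \<zero>"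
  proof -
    have "k \<odot> v \<oplus> (- k) \<odot> v = \<zero>" using smult_l_distr[of v k "- k"] v by simp
    then show ?thesis using v by (simp add: y_def)
  qed
  then show ?thesis unfolding algebraic_action_def
    using assms v by (intro exI[of _ y] exI[of _ "[:- k, 1:]"]) (auto simp: y_def)
qed

locale prime_nonunital_algebra = nonunital_algebra A
  for A :: "('k :: field, 'a, 'm) module_scheme" (structure) +
  assumes nontrivial: "carrier A \<noteq> {\<zero>}"
    and elementwise_prime:
      "\<lbrakk>x \<in> carrier A; y \<in> carrier A; \<And>a. a \<in> carrier A \<Longrightarrow> x \<otimes> a \<otimes> y = \<zero>\<rbrakk> \<Longrightarrow> x = \<zero> \<or> y = \<zero>"
begin

lemma annihilates_ideal:
  assumes I: "two_sided_ideal I A" "I \<noteq> {\<zero>}" and y: "y \<in> carrier A"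
    and ann: "\<And>i. i \<in> I \<Longrightarrow> y \<otimes> i = \<zero>"
  shows "y = \<zero>"
proof -
  obtain i where i: "i \<in> I" "i \<noteq> \<zero>" using ideal_ex_nonzero[OF I] by blast
  have "y \<otimes> a \<otimes> i = \<zero>" if "a \<in> carrier A" for a
    using that y i ann[of "a \<otimes> i"] ideal_carrier[OF I(1)] ideal_mult_l[OF I(1)] by (simp add: m_assoc)
  then show ?thesis using elementwise_prime[of y i] i y ideal_carrier[OF I(1)] by blast
qed

text \<open>
  A bimodule homomorphism that kills one nonzero element kills the ideal generated by it, and in a
  prime algebra it is then zero.
\<close>
lemma acts_zero:
  assumes I: "two_sided_ideal I A" and f: "f \<in> bimodule_homs A I"
    and y: "acts A I f y \<zero>" "y \<noteq> \<zero>" and i: "i \<in> I"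
  shows "f i = \<zero>"
proof -
  have c: "y \<in> carrier A" "f i \<in> carrier A" "i \<in> carrier A"
    using y i ideal_carrier[OF I] bimodule_homsD(1)[OF f] by (auto simp: acts_def)
  have "y \<otimes> a \<otimes> f i = \<zero>" if a: "a \<in> carrier A" for a
  proof -
    have "y \<otimes> a \<otimes> f i = y \<otimes> f (a \<otimes> i)"
      using a i c by (simp add: m_assoc bimodule_homsD(4)[OF f])
    also have "\<dots> = \<zero> \<otimes> (a \<otimes> i)"
      using y ideal_mult_l[OF I i a] by (simp add: acts_def)
    finally show ?thesis using a c by simp
  qed
  then show ?thesis using elementwise_prime[of y "f i"] c y by blast
qed

end

section \<open>Commutative corners generated by one element and its inverse\<close>
text \<open>
  Horner evaluation of a polynomial at \<open>x\<close>, the idempotent \<open>g\<close> serving as the unit.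
\<close>
definition poly_at :: "('k :: field, 'a, 'm) module_scheme \<Rightarrow> 'a \<Rightarrow> 'a \<Rightarrow> 'k poly \<Rightarrow> 'a" where
  "poly_at A g x p = fold_coeffs (\<lambda>c y. (c \<odot>\<^bsub>A\<^esub> g) \<oplus>\<^bsub>A\<^esub> (x \<otimes>\<^bsub>A\<^esub> y)) p \<zero>\<^bsub>A\<^esub>"

locale pointed_corner = nonunital_algebra A
  for A :: "('k :: field, 'a, 'm) module_scheme" (structure) +
  fixes g x
  assumes g_closed [simp, intro]: "g \<in> carrier A" and g_idem [simp]: "g \<otimes> g = g"
    and x_closed [simp, intro]: "x \<in> carrier A" and g_x [simp]: "g \<otimes> x = x" and x_g [simp]: "x \<otimes> g = x"
begin

abbreviation ev where "ev p \<equiv> poly_at A g x p"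

lemma ev_0 [simp]: "ev 0 = \<zero>"
  by (simp add: poly_at_def)

lemma ev_pCons: "ev (pCons a p) = a \<odot> g \<oplus> x \<otimes> ev p"
proof (cases "a = 0 \<and> p = 0")
  case True then show ?thesis by simp
next
  case False then show ?thesis by (cases "p = 0") (simp_all add: poly_at_def)
qed

lemma ev_closed [simp, intro]: "ev p \<in> carrier A"
  by (induct p) (auto simp: ev_pCons)

lemma g_ev [simp]: "g \<otimes> ev p = ev p"
  by (induct p) (auto simp: ev_pCons r_distr smult_mult_r m_assoc[symmetric])

lemma ev_g [simp]: "ev p \<otimes> g = ev p"
  by (induct p) (auto simp: ev_pCons l_distr smult_mult_l m_assoc)

lemma ev_add: "ev (p + q) = ev p \<oplus> ev q"
proof (induct p arbitrary: q)
  case 0 then show ?case by simp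
next
  case (pCons a p)
  obtain b r where q: "q = pCons b r" by (cases q)
  have "ev (pCons a p + q) = (a \<odot> g \<oplus> b \<odot> g) \<oplus> (x \<otimes> ev p \<oplus> x \<otimes> ev r)"
    by (simp add: q ev_pCons pCons smult_l_distr r_distr)
  also have "\<dots> = (a \<odot> g \<oplus> x \<otimes> ev p) \<oplus> (b \<odot> g \<oplus> x \<otimes> ev r)"
    by (simp add: a_ac)
  finally show ?case by (simp add: q ev_pCons)
qed

lemma ev_smult: "ev (Polynomial.smult c p) = c \<odot> ev p"
  by (induct p) (auto simp: ev_pCons smult_r_distr smult_smult smult_mult_r)

lemma ev_mult: "ev (p * q) = ev p \<otimes> ev q"
proof (induct p)
  case 0 then show ?case by simp
next
  case (pCons a p)
  have "ev (pCons a p * q) = a \<odot> ev q \<oplus> x \<otimes> (ev p \<otimes> ev q)"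
    by (simp add: ev_add ev_smult ev_pCons pCons)
  also have "\<dots> = (a \<odot> g \<oplus> x \<otimes> ev p) \<otimes> ev q"
    by (simp add: l_distr smult_mult_l m_assoc)
  finally show ?case by (simp add: ev_pCons)
qed

lemma ev_1 [simp]: "ev 1 = g"
  by (simp add: one_pCons ev_pCons)

lemma ev_X [simp]: "ev [:0, 1:] = x"
  by (simp add: ev_pCons)

lemma ev_monom_add:
  "ev (Polynomial.monom 1 (m + n)) = ev (Polynomial.monom 1 m) \<otimes> ev (Polynomial.monom 1 n)"
  by (simp add: ev_mult[symmetric] mult_monom)

lemma comb_rev_ev:
  "comb A (rev cs) (\<lambda>j. ev (q j)) = ev (\<Sum>i<length cs. Polynomial.smult (cs ! i) (q i))"
proof (induct cs rule: rev_induct)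
  case Nil then show ?case by simp
next
  case (snoc c cs)
  have "(\<Sum>i<length cs. Polynomial.smult ((cs @ [c]) ! i) (q i)) =
        (\<Sum>i<length cs. Polynomial.smult (cs ! i) (q i))"
    by (rule sum.cong) (auto simp: nth_append)
  then show ?case using snoc by (simp add: ev_add ev_smult a_comm)
qed

end

text \<open>
  The corner \<open>g A g\<close> is commutative, and a power of \<open>x\<close> brings each of its elements into the image of
  \<open>K[x]\<close>. Examples are \<open>K g\<close>, with \<open>x = g\<close>, and quotients of \<open>K[x, 1/x]\<close>.
\<close>
locale monogenic_corner = prime_nonunital_algebra A + pointed_corner A g x
  for A :: "('k :: field, 'a, 'm) module_scheme" (structure) and g x +
  assumes g_nonzero: "g \<noteq> \<zero>" and x_nonzero: "x \<noteq> \<zero>"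
    and corner_comm: "\<lbrakk>y \<in> carrier A; z \<in> carrier A\<rbrakk> \<Longrightarrow>
           (g \<otimes> y \<otimes> g) \<otimes> (g \<otimes> z \<otimes> g) = (g \<otimes> z \<otimes> g) \<otimes> (g \<otimes> y \<otimes> g)"
    and corner_fraction: "y \<in> carrier A \<Longrightarrow>
           \<exists>n p. poly_at A g x (Polynomial.monom 1 n) \<otimes> (g \<otimes> y \<otimes> g) = poly_at A g x p"
begin

definition corner :: "'a set" where
  "corner = {y \<in> carrier A. g \<otimes> y = y \<and> y \<otimes> g = y}"

lemma cornerD:
  assumes "y \<in> corner"
  shows "y \<in> carrier A" "g \<otimes> y = y" "y \<otimes> g = y" "g \<otimes> y \<otimes> g = y"
  using assms by (auto simp: corner_def)

lemma cornerI: "y \<in> carrier A \<Longrightarrow> g \<otimes> y \<otimes> g \<in> corner"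
  by (auto simp: corner_def m_assoc[symmetric]) (simp add: m_assoc)

lemma ev_corner [simp, intro]: "ev p \<in> corner"
  by (auto simp: corner_def)

lemma corner_mult: "y \<in> corner \<Longrightarrow> z \<in> corner \<Longrightarrow> y \<otimes> z \<in> corner"
  by (auto simp: corner_def m_assoc[symmetric]) (simp add: m_assoc)

lemma corner_commute: "y \<in> corner \<Longrightarrow> z \<in> corner \<Longrightarrow> y \<otimes> z = z \<otimes> y"
  using corner_comm[of y z] by (simp add: cornerD)

lemma corner_fractionE:
  assumes "y \<in> corner"
  obtains n p where "ev (Polynomial.monom 1 n) \<otimes> y = ev p"
  using corner_fraction[of y] assms by (auto simp: cornerD)

text \<open>
  Because the corner is commutative, \<open>y a z = (g a g) (y z)\<close> for all \<open>a\<close>, and primeness applies.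
\<close>
lemma corner_domain:
  assumes y: "y \<in> corner" and z: "z \<in> corner" and yz: "y \<otimes> z = \<zero>"
  shows "y = \<zero> \<or> z = \<zero>"
proof (rule elementwise_prime)
  fix a assume a: "a \<in> carrier A"
  have c: "g \<otimes> a \<otimes> g \<in> corner" using a by (rule cornerI)
  have "y \<otimes> a \<otimes> z = (y \<otimes> g) \<otimes> a \<otimes> (g \<otimes> z)" using y z by (simp add: cornerD)
  also have "\<dots> = y \<otimes> (g \<otimes> a \<otimes> g) \<otimes> z" using a cornerD(1)[OF y] cornerD(1)[OF z] by (simp add: m_assoc)
  also have "\<dots> = (g \<otimes> a \<otimes> g) \<otimes> (y \<otimes> z)"
    using corner_commute[OF y c] cornerD(1)[OF y] cornerD(1)[OF z] a by (simp add: m_assoc)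
  finally show "y \<otimes> a \<otimes> z = \<zero>" using a yz by simp
qed (use y z cornerD in auto)

lemma ev_power_nonzero: "ev p \<noteq> \<zero> \<Longrightarrow> ev (p ^ n) \<noteq> \<zero>"
  by (induct n) (use g_nonzero corner_domain in \<open>auto simp: ev_mult\<close>)

lemma ev_monom_nonzero: "ev (Polynomial.monom 1 n) \<noteq> \<zero>"
  using ev_power_nonzero[of "[:0, 1:]" n] x_nonzero by (simp add: monom_altdef)

lemma ev_monom_mult_nonzero: "y \<in> corner \<Longrightarrow> y \<noteq> \<zero> \<Longrightarrow> ev (Polynomial.monom 1 n) \<otimes> y \<noteq> \<zero>"
  using corner_domain[OF ev_corner] ev_monom_nonzero by blast

lemma ex_corner_multiple_nonzero:
  assumes y: "y \<in> carrier A" "y \<noteq> \<zero>"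
  shows "\<exists>s\<in>carrier A. \<exists>t\<in>carrier A. g \<otimes> (s \<otimes> y \<otimes> t) \<otimes> g \<noteq> \<zero>"
proof -
  obtain s where s: "s \<in> carrier A" "g \<otimes> s \<otimes> y \<noteq> \<zero>"
    using elementwise_prime[of g y] g_nonzero y by blast
  obtain t where t: "t \<in> carrier A" "(g \<otimes> s \<otimes> y) \<otimes> t \<otimes> g \<noteq> \<zero>"
    using elementwise_prime[of "g \<otimes> s \<otimes> y" g] g_nonzero s y by blast
  have "(g \<otimes> s \<otimes> y) \<otimes> t \<otimes> g = g \<otimes> (s \<otimes> y \<otimes> t) \<otimes> g"
    using s t y by (simp add: m_assoc)
  then show ?thesis using s t by auto
qed

text \<open>
  The ideal \<open>I\<close> meets the corner in some \<open>b \<noteq> 0\<close>, and \<open>h b\<close> lies in the corner as well. After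
  multiplication by a power of \<open>x\<close> both are polynomials \<open>q\<close> and \<open>q'\<close> in \<open>x\<close>, so \<open>h\<close> is multiplication
  by the fraction \<open>q' / q\<close>. The powers of this fraction lie in the fraction field of a finite
  dimensional domain. Homogenising the relation between them avoids the inversion of \<open>q\<close>.
\<close>
theorem algebraic_action_if_algebraic:
  assumes f: "f \<noteq> 0" "ev f = \<zero>"
    and I: "two_sided_ideal I A" "I \<noteq> {\<zero>}" and h: "h \<in> bimodule_homs A I"
  shows "algebraic_action A I h"
proof -
  note hD = bimodule_homsD[OF h]
  obtain i where i: "i \<in> I" "i \<noteq> \<zero>" using ideal_ex_nonzero[OF I] by blast
  then obtain s t where st: "s \<in> carrier A" "t \<in> carrier A" and nz: "g \<otimes> (s \<otimes> i \<otimes> t) \<otimes> g \<noteq> \<zero>"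
    using ex_corner_multiple_nonzero ideal_carrier[OF I(1)] by blast
  define b where "b = g \<otimes> (s \<otimes> i \<otimes> t) \<otimes> g"
  have bI: "b \<in> I" unfolding b_def
    using st i by (intro ideal_mult_l[OF I(1)] ideal_mult_r[OF I(1)]) auto
  have bc: "b \<in> corner" unfolding b_def
    using st i ideal_carrier[OF I(1)] by (intro cornerI) auto
  have "h b \<in> corner"
    using bI bc hD(1,3,4)[of b] cornerD[OF bc] by (simp add: corner_def) (metis g_closed)
  then obtain m p' where p': "ev (Polynomial.monom 1 m) \<otimes> h b = ev p'" by (rule corner_fractionE)
  obtain n p where p: "ev (Polynomial.monom 1 n) \<otimes> b = ev p" using bc by (rule corner_fractionE)
  define q where "q = Polynomial.monom 1 m * p"
  define q' where "q' = Polynomial.monom 1 n * p'"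
  have hb: "h b \<in> carrier A" "b \<in> carrier A" using bI hD(1) ideal_carrier[OF I(1)] by auto
  have q: "ev q = ev (Polynomial.monom 1 m * Polynomial.monom 1 n) \<otimes> b"
    using hb by (simp add: q_def ev_mult p[symmetric] m_assoc)
  have q': "ev q' = ev (Polynomial.monom 1 m * Polynomial.monom 1 n) \<otimes> h b"
    using hb by (subst mult.commute) (simp add: q'_def ev_mult p'[symmetric] m_assoc)
  have qI: "ev q \<in> I" unfolding q by (intro ideal_mult_l[OF I(1)] bI) auto
  have hq: "h (ev q) = ev q'" unfolding q q' using hD(4)[OF bI] by simp
  have q0: "ev q \<noteq> \<zero>"
    unfolding q mult_monom using nz bc by (simp add: ev_monom_mult_nonzero b_def[symmetric])
  define d where "d = Polynomial.degree f"
  \<comment> \<open>\<open>h\<close> maps the \<open>j\<close>-th of these to the next one, as \<open>h^j (q^d)\<close> is \<open>q'^j q^(d-j)\<close>.\<close>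
  define u where "u j = q' ^ j * q ^ (d - j)" for j
  define y where "y j = ev (u j)" for j
  obtain c where c: "c \<noteq> 0" "Polynomial.degree c \<le> d"
      "f dvd (\<Sum>i\<le>Polynomial.degree c. Polynomial.smult (Polynomial.coeff c i) (u i))"
    using exists_relation_modulo_poly[OF f(1), of u] by (auto simp: d_def)
  have "acts A I h (y j) (y (Suc j))" if j: "j < d" for j
  proof -
    have d: "d - j = Suc (d - Suc j)" using j by simp
    have "acts A I h (ev q \<otimes> ev (q' ^ j * q ^ (d - Suc j))) (ev q' \<otimes> ev (q' ^ j * q ^ (d - Suc j)))"
      using acts_self[OF I(1) h qI] hq by (intro acts_mult_r[OF I(1) h]) auto
    then show ?thesis
      by (simp only: ev_mult[symmetric] y_def u_def d power_Suc mult_ac)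
  qed
  moreover have "y 0 \<noteq> \<zero>" using ev_power_nonzero[OF q0] by (simp add: y_def u_def)
  moreover have "comb A (rev (coeffs c)) y = \<zero>"
  proof -
    have "comb A (rev (coeffs c)) y =
          ev (\<Sum>i<length (coeffs c). Polynomial.smult (coeffs c ! i) (u i))"
      unfolding y_def by (rule comb_rev_ev)
    also have "(\<Sum>i<length (coeffs c). Polynomial.smult (coeffs c ! i) (u i)) =
        (\<Sum>i\<le>Polynomial.degree c. Polynomial.smult (Polynomial.coeff c i) (u i))"
      using c(1) by (intro sum.cong) (auto simp: length_coeffs_degree coeffs_nth)
    finally show ?thesis using c(3) f(2) by (auto simp: dvd_def ev_mult)
  qed
  ultimately show ?thesis unfolding algebraic_action_def
    using c by (intro exI[of _ y] exI[of _ c]) (auto simp: y_def)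
qed

text \<open>
  Some \<open>b = g s a t g\<close> is nonzero. It equals \<open>p\<close> divided by a power of \<open>x\<close>, and an irreducible
  polynomial \<open>f\<close> that divides neither \<open>p\<close> nor \<open>X\<close> generates a prime ideal \<open>M\<close> of the corner without
  \<open>b\<close>. The ideal \<open>Q\<close> of those \<open>y\<close> for which all \<open>g s y t g\<close> lie in \<open>M\<close> is prime in \<open>A\<close>, contains \<open>f(x)\<close>,
  which is nonzero by transcendence, and does not contain \<open>a\<close>.
\<close>
theorem ex_prime_avoiding_if_transcendental:
  assumes trans: "\<And>f. ev f = \<zero> \<Longrightarrow> f = 0"
    and a: "a \<in> carrier A" "a \<noteq> \<zero>"
  shows "\<exists>Q. prime_two_sided_ideal Q A \<and> Q \<noteq> {\<zero>} \<and> a \<notin> Q"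
proof -
  have ev_inj: "p = q" if "ev p = ev q" for p q
  proof -
    have "ev (p + Polynomial.smult (- 1) q) = \<zero>"
      using that by (simp only: ev_add ev_smult uminus_smult[symmetric] ev_closed r_neg)
    from trans[OF this] show ?thesis by simp
  qed
  obtain s t where st: "s \<in> carrier A" "t \<in> carrier A" and nz: "g \<otimes> (s \<otimes> a \<otimes> t) \<otimes> g \<noteq> \<zero>"
    using ex_corner_multiple_nonzero[OF a] by blast
  define b where "b = g \<otimes> (s \<otimes> a \<otimes> t) \<otimes> g"
  have bc: "b \<in> corner" unfolding b_def using st a by (intro cornerI) auto
  obtain n p where p: "ev (Polynomial.monom 1 n) \<otimes> b = ev p" using bc by (rule corner_fractionE)
  have "p \<noteq> 0"
    using p nz ev_monom_mult_nonzero[OF bc, of n] by (auto simp: b_def[symmetric])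
  then obtain f where f: "prime_elem f" "\<not> f dvd [:0, 1:]" "\<not> f dvd p"
    using exists_prime_poly_avoiding by blast
  have f_monom: "\<not> f dvd Polynomial.monom 1 k" for k
    using f(1,2) prime_elem_dvd_power[of f "[:0, 1:]" k] by (auto simp: monom_altdef)
  define M where "M = {y \<in> corner. \<exists>n r. ev (Polynomial.monom 1 n) \<otimes> y = ev (f * r)}"
  have M_dvd: "f dvd q" if yM: "y \<in> M" and yq: "ev (Polynomial.monom 1 n) \<otimes> y = ev q" for y n q
  proof -
    obtain m r where mr: "ev (Polynomial.monom 1 m) \<otimes> y = ev (f * r)" and y: "y \<in> carrier A"
      using yM by (auto simp: M_def corner_def)
    have "ev (Polynomial.monom 1 m * q) = ev (Polynomial.monom 1 m * Polynomial.monom 1 n) \<otimes> y"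
      using y by (simp only: ev_mult yq[symmetric] m_assoc ev_closed)
    also have "\<dots> = ev (Polynomial.monom 1 n * (f * r))"
      using y mr by (subst mult.commute) (simp add: ev_mult m_assoc)
    finally have "Polynomial.monom 1 m * q = Polynomial.monom 1 n * (f * r)" by (rule ev_inj)
    then have "f dvd Polynomial.monom 1 m * q" by simp
    then show ?thesis using prime_elem_dvd_multD[OF f(1)] f_monom by blast
  qed
  have b_notin: "b \<notin> M" using M_dvd p f(3) by blast
  have M_prime: "y \<in> M \<or> z \<in> M" if yz: "y \<in> corner" "z \<in> corner" "y \<otimes> z \<in> M" for y z
  proof -
    obtain m q where q: "ev (Polynomial.monom 1 m) \<otimes> y = ev q" using yz(1) by (rule corner_fractionE)
    obtain n r where r: "ev (Polynomial.monom 1 n) \<otimes> z = ev r" using yz(2) by (rule corner_fractionE)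
    have c: "y \<in> carrier A" "z \<in> carrier A" using yz cornerD by auto
    have "ev (Polynomial.monom 1 (m + n)) \<otimes> (y \<otimes> z) =
          ev (Polynomial.monom 1 m) \<otimes> (ev (Polynomial.monom 1 n) \<otimes> y) \<otimes> z"
      using c by (simp add: m_assoc ev_monom_add)
    also have "\<dots> = (ev (Polynomial.monom 1 m) \<otimes> y) \<otimes> (ev (Polynomial.monom 1 n) \<otimes> z)"
      using c corner_commute[OF ev_corner[of "Polynomial.monom 1 n"] yz(1)] by (simp add: m_assoc)
    also have "\<dots> = ev (q * r)" by (simp add: q r ev_mult)
    finally have "f dvd q * r" by (rule M_dvd[OF yz(3)])
    then have "f dvd q \<or> f dvd r" using prime_elem_dvd_multD[OF f(1)] by blast
    then show ?thesis using yz q r by (auto simp: M_def dvd_def)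
  qed
  have M_zero: "\<zero> \<in> M" by (auto simp: M_def corner_def intro!: exI[of _ 0])
  have M_add: "y \<oplus> z \<in> M" if yz: "y \<in> M" "z \<in> M" for y z
  proof -
    obtain m q where q: "ev (Polynomial.monom 1 m) \<otimes> y = ev (f * q)" using yz(1) by (auto simp: M_def)
    obtain n r where r: "ev (Polynomial.monom 1 n) \<otimes> z = ev (f * r)" using yz(2) by (auto simp: M_def)
    have c: "y \<in> corner" "z \<in> corner" "y \<in> carrier A" "z \<in> carrier A"
      using yz by (auto simp: M_def corner_def)
    have 1: "ev (Polynomial.monom 1 n * Polynomial.monom 1 m) \<otimes> y = ev (f * (Polynomial.monom 1 n * q))"
      using c by (simp only: ev_mult m_assoc ev_closed q mult.left_commute[of f "Polynomial.monom 1 n" q])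
    have 2: "ev (Polynomial.monom 1 n * Polynomial.monom 1 m) \<otimes> z = ev (f * (Polynomial.monom 1 m * r))"
      using c by (subst mult.commute) (simp only: ev_mult m_assoc ev_closed r mult.left_commute[of f "Polynomial.monom 1 m" r])
    have "ev (Polynomial.monom 1 (n + m)) \<otimes> (y \<oplus> z) =
        ev (f * (Polynomial.monom 1 n * q + Polynomial.monom 1 m * r))"
      using c 1 2 by (simp add: mult_monom r_distr distrib_left ev_add)
    moreover have "y \<oplus> z \<in> corner" using c by (auto simp: corner_def r_distr l_distr)
    ultimately show ?thesis by (auto simp: M_def)
  qed
  have M_mult: "c \<otimes> y \<in> M" if yM: "y \<in> M" and cc: "c \<in> corner" for y c
  proof -
    obtain m q where q: "ev (Polynomial.monom 1 m) \<otimes> y = ev (f * q)" and y: "y \<in> corner"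
      using yM by (auto simp: M_def)
    obtain n r where r: "ev (Polynomial.monom 1 n) \<otimes> c = ev r" using cc by (rule corner_fractionE)
    have c: "y \<in> carrier A" "c \<in> carrier A" using y cc cornerD by auto
    have "ev (Polynomial.monom 1 (n + m)) \<otimes> (c \<otimes> y) =
          ev (Polynomial.monom 1 n) \<otimes> (ev (Polynomial.monom 1 m) \<otimes> c) \<otimes> y"
      using c by (simp add: m_assoc ev_monom_add)
    also have "\<dots> = (ev (Polynomial.monom 1 n) \<otimes> c) \<otimes> (ev (Polynomial.monom 1 m) \<otimes> y)"
      using c corner_commute[OF ev_corner[of "Polynomial.monom 1 m"] cc] by (simp add: m_assoc)
    also have "\<dots> = ev (f * (r * q))" by (simp add: q r ev_mult[symmetric] mult_ac)
    finally show ?thesis using corner_mult[OF cc y] by (auto simp: M_def)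
  qed
  have M_minus: "\<ominus> y \<in> M" if "y \<in> M" for y
  proof -
    have "ev [:- 1:] \<otimes> y \<in> M" by (rule M_mult[OF that]) auto
    then show ?thesis
      using that by (simp add: ev_pCons smult_mult_l M_def corner_def uminus_smult)
  qed
  define Q where "Q = {y \<in> carrier A. \<forall>s\<in>carrier A. \<forall>t\<in>carrier A. g \<otimes> (s \<otimes> y \<otimes> t) \<otimes> g \<in> M}"
  have Qid: "two_sided_ideal Q A"
  proof (rule two_sided_idealI)
    show "\<zero> \<in> Q" by (auto simp: Q_def M_zero)
    show "y \<oplus> z \<in> Q" if "y \<in> Q" "z \<in> Q" for y z
      using that M_add by (auto simp: Q_def l_distr r_distr)
    show "\<ominus> y \<in> Q" if "y \<in> Q" for y
      using that M_minus by (auto simp: Q_def l_minus r_minus)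
    show "c \<otimes> y \<in> Q" if y: "y \<in> Q" and c: "c \<in> carrier A" for y c
    proof -
      have "g \<otimes> (s \<otimes> (c \<otimes> y) \<otimes> t) \<otimes> g = g \<otimes> ((s \<otimes> c) \<otimes> y \<otimes> t) \<otimes> g"
        if "s \<in> carrier A" "t \<in> carrier A" for s t
        using that y c by (simp add: m_assoc Q_def)
      then show ?thesis using y c by (simp add: Q_def)
    qed
    show "y \<otimes> c \<in> Q" if y: "y \<in> Q" and c: "c \<in> carrier A" for y c
    proof -
      have "g \<otimes> (s \<otimes> (y \<otimes> c) \<otimes> t) \<otimes> g = g \<otimes> (s \<otimes> y \<otimes> (c \<otimes> t)) \<otimes> g"
        if "s \<in> carrier A" "t \<in> carrier A" for s t
        using that y c by (simp add: m_assoc Q_def)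
      then show ?thesis using y c by (simp add: Q_def)
    qed
  qed (auto simp: Q_def)
  have aQ: "a \<notin> Q" using b_notin st by (auto simp: Q_def b_def)
  have fQ: "ev f \<in> Q"
  proof -
    have "g \<otimes> (s \<otimes> ev f \<otimes> t) \<otimes> g \<in> M" if st: "s \<in> carrier A" "t \<in> carrier A" for s t
    proof -
      have "ev (Polynomial.monom 1 0) \<otimes> ev f = ev (f * 1)" by (simp add: ev_mult)
      then have fM: "ev f \<in> M" unfolding M_def using ev_corner by blast
      have "g \<otimes> (s \<otimes> ev f \<otimes> t) \<otimes> g = g \<otimes> (s \<otimes> (g \<otimes> ev f \<otimes> g) \<otimes> t) \<otimes> g" by simp
      also have "\<dots> = (g \<otimes> s \<otimes> g) \<otimes> (ev f \<otimes> (g \<otimes> t \<otimes> g))"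
        using st by (simp add: m_assoc del: g_ev ev_g)
      also have "\<dots> = (g \<otimes> s \<otimes> g) \<otimes> ((g \<otimes> t \<otimes> g) \<otimes> ev f)"
        using corner_commute[OF ev_corner cornerI[OF st(2)], of f] by simp
      also have "\<dots> \<in> M" using st by (intro M_mult fM cornerI) auto
      finally show ?thesis .
    qed
    then show ?thesis by (auto simp: Q_def)
  qed
  have "Q \<noteq> {\<zero>}" using fQ trans[of f] f(1) by auto
  moreover have "prime_two_sided_ideal Q A"
    unfolding prime_two_sided_ideal_def
  proof (intro conjI allI impI)
    show "Q \<noteq> carrier A" using aQ a by blast
    fix I J assume I: "two_sided_ideal I A" and J: "two_sided_ideal J A" and IJ: "I \<cdot> J \<subseteq> Q"
    \<comment> \<open>An ideal that is not contained in \<open>Q\<close> has a corner element outside \<open>M\<close>.\<close>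
    have ex: "\<exists>i\<in>H. i \<in> corner \<and> i \<notin> M" if H: "two_sided_ideal H A" and nH: "\<not> H \<subseteq> Q" for H
    proof -
      obtain i where i: "i \<in> H" "i \<notin> Q" using nH by blast
      have ic: "i \<in> carrier A" using i ideal_carrier[OF H] by blast
      then obtain s t where st: "s \<in> carrier A" "t \<in> carrier A" "g \<otimes> (s \<otimes> i \<otimes> t) \<otimes> g \<notin> M"
        using i by (auto simp: Q_def)
      moreover have "g \<otimes> (s \<otimes> i \<otimes> t) \<otimes> g \<in> H"
        using st i by (intro ideal_mult_l[OF H] ideal_mult_r[OF H]) auto
      ultimately show ?thesis using ic by (intro bexI[of _ "g \<otimes> (s \<otimes> i \<otimes> t) \<otimes> g"]) (auto intro: cornerI)
    qed
    show "I \<subseteq> Q \<or> J \<subseteq> Q"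
    proof (rule ccontr)
      assume "\<not> ?thesis"
      then obtain i j where i: "i \<in> I" "i \<in> corner" "i \<notin> M" and j: "j \<in> J" "j \<in> corner" "j \<notin> M"
        using ex[OF I] ex[OF J] by blast
      have "i \<otimes> j \<in> Q" using IJ i(1) j(1) by (auto intro: ideal_prod.prod)
      then have "g \<otimes> (g \<otimes> (i \<otimes> j) \<otimes> g) \<otimes> g \<in> M" by (auto simp: Q_def)
      moreover have "g \<otimes> (g \<otimes> (i \<otimes> j) \<otimes> g) \<otimes> g = i \<otimes> j"
        using corner_mult[OF i(2) j(2)] by (simp add: cornerD)
      ultimately show False using M_prime i j by auto
    qed
  qed (rule Qid)
  ultimately show ?thesis using aQ by blast
qed

end

section \<open>The extended centroid of a prime algebra\<close>
lemma (in ring) ring_center_subring: "subring (ring_center R) R"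
proof (rule subringI)
  show "ring_center R \<subseteq> carrier R" by (auto simp: ring_center_def)
  show "\<one> \<in> ring_center R" by (auto simp: ring_center_def)
  show "\<ominus> h \<in> ring_center R" if "h \<in> ring_center R" for h
    using that by (auto simp: ring_center_def l_minus r_minus)
  show "h \<otimes> k \<in> ring_center R" if hk: "h \<in> ring_center R" "k \<in> ring_center R" for h k
  proof -
    have c: "h \<in> carrier R" "k \<in> carrier R" using hk by (auto simp: ring_center_def)
    have "h \<otimes> k \<otimes> y = y \<otimes> (h \<otimes> k)" if y: "y \<in> carrier R" for y
    proof -
      have "k \<otimes> y = y \<otimes> k" "h \<otimes> y = y \<otimes> h" using hk y unfolding ring_center_def by blast+
      then show ?thesis using c y by (metis m_assoc)
    qed
    then show ?thesis using c unfolding ring_center_def by blast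
  qed
  show "h \<oplus> k \<in> ring_center R" if hk: "h \<in> ring_center R" "k \<in> ring_center R" for h k
  proof -
    have c: "h \<in> carrier R" "k \<in> carrier R" using hk by (auto simp: ring_center_def)
    have "(h \<oplus> k) \<otimes> y = y \<otimes> (h \<oplus> k)" if y: "y \<in> carrier R" for y
    proof -
      have "k \<otimes> y = y \<otimes> k" "h \<otimes> y = y \<otimes> h" using hk y unfolding ring_center_def by blast+
      then show ?thesis using c y by (simp add: l_distr r_distr)
    qed
    then show ?thesis using c unfolding ring_center_def by blast
  qed
qed

context nonunital_algebra
begin

lemma minus_zero_imp_eq:
  assumes "x \<ominus> y = \<zero>" "x \<in> carrier A" "y \<in> carrier A"
  shows "x = y"
proof -
  have "x = (x \<ominus> y) \<oplus> y" using assms(2,3) by (simp add: a_minus_def a_assoc l_neg)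
  then show ?thesis using assms by simp
qed

lemma ideal_prod_subset:
  assumes "two_sided_ideal I A" "two_sided_ideal J A" "x \<in> I \<cdot> J"
  shows "x \<in> I" "x \<in> J" "x \<in> carrier A"
proof -
  have "x \<in> I \<and> x \<in> J"
    using assms(3)
    by induct (auto intro: ideal_add[OF assms(1)] ideal_add[OF assms(2)] ideal_mult_r[OF assms(1)]
        ideal_mult_l[OF assms(2)] ideal_carrier[OF assms(1)] ideal_carrier[OF assms(2)])
  then show "x \<in> I" "x \<in> J" "x \<in> carrier A" using ideal_carrier[OF assms(1)] by auto
qed

lemma ideal_prod_ideal:
  assumes I: "two_sided_ideal I A" and J: "two_sided_ideal J A"
  shows "two_sided_ideal (I \<cdot> J) A"
proof (rule two_sided_idealI)
  note c = ideal_prod_subset(3)[OF I J]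
  note ic = ideal_carrier[OF I] ideal_carrier[OF J]
  show "I \<cdot> J \<subseteq> carrier A" using c by blast
  have "\<zero> \<otimes> \<zero> \<in> I \<cdot> J" by (intro ideal_prod.prod ideal_zero I J)
  then show "\<zero> \<in> I \<cdot> J" by simp
  show "x \<oplus> y \<in> I \<cdot> J" if "x \<in> I \<cdot> J" "y \<in> I \<cdot> J" for x y using that by (rule ideal_prod.sum)
  show "\<ominus> x \<in> I \<cdot> J" if "x \<in> I \<cdot> J" for x
    using that
  proof induct
    case (prod i j)
    have "(\<ominus> i) \<otimes> j \<in> I \<cdot> J" by (intro ideal_prod.prod ideal_uminus[OF I] prod)
    then show ?case using prod ic by (simp add: l_minus)
  next
    case (sum s t)
    then show ?case using c by (simp add: minus_add ideal_prod.sum)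
  qed
  show "a \<otimes> x \<in> I \<cdot> J" if "x \<in> I \<cdot> J" and a: "a \<in> carrier A" for x a
    using that(1)
  proof induct
    case (prod i j)
    have "(a \<otimes> i) \<otimes> j \<in> I \<cdot> J" by (intro ideal_prod.prod ideal_mult_l[OF I] prod a)
    then show ?case using prod ic a by (simp add: m_assoc)
  next
    case (sum s t)
    then show ?case using c a by (simp add: r_distr ideal_prod.sum)
  qed
  show "x \<otimes> a \<in> I \<cdot> J" if "x \<in> I \<cdot> J" and a: "a \<in> carrier A" for x a
    using that(1)
  proof induct
    case (prod i j)
    have "i \<otimes> (j \<otimes> a) \<in> I \<cdot> J" by (intro ideal_prod.prod ideal_mult_r[OF J] prod a)
    then show ?case using prod ic a by (simp add: m_assoc)
  next
    case (sum s t)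
    then show ?case using c a by (simp add: l_distr ideal_prod.sum)
  qed
qed

lemma ideal_Int:
  assumes I: "two_sided_ideal I A" and J: "two_sided_ideal J A"
  shows "two_sided_ideal (I \<inter> J) A"
  by (rule two_sided_idealI)
    (auto intro: ideal_carrier[OF I] ideal_zero[OF I] ideal_zero[OF J] ideal_add[OF I] ideal_add[OF J]
      ideal_uminus[OF I] ideal_uminus[OF J] ideal_mult_l[OF I] ideal_mult_l[OF J]
      ideal_mult_r[OF I] ideal_mult_r[OF J])

lemma right_module_hom_ideal_prod:
  assumes I: "two_sided_ideal I A" and J: "two_sided_ideal J A"
    and g: "g \<in> right_module_homs A J" and x: "x \<in> J \<cdot> I"
  shows "g x \<in> I"
  using x
proof induct
  case (prod j i)
  then show ?case using g ideal_mult_l[OF I] ideal_carrier[OF I] by (auto simp: right_module_homs_def)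
next
  case (sum s t)
  then show ?case using g ideal_prod_subset(1)[OF J I] ideal_add[OF I]
    by (auto simp: right_module_homs_def)
qed

end

context prime_nonunital_algebra
begin

abbreviation pairs where "pairs \<equiv> martindale_pairs A"
definition frac_class where "frac_class I f = martindale_rel A `` {(I, f)}"
abbreviation Frac where "Frac \<equiv> martindale_ring A"

lemma pairsD:
  assumes "(I, f) \<in> pairs"
  shows "two_sided_ideal I A" "I \<noteq> {\<zero>}" "f \<in> right_module_homs A I"
    "x \<in> I \<Longrightarrow> x \<in> carrier A" "x \<in> I \<Longrightarrow> f x \<in> carrier A"
    "x \<in> I \<Longrightarrow> y \<in> I \<Longrightarrow> f (x \<oplus> y) = f x \<oplus> f y"
    "x \<in> I \<Longrightarrow> a \<in> carrier A \<Longrightarrow> f (x \<otimes> a) = f x \<otimes> a"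
  using assms by (auto simp: martindale_pairs_def right_module_homs_def intro: ideal_carrier)

lemma pairsI:
  assumes "two_sided_ideal I A" "I \<noteq> {\<zero>}" "\<And>x. x \<in> I \<Longrightarrow> f x \<in> carrier A"
    "\<And>x y. x \<in> I \<Longrightarrow> y \<in> I \<Longrightarrow> f (x \<oplus> y) = f x \<oplus> f y"
    "\<And>x a. x \<in> I \<Longrightarrow> a \<in> carrier A \<Longrightarrow> f (x \<otimes> a) = f x \<otimes> a"
  shows "(I, f) \<in> pairs"
  using assms by (auto simp: martindale_pairs_def right_module_homs_def)

lemma ideal_prod_nonzero:
  assumes I: "two_sided_ideal I A" "I \<noteq> {\<zero>}" and J: "two_sided_ideal J A" "J \<noteq> {\<zero>}"
  shows "I \<cdot> J \<noteq> {\<zero>}"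
proof
  assume eq: "I \<cdot> J = {\<zero>}"
  obtain i where i: "i \<in> I" "i \<noteq> \<zero>" using ideal_ex_nonzero[OF I] by blast
  have "i = \<zero>"
    by (rule annihilates_ideal[OF J]) (use i eq ideal_carrier[OF I(1)] in \<open>auto dest: ideal_prod.prod\<close>)
  with i show False by simp
qed

lemma ideal_Int_nonzero:
  assumes I: "two_sided_ideal I A" "I \<noteq> {\<zero>}" and J: "two_sided_ideal J A" "J \<noteq> {\<zero>}"
  shows "I \<inter> J \<noteq> {\<zero>}"
proof
  assume "I \<inter> J = {\<zero>}"
  then have "I \<cdot> J \<subseteq> {\<zero>}" using ideal_prod_subset[OF I(1) J(1)] by blast
  then have "I \<cdot> J = {\<zero>}" using ideal_zero[OF ideal_prod_ideal[OF I(1) J(1)]] by blast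
  with ideal_prod_nonzero[OF I J] show False by simp
qed

text \<open>
  Agreement on any nonzero ideal \<open>H\<close> is enough: \<open>(f x - g x) h = f (x h) - g (x h) = 0\<close> for \<open>h \<in> H\<close>.
  This is where primeness enters the transitivity of the relation.
\<close>
lemma martindale_relI:
  assumes f: "(I, f) \<in> pairs" and g: "(J, g) \<in> pairs"
    and H: "two_sided_ideal H A" "H \<noteq> {\<zero>}" "H \<subseteq> I" "H \<subseteq> J" and eq: "\<And>x. x \<in> H \<Longrightarrow> f x = g x"
  shows "((I, f), (J, g)) \<in> martindale_rel A"
proof -
  have "f x = g x" if x: "x \<in> I" "x \<in> J" for x
  proof -
    have c: "x \<in> carrier A" "f x \<in> carrier A" "g x \<in> carrier A" using x pairsD[OF f] pairsD[OF g] by auto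
    have "f x \<ominus> g x = \<zero>"
    proof (rule annihilates_ideal[OF H(1,2)])
      fix h assume h: "h \<in> H"
      then have hc: "h \<in> carrier A" using ideal_carrier[OF H(1)] by blast
      have "f x \<otimes> h = g x \<otimes> h"
        using eq[OF ideal_mult_l[OF H(1) h c(1)]] pairsD(7)[OF f x(1) hc] pairsD(7)[OF g x(2) hc] by simp
      then show "(f x \<ominus> g x) \<otimes> h = \<zero>"
        using c hc by (simp add: a_minus_def l_distr l_minus r_neg)
    qed (use c in auto)
    from minus_zero_imp_eq[OF this c(2,3)] show ?thesis .
  qed
  then show ?thesis using f g by (auto simp: martindale_rel_def)
qed

lemma equiv_martindale_rel: "equiv pairs (martindale_rel A)"
proof (rule equivI)
  show "martindale_rel A \<subseteq> pairs \<times> pairs" by (auto simp: martindale_rel_def)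
  show "refl_on pairs (martindale_rel A)" by (auto simp: refl_on_def martindale_rel_def)
  show "sym (martindale_rel A)" by (auto simp: sym_def martindale_rel_def)
  show "trans (martindale_rel A)"
  proof (rule transI)
    fix p q r assume pq: "(p, q) \<in> martindale_rel A" and qr: "(q, r) \<in> martindale_rel A"
    obtain I f J g K h where pqr: "p = (I, f)" "q = (J, g)" "r = (K, h)" by (metis surj_pair)
    have P: "(I, f) \<in> pairs" "(J, g) \<in> pairs" "(K, h) \<in> pairs"
      using pq qr by (auto simp: pqr martindale_rel_def)
    have IJ: "two_sided_ideal (I \<inter> J) A" "I \<inter> J \<noteq> {\<zero>}"
      using ideal_Int ideal_Int_nonzero P pairsD by metis+
    have IJK: "two_sided_ideal (I \<inter> J \<inter> K) A" "I \<inter> J \<inter> K \<noteq> {\<zero>}"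
      using ideal_Int[OF IJ(1)] ideal_Int_nonzero[OF IJ] P pairsD by metis+
    show "(p, r) \<in> martindale_rel A"
      unfolding pqr by (rule martindale_relI[OF P(1,3) IJK])
        (use pq qr in \<open>auto simp: pqr martindale_rel_def\<close>)
  qed
qed

lemma frac_eq_iff:
  assumes "(I, f) \<in> pairs" "(J, g) \<in> pairs"
  shows "frac_class I f = frac_class J g \<longleftrightarrow> (\<forall>x\<in>I \<inter> J. f x = g x)"
proof -
  have "frac_class I f = frac_class J g \<longleftrightarrow> ((I, f), (J, g)) \<in> martindale_rel A"
    unfolding frac_class_def by (rule eq_equiv_class_iff[OF equiv_martindale_rel assms])
  also have "\<dots> \<longleftrightarrow> (\<forall>x\<in>I \<inter> J. f x = g x)"
    using assms unfolding martindale_rel_def by blast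
  finally show ?thesis .
qed

lemma frac_eqI:
  assumes "(I, f) \<in> pairs" "(J, g) \<in> pairs" "\<And>x. x \<in> I \<Longrightarrow> x \<in> J \<Longrightarrow> f x = g x"
  shows "frac_class I f = frac_class J g"
  using assms by (simp add: frac_eq_iff)

lemma mem_frac: "(J, g) \<in> frac_class I f \<longleftrightarrow> (I, f) \<in> pairs \<and> (J, g) \<in> pairs \<and> (\<forall>x\<in>I \<inter> J. f x = g x)"
  by (auto simp: frac_class_def martindale_rel_def)

lemma frac_closed [simp]: "(I, f) \<in> pairs \<Longrightarrow> frac_class I f \<in> carrier Frac"
  by (auto simp: martindale_ring_def frac_class_def intro: quotientI)

lemma Frac_cases:
  assumes "z \<in> carrier Frac"
  obtains I f where "(I, f) \<in> pairs" "z = frac_class I f"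
  using assms by (auto simp: martindale_ring_def frac_class_def elim!: quotientE)

lemma comp_pairs:
  assumes f: "(I, f) \<in> pairs" and g: "(J, g) \<in> pairs"
  shows "(J \<cdot> I, f \<circ> g) \<in> pairs"
proof (rule pairsI)
  note I = pairsD(1)[OF f] and J = pairsD(1)[OF g]
  note gI = right_module_hom_ideal_prod[OF I J pairsD(3)[OF g]]
  note JI = ideal_prod_subset[OF J I]
  show "two_sided_ideal (J \<cdot> I) A" by (rule ideal_prod_ideal[OF J I])
  show "J \<cdot> I \<noteq> {\<zero>}" by (rule ideal_prod_nonzero[OF J pairsD(2)[OF g] I pairsD(2)[OF f]])
  show "(f \<circ> g) x \<in> carrier A" if "x \<in> J \<cdot> I" for x using gI[OF that] pairsD[OF f] by simp
  show "(f \<circ> g) (x \<oplus> y) = (f \<circ> g) x \<oplus> (f \<circ> g) y" if "x \<in> J \<cdot> I" "y \<in> J \<cdot> I" for x y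
    using gI[OF that(1)] gI[OF that(2)] pairsD(6)[OF f] pairsD(6)[OF g] JI[OF that(1)] JI[OF that(2)] by simp
  show "(f \<circ> g) (x \<otimes> a) = (f \<circ> g) x \<otimes> a" if "x \<in> J \<cdot> I" "a \<in> carrier A" for x a
    using gI[OF that(1)] that(2) pairsD(7)[OF f] pairsD(7)[OF g] JI[OF that(1)] by simp
qed

lemma plus_pairs:
  assumes f: "(I, f) \<in> pairs" and g: "(J, g) \<in> pairs"
  shows "(I \<inter> J, \<lambda>x. f x \<oplus> g x) \<in> pairs"
proof (rule pairsI)
  note F = pairsD[OF f] and G = pairsD[OF g]
  show "two_sided_ideal (I \<inter> J) A" by (rule ideal_Int[OF F(1) G(1)])
  show "I \<inter> J \<noteq> {\<zero>}" by (rule ideal_Int_nonzero[OF F(1,2) G(1,2)])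
  fix x assume x: "x \<in> I \<inter> J"
  show "f x \<oplus> g x \<in> carrier A" using x F(5) G(5) by simp
  show "f (x \<oplus> y) \<oplus> g (x \<oplus> y) = f x \<oplus> g x \<oplus> (f y \<oplus> g y)" if "y \<in> I \<inter> J" for y
    using x that F(5,6) G(5,6) by (simp add: a_ac)
  show "f (x \<otimes> a) \<oplus> g (x \<otimes> a) = (f x \<oplus> g x) \<otimes> a" if "a \<in> carrier A" for a
    using x that F(5,7) G(5,7) by (simp add: l_distr)
qed

lemma frac_mult:
  assumes f: "(I, f) \<in> pairs" and g: "(J, g) \<in> pairs"
  shows "frac_class I f \<otimes>\<^bsub>Frac\<^esub> frac_class J g = frac_class (J \<cdot> I) (f \<circ> g)"
proof -
  have "frac_class (J' \<cdot> I') (f' \<circ> g') = frac_class (J \<cdot> I) (f \<circ> g)"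
    if "(I', f') \<in> frac_class I f" "(J', g') \<in> frac_class J g" for I' f' J' g'
  proof -
    have P: "(I', f') \<in> pairs" "(J', g') \<in> pairs" and eq: "\<And>x. x \<in> I \<Longrightarrow> x \<in> I' \<Longrightarrow> f x = f' x"
      "\<And>x. x \<in> J \<Longrightarrow> x \<in> J' \<Longrightarrow> g x = g' x"
      using that by (auto simp: mem_frac)
    show ?thesis
    proof (rule frac_eqI[OF comp_pairs[OF P] comp_pairs[OF f g]])
      fix x assume x': "x \<in> J' \<cdot> I'" and x: "x \<in> J \<cdot> I"
      have "g x = g' x"
        using eq(2) ideal_prod_subset(1)[OF _ _ x] ideal_prod_subset(1)[OF _ _ x'] pairsD(1) P f g by metis
      moreover have "g x \<in> I" "g' x \<in> I'"
        using right_module_hom_ideal_prod[OF _ _ _ x] right_module_hom_ideal_prod[OF _ _ _ x'] pairsD(1,3) P f g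
        by metis+
      ultimately show "(f' \<circ> g') x = (f \<circ> g) x" using eq(1) by simp
    qed
  qed
  then have "(\<Union>p\<in>frac_class I f. \<Union>q\<in>frac_class J g. frac_class (fst q \<cdot> fst p) (snd p \<circ> snd q)) =
      (\<Union>p\<in>frac_class I f. \<Union>q\<in>frac_class J g. frac_class (J \<cdot> I) (f \<circ> g))"
    by (intro SUP_cong refl) (metis prod.collapse)
  moreover have "(I, f) \<in> frac_class I f" "(J, g) \<in> frac_class J g" using f g by (auto simp: mem_frac)
  ultimately show ?thesis by (auto simp: martindale_ring_def split_def frac_class_def)
qed

lemma frac_add:
  assumes f: "(I, f) \<in> pairs" and g: "(J, g) \<in> pairs"
  shows "frac_class I f \<oplus>\<^bsub>Frac\<^esub> frac_class J g = frac_class (I \<inter> J) (\<lambda>x. f x \<oplus> g x)"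
proof -
  have "frac_class (I' \<inter> J') (\<lambda>x. f' x \<oplus> g' x) = frac_class (I \<inter> J) (\<lambda>x. f x \<oplus> g x)"
    if "(I', f') \<in> frac_class I f" "(J', g') \<in> frac_class J g" for I' f' J' g'
    using that f g by (intro frac_eqI plus_pairs) (auto simp: mem_frac)
  then have "(\<Union>p\<in>frac_class I f. \<Union>q\<in>frac_class J g. frac_class (fst p \<inter> fst q) (\<lambda>x. snd p x \<oplus> snd q x)) =
      (\<Union>p\<in>frac_class I f. \<Union>q\<in>frac_class J g. frac_class (I \<inter> J) (\<lambda>x. f x \<oplus> g x))"
    by (intro SUP_cong refl) (metis prod.collapse)
  moreover have "(I, f) \<in> frac_class I f" "(J, g) \<in> frac_class J g" using f g by (auto simp: mem_frac)
  ultimately show ?thesis by (auto simp: martindale_ring_def split_def frac_class_def)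
qed

lemma id_pair: "(carrier A, \<lambda>x. x) \<in> pairs"
  and zero_pair: "(carrier A, \<lambda>x. \<zero>) \<in> pairs"
  and smult_pair: "(carrier A, \<lambda>x. c \<odot> x) \<in> pairs"
  and left_mult_pair: "a \<in> carrier A \<Longrightarrow> (carrier A, \<lambda>x. a \<otimes> x) \<in> pairs"
  using nontrivial
  by (auto intro!: pairsI two_sided_ideal_carrier simp: smult_r_distr smult_mult_l r_distr m_assoc)

lemma uminus_pair: "(I, f) \<in> pairs \<Longrightarrow> (I, \<lambda>x. \<ominus> f x) \<in> pairs"
  using pairsD[of I f] by (intro pairsI) (auto simp: minus_add l_minus)

lemma Frac_one: "\<one>\<^bsub>Frac\<^esub> = frac_class (carrier A) (\<lambda>x. x)"
  and Frac_zero: "\<zero>\<^bsub>Frac\<^esub> = frac_class (carrier A) (\<lambda>x. \<zero>)"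
  by (simp_all add: martindale_ring_def frac_class_def)

text \<open>
  By the formulas for sums and products of classes, each ring axiom is an identity of functions
  that holds pointwise on the intersection of the two domains.
\<close>
lemma ring_martindale_ring: "ring Frac"
proof (rule ringI)
  show "abelian_group Frac"
  proof (rule abelian_groupI)
    show "\<zero>\<^bsub>Frac\<^esub> \<in> carrier Frac" using zero_pair by (simp add: Frac_zero)
  next
    fix y z assume "y \<in> carrier Frac" "z \<in> carrier Frac"
    then obtain I f J g where f: "(I, f) \<in> pairs" "y = frac_class I f" and g: "(J, g) \<in> pairs" "z = frac_class J g"
      by (elim Frac_cases)
    show "y \<oplus>\<^bsub>Frac\<^esub> z \<in> carrier Frac"
      unfolding f g by (simp only: frac_add f(1) g(1) plus_pairs frac_closed)
    show "y \<oplus>\<^bsub>Frac\<^esub> z = z \<oplus>\<^bsub>Frac\<^esub> y"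
      unfolding f g frac_add[OF f(1) g(1)] frac_add[OF g(1) f(1)]
      by (rule frac_eqI[OF plus_pairs[OF f(1) g(1)] plus_pairs[OF g(1) f(1)]])
        (simp add: a_comm pairsD(5)[OF f(1)] pairsD(5)[OF g(1)])
  next
    fix y z w assume "y \<in> carrier Frac" "z \<in> carrier Frac" "w \<in> carrier Frac"
    then obtain I f J g K h where f: "(I, f) \<in> pairs" "y = frac_class I f" and g: "(J, g) \<in> pairs" "z = frac_class J g"
      and h: "(K, h) \<in> pairs" "w = frac_class K h"
      by (elim Frac_cases)
    note fg = plus_pairs[OF f(1) g(1)] and gh = plus_pairs[OF g(1) h(1)]
    show "y \<oplus>\<^bsub>Frac\<^esub> z \<oplus>\<^bsub>Frac\<^esub> w = y \<oplus>\<^bsub>Frac\<^esub> (z \<oplus>\<^bsub>Frac\<^esub> w)"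
      unfolding f g h frac_add[OF f(1) g(1)] frac_add[OF g(1) h(1)] frac_add[OF fg h(1)] frac_add[OF f(1) gh]
      by (rule frac_eqI[OF plus_pairs[OF fg h(1)] plus_pairs[OF f(1) gh]])
        (simp add: a_assoc pairsD(5)[OF f(1)] pairsD(5)[OF g(1)] pairsD(5)[OF h(1)])
  next
    fix y assume "y \<in> carrier Frac"
    then obtain I f where f: "(I, f) \<in> pairs" "y = frac_class I f" by (rule Frac_cases)
    show "\<zero>\<^bsub>Frac\<^esub> \<oplus>\<^bsub>Frac\<^esub> y = y"
      unfolding f Frac_zero frac_add[OF zero_pair f(1)]
      by (rule frac_eqI[OF plus_pairs[OF zero_pair f(1)] f(1)]) (simp add: pairsD(5)[OF f(1)])
    note u = uminus_pair[OF f(1)]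
    have "frac_class I (\<lambda>x. \<ominus> f x) \<oplus>\<^bsub>Frac\<^esub> y = \<zero>\<^bsub>Frac\<^esub>"
      unfolding f Frac_zero frac_add[OF u f(1)]
      by (rule frac_eqI[OF plus_pairs[OF u f(1)] zero_pair]) (simp add: l_neg pairsD(5)[OF f(1)])
    then show "\<exists>z\<in>carrier Frac. z \<oplus>\<^bsub>Frac\<^esub> y = \<zero>\<^bsub>Frac\<^esub>" using frac_closed[OF u] by blast
  qed
  show "monoid Frac"
  proof (rule monoidI)
    show "\<one>\<^bsub>Frac\<^esub> \<in> carrier Frac" using id_pair by (simp add: Frac_one)
  next
    fix y assume "y \<in> carrier Frac"
    then obtain I f where f: "(I, f) \<in> pairs" "y = frac_class I f" by (rule Frac_cases)
    show "\<one>\<^bsub>Frac\<^esub> \<otimes>\<^bsub>Frac\<^esub> y = y"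
      unfolding f Frac_one frac_mult[OF id_pair f(1)]
      by (rule frac_eqI[OF comp_pairs[OF id_pair f(1)] f(1)]) simp
    show "y \<otimes>\<^bsub>Frac\<^esub> \<one>\<^bsub>Frac\<^esub> = y"
      unfolding f Frac_one frac_mult[OF f(1) id_pair]
      by (rule frac_eqI[OF comp_pairs[OF f(1) id_pair] f(1)]) simp
  next
    fix y z assume "y \<in> carrier Frac" "z \<in> carrier Frac"
    then obtain I f J g where f: "(I, f) \<in> pairs" "y = frac_class I f" and g: "(J, g) \<in> pairs" "z = frac_class J g"
      by (elim Frac_cases)
    show "y \<otimes>\<^bsub>Frac\<^esub> z \<in> carrier Frac"
      unfolding f g by (simp only: frac_mult f(1) g(1) comp_pairs frac_closed)
  next
    fix y z w assume "y \<in> carrier Frac" "z \<in> carrier Frac" "w \<in> carrier Frac"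
    then obtain I f J g K h where f: "(I, f) \<in> pairs" "y = frac_class I f" and g: "(J, g) \<in> pairs" "z = frac_class J g"
      and h: "(K, h) \<in> pairs" "w = frac_class K h"
      by (elim Frac_cases)
    note fg = comp_pairs[OF f(1) g(1)] and gh = comp_pairs[OF g(1) h(1)]
    show "y \<otimes>\<^bsub>Frac\<^esub> z \<otimes>\<^bsub>Frac\<^esub> w = y \<otimes>\<^bsub>Frac\<^esub> (z \<otimes>\<^bsub>Frac\<^esub> w)"
      unfolding f g h frac_mult[OF f(1) g(1)] frac_mult[OF g(1) h(1)] frac_mult[OF fg h(1)] frac_mult[OF f(1) gh]
      by (rule frac_eqI[OF comp_pairs[OF fg h(1)] comp_pairs[OF f(1) gh]]) simp
  qed
next
  fix y z w assume "y \<in> carrier Frac" "z \<in> carrier Frac" "w \<in> carrier Frac"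
  then obtain I f J g K h where f: "(I, f) \<in> pairs" "y = frac_class I f" and g: "(J, g) \<in> pairs" "z = frac_class J g"
    and h: "(K, h) \<in> pairs" "w = frac_class K h"
    by (elim Frac_cases)
  note fg = plus_pairs[OF f(1) g(1)] and fh = comp_pairs[OF f(1) h(1)] and gh = comp_pairs[OF g(1) h(1)]
    and hf = comp_pairs[OF h(1) f(1)] and hg = comp_pairs[OF h(1) g(1)]
  show "(y \<oplus>\<^bsub>Frac\<^esub> z) \<otimes>\<^bsub>Frac\<^esub> w = y \<otimes>\<^bsub>Frac\<^esub> w \<oplus>\<^bsub>Frac\<^esub> z \<otimes>\<^bsub>Frac\<^esub> w"
    unfolding f g h frac_add[OF f(1) g(1)] frac_mult[OF fg h(1)] frac_mult[OF f(1) h(1)]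
      frac_mult[OF g(1) h(1)] frac_add[OF fh gh]
    by (rule frac_eqI[OF comp_pairs[OF fg h(1)] plus_pairs[OF fh gh]]) simp
  have "h (f x \<oplus> g x) = h (f x) \<oplus> h (g x)" if x: "x \<in> I \<cdot> K" "x \<in> J \<cdot> K" for x
    by (rule pairsD(6)[OF h(1)])
      (fact right_module_hom_ideal_prod[OF pairsD(1)[OF h(1)] pairsD(1,3)[OF f(1)] x(1)]
            right_module_hom_ideal_prod[OF pairsD(1)[OF h(1)] pairsD(1,3)[OF g(1)] x(2)])+
  then show "w \<otimes>\<^bsub>Frac\<^esub> (y \<oplus>\<^bsub>Frac\<^esub> z) = w \<otimes>\<^bsub>Frac\<^esub> y \<oplus>\<^bsub>Frac\<^esub> w \<otimes>\<^bsub>Frac\<^esub> z"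
    unfolding f g h frac_add[OF f(1) g(1)] frac_mult[OF h(1) fg] frac_mult[OF h(1) f(1)]
      frac_mult[OF h(1) g(1)] frac_add[OF hf hg]
    by (intro frac_eqI[OF comp_pairs[OF h(1) fg] plus_pairs[OF hf hg]]) simp
qed

lemma ring_extended_centroid: "ring (extended_centroid A)"
  unfolding extended_centroid_def
  by (rule ring.subring_is_ring[OF ring_martindale_ring ring.ring_center_subring[OF ring_martindale_ring]])

text \<open>
  Left multiplications by elements of \<open>A\<close> are elements of the Martindale ring. Commuting with them
  gives \<open>f (a x) = a (f x)\<close> on a smaller ideal, in particular for \<open>x = i j\<close> with \<open>i, j \<in> I\<close>, and right
  linearity removes the factor \<open>j\<close>.
\<close>
lemma central_bimodule_hom:
  assumes f: "(I, f) \<in> pairs" and z: "frac_class I f \<in> ring_center Frac"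
  shows "f \<in> bimodule_homs A I"
proof -
  have "f (a \<otimes> i) = a \<otimes> f i" if i: "i \<in> I" and a: "a \<in> carrier A" for i a
  proof -
    note I = pairsD(1,2)[OF f]
    have ic: "i \<in> carrier A" "f i \<in> carrier A" "a \<otimes> i \<in> I"
      using i a pairsD[OF f] ideal_mult_l[OF I(1)] by auto
    note l = left_mult_pair[OF a]
    have "frac_class I f \<otimes>\<^bsub>Frac\<^esub> frac_class (carrier A) (\<lambda>x. a \<otimes> x) =
          frac_class (carrier A) (\<lambda>x. a \<otimes> x) \<otimes>\<^bsub>Frac\<^esub> frac_class I f"
      using z frac_closed[OF l] unfolding ring_center_def by blast
    then have "frac_class (carrier A \<cdot> I) (f \<circ> (\<lambda>x. a \<otimes> x)) = frac_class (I \<cdot> carrier A) ((\<lambda>x. a \<otimes> x) \<circ> f)"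
      unfolding frac_mult[OF f l] frac_mult[OF l f] .
    then have eq: "f (a \<otimes> x) = a \<otimes> f x" if "x \<in> carrier A \<cdot> I" "x \<in> I \<cdot> carrier A" for x
      using that unfolding frac_eq_iff[OF comp_pairs[OF f l] comp_pairs[OF l f]] by simp
    have "f (a \<otimes> i) \<ominus> a \<otimes> f i = \<zero>"
    proof (rule annihilates_ideal[OF I])
      fix j assume j: "j \<in> I"
      then have jc: "j \<in> carrier A" using pairsD(4)[OF f] by blast
      have "f (a \<otimes> (i \<otimes> j)) = a \<otimes> f (i \<otimes> j)"
        using i j ic jc by (intro eq ideal_prod.prod) auto
      moreover have "f (a \<otimes> (i \<otimes> j)) = f (a \<otimes> i) \<otimes> j"
        using pairsD(7)[OF f ic(3) jc] a ic jc by (simp add: m_assoc)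
      moreover have "f (i \<otimes> j) = f i \<otimes> j" using pairsD(7)[OF f i jc] .
      ultimately have "f (a \<otimes> i) \<otimes> j = a \<otimes> f i \<otimes> j" using a ic jc by (simp add: m_assoc)
      then show "(f (a \<otimes> i) \<ominus> a \<otimes> f i) \<otimes> j = \<zero>"
        using a ic jc pairsD(5)[OF f] by (simp add: a_minus_def l_distr l_minus r_neg)
    qed (use a ic pairsD(5)[OF f] in auto)
    from minus_zero_imp_eq[OF this] show ?thesis using a ic pairsD(5)[OF f] by simp
  qed
  then show ?thesis using pairsD(3)[OF f] by (simp add: bimodule_homs_def)
qed

definition frac_acts :: "('a set \<times> ('a \<Rightarrow> 'a)) set \<Rightarrow> 'a \<Rightarrow> 'a \<Rightarrow> bool" where
  "frac_acts z y y' \<longleftrightarrow> (\<exists>I f. (I, f) \<in> pairs \<and> z = frac_class I f \<and> acts A I f y y')"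

lemma frac_actsI: "(I, f) \<in> pairs \<Longrightarrow> acts A I f y y' \<Longrightarrow> frac_acts (frac_class I f) y y'"
  by (auto simp: frac_acts_def)

lemma frac_acts_mult:
  assumes "frac_acts z y y'" "frac_acts w y' y''"
  shows "frac_acts (z \<otimes>\<^bsub>Frac\<^esub> w) y y''"
proof -
  obtain I f where f: "(I, f) \<in> pairs" "z = frac_class I f" "acts A I f y y'"
    using assms(1) by (auto simp: frac_acts_def)
  obtain J g where g: "(J, g) \<in> pairs" "w = frac_class J g" "acts A J g y' y''"
    using assms(2) by (auto simp: frac_acts_def)
  have "acts A (J \<cdot> I) (f \<circ> g) y y''"
    unfolding acts_def
  proof (intro conjI ballI)
    fix i assume i: "i \<in> J \<cdot> I"
    have "g i \<in> I" "i \<in> J"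
      using right_module_hom_ideal_prod[OF pairsD(1)[OF f(1)] pairsD(1,3)[OF g(1)] i]
        ideal_prod_subset(1)[OF pairsD(1)[OF g(1)] pairsD(1)[OF f(1)] i] by auto
    then show "y \<otimes> (f \<circ> g) i = y'' \<otimes> i" using f(3) g(3) by (simp add: acts_def)
  qed (use f g in \<open>auto simp: acts_def\<close>)
  then show ?thesis using comp_pairs[OF f(1) g(1)] f g by (auto simp: frac_acts_def frac_mult)
qed

lemma frac_acts_add:
  assumes "frac_acts z y y'" "frac_acts w y y''"
  shows "frac_acts (z \<oplus>\<^bsub>Frac\<^esub> w) y (y' \<oplus> y'')"
proof -
  obtain I f where f: "(I, f) \<in> pairs" "z = frac_class I f" "acts A I f y y'"
    using assms(1) by (auto simp: frac_acts_def)
  obtain J g where g: "(J, g) \<in> pairs" "w = frac_class J g" "acts A J g y y''"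
    using assms(2) by (auto simp: frac_acts_def)
  have "acts A (I \<inter> J) (\<lambda>x. f x \<oplus> g x) y (y' \<oplus> y'')"
    using f g pairsD[OF f(1)] pairsD[OF g(1)] by (auto simp: acts_def r_distr l_distr)
  then show ?thesis using plus_pairs[OF f(1) g(1)] f g by (auto simp: frac_acts_def frac_add)
qed

lemma frac_acts_smult: "frac_acts z y y' \<Longrightarrow> frac_acts z (c \<odot> y) (c \<odot> y')"
  unfolding frac_acts_def acts_def by (metis pairsD(4,5) smult_closed smult_mult_l)

lemma frac_acts_zero: "y \<in> carrier A \<Longrightarrow> frac_acts \<zero>\<^bsub>Frac\<^esub> y \<zero>"
  unfolding Frac_zero by (rule frac_actsI[OF zero_pair]) (simp add: acts_def)

lemma frac_acts_one: "y \<in> carrier A \<Longrightarrow> frac_acts \<one>\<^bsub>Frac\<^esub> y y"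
  unfolding Frac_one by (rule frac_actsI[OF id_pair]) (simp add: acts_def)

lemma frac_acts_scalar: "y \<in> carrier A \<Longrightarrow> frac_acts (frac_class (carrier A) (\<lambda>x. c \<odot> x)) y (c \<odot> y)"
  by (rule frac_actsI[OF smult_pair]) (simp add: acts_def smult_mult_l smult_mult_r)

lemma central_acts_zero:
  assumes "frac_acts z y \<zero>" "y \<noteq> \<zero>" "z \<in> ring_center Frac"
  shows "z = \<zero>\<^bsub>Frac\<^esub>"
proof -
  obtain I f where f: "(I, f) \<in> pairs" "z = frac_class I f" "acts A I f y \<zero>"
    using assms(1) by (auto simp: frac_acts_def)
  have "f \<in> bimodule_homs A I" using central_bimodule_hom[OF f(1)] assms(3) f(2) by simp
  then have "f i = \<zero>" if "i \<in> I" for i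
    using acts_zero[OF pairsD(1)[OF f(1)] _ f(3) assms(2) that] by blast
  then show ?thesis unfolding f Frac_zero by (intro frac_eqI[OF f(1) zero_pair]) simp
qed

text \<open>
  A relation \<open>\<Sum> c\<^sub>j f\<^sup>j y = 0\<close> with \<open>y \<noteq> 0\<close> says that the polynomial with the coefficients \<open>c\<^sub>j\<close>, evaluated
  at the class of \<open>f\<close>, kills \<open>y\<close>. The value is central, hence it is zero by \<open>central_acts_zero\<close>.
\<close>
theorem extended_centroid_algebraic:
  assumes alg: "\<And>I f. two_sided_ideal I A \<Longrightarrow> I \<noteq> {\<zero>} \<Longrightarrow> f \<in> bimodule_homs A I \<Longrightarrow> algebraic_action A I f"
    and z: "z \<in> carrier (extended_centroid A)"
  shows "ring.algebraic (extended_centroid A) (centroid_scalars A) z"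
proof -
  interpret C: ring "extended_centroid A" by (rule ring_extended_centroid)
  have C_ops: "\<zero>\<^bsub>extended_centroid A\<^esub> = \<zero>\<^bsub>Frac\<^esub>" "\<one>\<^bsub>extended_centroid A\<^esub> = \<one>\<^bsub>Frac\<^esub>"
    "(\<otimes>\<^bsub>extended_centroid A\<^esub>) = (\<otimes>\<^bsub>Frac\<^esub>)" "(\<oplus>\<^bsub>extended_centroid A\<^esub>) = (\<oplus>\<^bsub>Frac\<^esub>)"
    by (simp_all add: extended_centroid_def)
  have zc: "z \<in> ring_center Frac" using z by (simp add: extended_centroid_def)
  then obtain I f where f: "(I, f) \<in> pairs" "z = frac_class I f" by (auto simp: ring_center_def elim: Frac_cases)
  have "algebraic_action A I f"
    using alg[OF pairsD(1,2)[OF f(1)]] central_bimodule_hom[OF f(1)] zc f(2) by simp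
  then obtain y c where c: "c \<noteq> 0" and y: "\<And>j. y j \<in> carrier A" "y 0 \<noteq> \<zero>"
    and step: "\<And>j. j < Polynomial.degree c \<Longrightarrow> acts A I f (y j) (y (Suc j))"
    and comb: "comb A (rev (coeffs c)) y = \<zero>"
    unfolding algebraic_action_def by blast
  define s where "s k = frac_class (carrier A) (\<lambda>x. k \<odot> x)" for k
  \<comment> \<open>An arbitrary right module homomorphism need not commute with scalars. On products \<open>i a\<close> it does,
      because there the scalar can be moved into \<open>a\<close>.\<close>
  have s_central: "s k \<in> carrier (extended_centroid A)" for k
  proof -
    have "s k \<otimes>\<^bsub>Frac\<^esub> w = w \<otimes>\<^bsub>Frac\<^esub> s k" if w: "w \<in> carrier Frac" for w
    proof -
      obtain J g where g: "(J, g) \<in> pairs" "w = frac_class J g" using w by (rule Frac_cases)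
      have "g (k \<odot> x) = k \<odot> g x" if x: "x \<in> J \<cdot> carrier A" "x \<in> carrier A \<cdot> J" for x
        using x(1)
      proof induct
        case (prod i a)
        then show ?case using pairsD[OF g(1)] by (simp add: smult_mult_r[symmetric])
      next
        case (sum u v)
        have J: "t \<in> J" "k \<odot> t \<in> J" if "t \<in> J \<cdot> carrier A" for t
        proof -
          show "t \<in> J" using ideal_prod_subset(1)[OF pairsD(1)[OF g(1)] two_sided_ideal_carrier that] .
          show "k \<odot> t \<in> J" using that
          proof induct
            case (prod i a)
            then show ?case
              using ideal_mult_r[OF pairsD(1)[OF g(1)] prod(1), of "k \<odot> a"] pairsD(4)[OF g(1)]
              by (simp add: smult_mult_r)
          next
            case (sum u v)
            then show ?case using ideal_add[OF pairsD(1)[OF g(1)]]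
                ideal_prod_subset(3)[OF pairsD(1)[OF g(1)] two_sided_ideal_carrier]
              by (simp add: smult_r_distr)
          qed
        qed
        have "g (k \<odot> (u \<oplus> v)) = g (k \<odot> u) \<oplus> g (k \<odot> v)"
          using sum J pairsD[OF g(1)] by (simp add: smult_r_distr)
        then show ?case using sum J pairsD[OF g(1)] by (simp add: smult_r_distr)
      qed
      then show ?thesis unfolding s_def g(2)
          frac_mult[OF smult_pair g(1)] frac_mult[OF g(1) smult_pair]
        by (intro frac_eqI[OF comp_pairs[OF smult_pair g(1)] comp_pairs[OF g(1) smult_pair]]) simp
    qed
    moreover have "s k \<in> carrier Frac" by (simp add: s_def smult_pair)
    ultimately show ?thesis by (simp add: extended_centroid_def ring_center_def)
  qed
  have pow: "frac_acts (z [^]\<^bsub>extended_centroid A\<^esub> j) (y 0) (y j)" if "j \<le> Polynomial.degree c" for j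
    using that
  proof (induct j)
    case 0 then show ?case using y by (simp add: C_ops frac_acts_one)
  next
    case (Suc j)
    have "frac_acts z (y j) (y (Suc j))" using step[of j] Suc f by (auto simp: frac_acts_def)
    then show ?case using Suc by (auto simp: C_ops intro: frac_acts_mult)
  qed
  have ev: "frac_acts (C.eval (map s cs) z) (y 0) (comb A cs y)"
    if "length cs \<le> Suc (Polynomial.degree c)" for cs
    using that
  proof (induct cs)
    case Nil then show ?case using y by (simp add: C_ops frac_acts_zero)
  next
    case (Cons k cs)
    have "frac_acts (s k \<otimes>\<^bsub>Frac\<^esub> z [^]\<^bsub>extended_centroid A\<^esub> length cs) (y 0) (k \<odot> y (length cs))"
      using Cons y by (intro frac_acts_mult[of _ _ "k \<odot> y 0"])
        (auto simp: s_def intro: frac_acts_scalar frac_acts_smult pow)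
    then show ?case using Cons by (simp add: C_ops frac_acts_add)
  qed
  let ?p = "map s (rev (coeffs c))"
  have len: "length (coeffs c) = Suc (Polynomial.degree c)" using c by (simp add: length_coeffs_degree)
  have "C.eval ?p z \<in> carrier (extended_centroid A)"
    using s_central z by (intro C.eval_in_carrier) auto
  then have eval0: "C.eval ?p z = \<zero>\<^bsub>extended_centroid A\<^esub>"
    using central_acts_zero[OF _ y(2), of "C.eval ?p z"] ev[of "rev (coeffs c)"] comb len
    by (simp add: C_ops(1)) (simp add: extended_centroid_def)
  have hd: "hd ?p = s (Polynomial.lead_coeff c)"
    using c by (simp add: hd_map hd_rev last_coeffs_eq_coeff_degree)
  have "hd ?p \<noteq> \<zero>\<^bsub>extended_centroid A\<^esub>"
  proof
    assume "hd ?p = \<zero>\<^bsub>extended_centroid A\<^esub>"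
    then have "\<forall>x\<in>carrier A. Polynomial.lead_coeff c \<odot> x = \<zero>"
      by (simp add: hd C_ops Frac_zero s_def frac_eq_iff smult_pair zero_pair)
    then have "carrier A \<subseteq> {\<zero>}" using c smult_eq_zero by (metis leading_coeff_0_iff singletonI subsetI)
    then show False using nontrivial by blast
  qed
  then have "?p \<in> carrier (centroid_scalars A [X]\<^bsub>extended_centroid A\<^esub>)"
    by (auto simp: univ_poly_def polynomial_def centroid_scalars_def s_def frac_class_def)
  moreover have "?p \<noteq> []" using c by simp
  ultimately show ?thesis
    using C.algebraicI[OF _ _ eval0] by (simp add: over_def)
qed

end

section \<open>Prime algebras generated by a path family\<close>
text \<open>
  The situation in a prime quotient of a Leavitt path algebra, where some vertices and edges may
  have become zero.
\<close>
locale path_algebra = prime_nonunital_algebra A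
  for A :: "('k :: field, 'a, 'm) module_scheme" (structure) +
  fixes E :: "('v, 'e) pre_digraph" and vx :: "'v \<Rightarrow> 'a" and ed gh :: "'e \<Rightarrow> 'a"
  assumes wf: "wf_digraph E"
    and vx_closed [simp, intro]: "v \<in> verts E \<Longrightarrow> vx v \<in> carrier A"
    and ed_closed [simp, intro]: "e \<in> arcs E \<Longrightarrow> ed e \<in> carrier A"
    and gh_closed [simp, intro]: "e \<in> arcs E \<Longrightarrow> gh e \<in> carrier A"
    and vx_idem: "v \<in> verts E \<Longrightarrow> vx v \<otimes> vx v = vx v"
    and vx_orth: "\<lbrakk>v \<in> verts E; w \<in> verts E; v \<noteq> w\<rbrakk> \<Longrightarrow> vx v \<otimes> vx w = \<zero>"
    and tail_ed: "e \<in> arcs E \<Longrightarrow> vx (tail E e) \<otimes> ed e = ed e"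
    and ed_head: "e \<in> arcs E \<Longrightarrow> ed e \<otimes> vx (head E e) = ed e"
    and head_gh: "e \<in> arcs E \<Longrightarrow> vx (head E e) \<otimes> gh e = gh e"
    and gh_tail: "e \<in> arcs E \<Longrightarrow> gh e \<otimes> vx (tail E e) = gh e"
    and gh_ed_same: "e \<in> arcs E \<Longrightarrow> gh e \<otimes> ed e = vx (head E e)"
    and gh_ed_distinct: "\<lbrakk>e \<in> arcs E; f \<in> arcs E; e \<noteq> f\<rbrakk> \<Longrightarrow> gh e \<otimes> ed f = \<zero>"
    and generated: "\<lbrakk>T \<subseteq> carrier A; \<zero> \<in> T; vx ` verts E \<subseteq> T; ed ` arcs E \<subseteq> T; gh ` arcs E \<subseteq> T;
        \<And>x y. x \<in> T \<Longrightarrow> y \<in> T \<Longrightarrow> x \<oplus> y \<in> T; \<And>x y. x \<in> T \<Longrightarrow> y \<in> T \<Longrightarrow> x \<otimes> y \<in> T;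
        \<And>c x. x \<in> T \<Longrightarrow> c \<odot> x \<in> T\<rbrakk> \<Longrightarrow> carrier A \<subseteq> T"
begin

text \<open>
  The vertices and edges that survive in \<open>A\<close>. An edge is nonzero exactly if its range is, because
  \<open>e\<^sup>* e = r(e)\<close>. Walks use surviving edges only.
\<close>
definition V where "V = {v \<in> verts E. vx v \<noteq> \<zero>}"
definition R where "R = {e \<in> arcs E. vx (head E e) \<noteq> \<zero>}"

lemma head_verts [simp, intro]: "e \<in> arcs E \<Longrightarrow> head E e \<in> verts E"
  and tail_verts [simp, intro]: "e \<in> arcs E \<Longrightarrow> tail E e \<in> verts E"
  using wf by (auto simp: wf_digraph_def)

lemma V_verts: "v \<in> V \<Longrightarrow> v \<in> verts E" and V_nonzero: "v \<in> V \<Longrightarrow> vx v \<noteq> \<zero>"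
  by (auto simp: V_def)

lemma V_closed [simp, intro]: "v \<in> V \<Longrightarrow> vx v \<in> carrier A"
  by (auto simp: V_def)

lemma R_arcs: "e \<in> R \<Longrightarrow> e \<in> arcs E"
  and head_V: "e \<in> R \<Longrightarrow> head E e \<in> V"
  and head_dead: "e \<in> arcs E \<Longrightarrow> e \<notin> R \<Longrightarrow> vx (head E e) = \<zero>"
  by (auto simp: R_def V_def)

declare R_arcs [simp]

lemma R_closed [simp, intro]: "e \<in> R \<Longrightarrow> ed e \<in> carrier A" "e \<in> R \<Longrightarrow> gh e \<in> carrier A"
  by (auto simp: R_arcs)

lemma ed_nonzero: "e \<in> R \<Longrightarrow> ed e \<noteq> \<zero>"
  using gh_ed_same[of e] V_nonzero[OF head_V[of e]] r_null[of "gh e"] by auto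

lemma tail_V: "e \<in> R \<Longrightarrow> tail E e \<in> V"
  using ed_nonzero[of e] tail_ed[of e] by (auto simp: V_def)

lemma vx_ed: "e \<in> R \<Longrightarrow> v \<in> V \<Longrightarrow> vx v \<otimes> ed e = (if tail E e = v then ed e else \<zero>)"
proof -
  assume e: "e \<in> R" and v: "v \<in> V"
  have eq: "(vx v \<otimes> vx (tail E e)) \<otimes> ed e = vx v \<otimes> ed e"
    using e v by (simp add: m_assoc tail_ed V_verts)
  show ?thesis
  proof (cases "tail E e = v")
    case True then show ?thesis using e tail_ed[of e] by auto
  next
    case False
    then show ?thesis using e v vx_orth[of v "tail E e"] eq by (simp add: V_verts)
  qed
qed

lemma gh_vx: "e \<in> R \<Longrightarrow> v \<in> V \<Longrightarrow> gh e \<otimes> vx v = (if tail E e = v then gh e else \<zero>)"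
proof -
  assume e: "e \<in> R" and v: "v \<in> V"
  have eq: "gh e \<otimes> (vx (tail E e) \<otimes> vx v) = gh e \<otimes> vx v"
    using e v by (simp add: m_assoc[symmetric] gh_tail V_verts)
  show ?thesis
  proof (cases "tail E e = v")
    case True then show ?thesis using e gh_tail[of e] by auto
  next
    case False
    then show ?thesis using e v vx_orth[of "tail E e" v] eq by (simp add: V_verts)
  qed
qed

lemma gh_ed: "e \<in> R \<Longrightarrow> f \<in> R \<Longrightarrow> gh e \<otimes> ed f = (if e = f then vx (head E e) else \<zero>)"
  by (simp add: gh_ed_same gh_ed_distinct)

primrec walk :: "'v \<Rightarrow> 'e list \<Rightarrow> 'v \<Rightarrow> bool" where
  "walk u [] w \<longleftrightarrow> u = w \<and> u \<in> V"
| "walk u (e # es) w \<longleftrightarrow> e \<in> R \<and> tail E e = u \<and> walk (head E e) es w"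

text \<open>
  The vertex argument is the end of the walk. It is what the empty list needs, whose path is a vertex.
\<close>
primrec pth :: "'e list \<Rightarrow> 'v \<Rightarrow> 'a" where
  "pth [] w = vx w"
| "pth (e # es) w = ed e \<otimes> pth es w"

primrec gpth :: "'e list \<Rightarrow> 'v \<Rightarrow> 'a" where
  "gpth [] w = vx w"
| "gpth (e # es) w = gpth es w \<otimes> gh e"

lemma walk_V: "walk u es w \<Longrightarrow> u \<in> V \<and> w \<in> V"
  by (induct es arbitrary: u) (auto dest: tail_V)

lemma walk_append: "walk u (xs @ ys) w \<longleftrightarrow> (\<exists>m. walk u xs m \<and> walk m ys w)"
  by (induct xs arbitrary: u) (auto dest: walk_V)

lemma walk_end_unique: "walk u xs w \<Longrightarrow> walk u' xs w' \<Longrightarrow> xs \<noteq> [] \<or> u = u' \<Longrightarrow> w = w' \<and> u = u'"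
  by (induct xs arbitrary: u u') auto

lemma pth_closed [simp, intro]: "walk u es w \<Longrightarrow> pth es w \<in> carrier A"
  and gpth_closed [simp, intro]: "walk u es w \<Longrightarrow> gpth es w \<in> carrier A"
  by (induct es arbitrary: u) auto

lemma vx_pth: "walk u es w \<Longrightarrow> v \<in> V \<Longrightarrow> vx v \<otimes> pth es w = (if v = u then pth es w else \<zero>)"
  by (cases es) (auto simp: vx_idem vx_orth V_verts m_assoc[symmetric] vx_ed)

lemma gpth_vx: "walk u es w \<Longrightarrow> v \<in> V \<Longrightarrow> gpth es w \<otimes> vx v = (if v = u then gpth es w else \<zero>)"
  by (cases es) (auto simp: vx_idem vx_orth V_verts m_assoc gh_vx)

lemma pth_vx: "walk u es w \<Longrightarrow> pth es w \<otimes> vx w = pth es w"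
proof (induct es arbitrary: u)
  case (Cons e es)
  have "pth es w \<in> carrier A" "vx w \<in> carrier A" using Cons walk_V by auto
  then show ?case using Cons by (auto simp: m_assoc)
qed (auto simp: vx_idem V_verts)

lemma vx_gpth: "walk u es w \<Longrightarrow> vx w \<otimes> gpth es w = gpth es w"
proof (induct es arbitrary: u)
  case (Cons e es)
  have "gpth es w \<in> carrier A" "vx w \<in> carrier A" using Cons walk_V by auto
  then show ?case using Cons by (auto simp: m_assoc[symmetric])
qed (auto simp: vx_idem V_verts)

lemma pth_append: "walk u xs m \<Longrightarrow> walk m ys w \<Longrightarrow> pth (xs @ ys) w = pth xs m \<otimes> pth ys w"
proof (induct xs arbitrary: u)
  case Nil then show ?case using vx_pth[OF Nil(2), of m] by auto
next
  case (Cons e xs)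
  have "pth xs m \<in> carrier A" "pth ys w \<in> carrier A" using Cons by auto
  then show ?case using Cons by (auto simp: m_assoc)
qed

lemma gpth_append: "walk u xs m \<Longrightarrow> walk m ys w \<Longrightarrow> gpth (xs @ ys) w = gpth ys w \<otimes> gpth xs m"
proof (induct xs arbitrary: u)
  case Nil then show ?case using gpth_vx[OF Nil(2), of m] by auto
next
  case (Cons e xs)
  have "gpth xs m \<in> carrier A" "gpth ys w \<in> carrier A" using Cons by auto
  then show ?case using Cons by (auto simp: m_assoc)
qed

text \<open>
  The relations \<open>e\<^sup>* f = 0\<close> and \<open>e\<^sup>* e = r(e)\<close> cancel common initial edges, so the product of a ghost path
  and a path vanishes unless one of the two lists is a prefix of the other.
\<close>
lemma gpth_pth_cases:
  assumes "walk u xs a" "walk u' ys b"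
  shows "gpth xs a \<otimes> pth ys b = \<zero> \<or>
    (\<exists>zs. ys = xs @ zs \<and> u = u' \<and> walk a zs b \<and> gpth xs a \<otimes> pth ys b = pth zs b) \<or>
    (\<exists>zs. xs = ys @ zs \<and> u = u' \<and> walk b zs a \<and> gpth xs a \<otimes> pth ys b = gpth zs a)"
  using assms
proof (induct xs arbitrary: u u' ys)
  case Nil
  then show ?case using vx_pth[OF Nil(2), of a] by (cases "u' = a") auto
next
  case (Cons e xs)
  show ?case
  proof (cases ys)
    case Nil
    then show ?thesis using gpth_vx[OF Cons(2), of b] Cons by (cases "u = b") auto
  next
    case ys: (Cons f zs)
    have w: "walk (head E e) xs a" "walk (head E f) zs b" "e \<in> R" "f \<in> R" "tail E e = u" "tail E f = u'"
      using Cons ys by auto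
    have c: "gpth xs a \<in> carrier A" "pth zs b \<in> carrier A" using w by auto
    have eq: "gpth (e # xs) a \<otimes> pth (f # zs) b = gpth xs a \<otimes> ((gh e \<otimes> ed f) \<otimes> pth zs b)"
      using c w by (simp add: m_assoc)
    show ?thesis
    proof (cases "e = f")
      case False
      then show ?thesis using eq c w ys by (simp add: gh_ed)
    next
      case True
      then have "gpth (e # xs) a \<otimes> pth (f # zs) b = gpth xs a \<otimes> pth zs b"
        using eq c w vx_pth[OF w(2) head_V[OF w(4)]] by (simp add: gh_ed)
      then show ?thesis using Cons(1)[OF w(1,2)] True ys w by auto
    qed
  qed
qed

lemma gpth_pth_same: "walk u xs a \<Longrightarrow> gpth xs a \<otimes> pth xs a = vx a"
proof (induct xs arbitrary: u)
  case Nil then show ?case by (auto simp: vx_idem V_verts)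
next
  case (Cons e xs)
  have c: "gpth xs a \<in> carrier A" "pth xs a \<in> carrier A" using Cons by auto
  have "gpth (e # xs) a \<otimes> pth (e # xs) a = gpth xs a \<otimes> ((gh e \<otimes> ed e) \<otimes> pth xs a)"
    using c Cons by (simp add: m_assoc)
  also have "\<dots> = gpth xs a \<otimes> pth xs a"
    using Cons vx_pth[of "head E e" xs a "head E e"] head_V[of e] by (simp add: gh_ed)
  finally show ?case using Cons by auto
qed

lemma gpth_pth_append:
  assumes "walk u xs a" "walk a zs b"
  shows "gpth xs a \<otimes> pth (xs @ zs) b = pth zs b" "gpth (xs @ zs) b \<otimes> pth xs a = gpth zs b"
proof -
  have c: "gpth xs a \<in> carrier A" "pth xs a \<in> carrier A" "gpth zs b \<in> carrier A" "pth zs b \<in> carrier A"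
    using assms by auto
  have "gpth xs a \<otimes> pth (xs @ zs) b = (gpth xs a \<otimes> pth xs a) \<otimes> pth zs b"
    using c by (simp add: pth_append[OF assms] m_assoc)
  also have "\<dots> = pth zs b"
    using vx_pth[OF assms(2), of a] walk_V[OF assms(2)] by (simp add: gpth_pth_same[OF assms(1)])
  finally show "gpth xs a \<otimes> pth (xs @ zs) b = pth zs b" .
  have "gpth (xs @ zs) b \<otimes> pth xs a = gpth zs b \<otimes> (gpth xs a \<otimes> pth xs a)"
    using c by (simp add: gpth_append[OF assms] m_assoc)
  also have "\<dots> = gpth zs b"
    using gpth_vx[OF assms(2), of a] walk_V[OF assms(2)] by (simp add: gpth_pth_same[OF assms(1)])
  finally show "gpth (xs @ zs) b \<otimes> pth xs a = gpth zs b" .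
qed

definition monomials where
  "monomials = {pth \<alpha> w \<otimes> gpth \<beta> w | \<alpha> \<beta> u v w. walk u \<alpha> w \<and> walk v \<beta> w}"

lemma monomials_closed: "monomials \<subseteq> carrier A"
  by (auto simp: monomials_def)

lemma monomials_mult:
  assumes "x \<in> monomials" "y \<in> monomials"
  shows "x \<otimes> y = \<zero> \<or> x \<otimes> y \<in> monomials"
proof -
  obtain \<alpha> \<beta> u v w where x: "x = pth \<alpha> w \<otimes> gpth \<beta> w" "walk u \<alpha> w" "walk v \<beta> w"
    using assms(1) by (auto simp: monomials_def)
  obtain \<gamma> \<delta> u' v' w' where y: "y = pth \<gamma> w' \<otimes> gpth \<delta> w'" "walk u' \<gamma> w'" "walk v' \<delta> w'"
    using assms(2) by (auto simp: monomials_def)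
  have c: "pth \<alpha> w \<in> carrier A" "gpth \<beta> w \<in> carrier A" "pth \<gamma> w' \<in> carrier A" "gpth \<delta> w' \<in> carrier A"
    using x y by auto
  have xy: "x \<otimes> y = pth \<alpha> w \<otimes> ((gpth \<beta> w \<otimes> pth \<gamma> w') \<otimes> gpth \<delta> w')"
    using c x y by (simp add: m_assoc)
  consider "gpth \<beta> w \<otimes> pth \<gamma> w' = \<zero>"
    | zs where "walk w zs w'" "gpth \<beta> w \<otimes> pth \<gamma> w' = pth zs w'"
    | zs where "walk w' zs w" "gpth \<beta> w \<otimes> pth \<gamma> w' = gpth zs w"
    using gpth_pth_cases[OF x(3) y(2)] by blast
  then show ?thesis
  proof cases
    case 1 then show ?thesis using xy c by simp
  next
    case 2
    have "x \<otimes> y = pth (\<alpha> @ zs) w' \<otimes> gpth \<delta> w'"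
      using xy 2 c by (simp add: pth_append[OF x(2) 2(1)] m_assoc[symmetric] pth_closed[OF 2(1)])
    moreover have "walk u (\<alpha> @ zs) w'" using x(2) 2(1) by (auto simp: walk_append)
    ultimately show ?thesis using y(3) by (auto simp: monomials_def)
  next
    case 3
    have "x \<otimes> y = pth \<alpha> w \<otimes> gpth (\<delta> @ zs) w"
      using xy 3 c by (simp add: gpth_append[OF y(3) 3(1)])
    moreover have "walk v' (\<delta> @ zs) w" using y(3) 3(1) by (auto simp: walk_append)
    ultimately show ?thesis using x(2) by (auto simp: monomials_def)
  qed
qed

lemma vx_alive_or_zero: "v \<in> verts E \<Longrightarrow> v \<in> V \<or> vx v = \<zero>"
  by (auto simp: V_def)

lemma carrier_eq_span: "carrier A = lin_span A monomials"
proof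
  show "lin_span A monomials \<subseteq> carrier A" using lin_span_closed[OF monomials_closed] by blast
  show "carrier A \<subseteq> lin_span A monomials"
  proof (rule generated)
    show "lin_span A monomials \<subseteq> carrier A" using lin_span_closed[OF monomials_closed] by blast
    show "\<zero> \<in> lin_span A monomials" by (rule lin_span.zero)
    have base: "x \<in> lin_span A monomials" if "x = \<zero> \<or> x \<in> monomials" for x
      using that lin_span_base[OF monomials_closed] lin_span.zero by auto
    have v: "vx v \<in> monomials" if "v \<in> V" for v
      using that by (force simp: monomials_def vx_idem V_verts intro: exI[of _ "[]"] exI[of _ v])
    show "vx ` verts E \<subseteq> lin_span A monomials"
      using base v vx_alive_or_zero by blast
    have "ed e = \<zero> \<or> ed e \<in> monomials" if e: "e \<in> arcs E" for e
    proof (cases "e \<in> R")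
      case False
      then have "vx (head E e) = \<zero>" by (rule head_dead[OF e])
      then show ?thesis using ed_head[OF e] e by auto
    next
      case True
      have h: "walk (head E e) [] (head E e)" using head_V[OF True] by simp
      have "walk (tail E e) [e] (head E e)" using True h by simp
      moreover have "ed e = pth [e] (head E e) \<otimes> gpth [] (head E e)"
        using e h by (simp add: m_assoc vx_idem ed_head)
      ultimately show ?thesis using h unfolding monomials_def by blast
    qed
    then show "ed ` arcs E \<subseteq> lin_span A monomials" using base by blast
    have "gh e = \<zero> \<or> gh e \<in> monomials" if e: "e \<in> arcs E" for e
    proof (cases "e \<in> R")
      case False
      then have "vx (head E e) = \<zero>" by (rule head_dead[OF e])
      then show ?thesis using head_gh[OF e] e by auto
    next
      case True
      have h: "walk (head E e) [] (head E e)" using head_V[OF True] by simp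
      have "walk (tail E e) [e] (head E e)" using True h by simp
      moreover have "gh e = pth [] (head E e) \<otimes> gpth [e] (head E e)"
        using e h by (simp add: m_assoc[symmetric] vx_idem head_gh)
      ultimately show ?thesis using h unfolding monomials_def by blast
    qed
    then show "gh ` arcs E \<subseteq> lin_span A monomials" using base by blast
    show "x \<oplus> y \<in> lin_span A monomials" if "x \<in> lin_span A monomials" "y \<in> lin_span A monomials" for x y
      using that by (rule lin_span.add)
    show "x \<otimes> y \<in> lin_span A monomials" if "x \<in> lin_span A monomials" "y \<in> lin_span A monomials" for x y
      using lin_span_mult[OF monomials_closed _ that] monomials_mult base by blast
    show "c \<odot> x \<in> lin_span A monomials" if "x \<in> lin_span A monomials" for c x
      using lin_span_smult[OF monomials_closed that] .
  qed
qed

section \<open>Gaps and exitless vertices\<close>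
definition out where "out v = {e \<in> R. tail E e = v}"

lemma outD: "e \<in> out v \<Longrightarrow> e \<in> R" "e \<in> out v \<Longrightarrow> tail E e = v"
  by (auto simp: out_def)

text \<open>
  For distinct edges starting in \<open>v\<close>, this is the idempotent \<open>v - \<Sum> e e\<^sup>*\<close>.
\<close>
primrec gap :: "'v \<Rightarrow> 'e list \<Rightarrow> 'a" where
  "gap v [] = vx v"
| "gap v (e # es) = gap v es \<ominus> ed e \<otimes> gh e"

lemma gap_closed [simp, intro]: "v \<in> V \<Longrightarrow> set es \<subseteq> out v \<Longrightarrow> gap v es \<in> carrier A"
  by (induct es) (auto dest: outD)

lemma gap_ed:
  assumes "v \<in> V" "distinct es" "set es \<subseteq> out v" "f \<in> out v"
  shows "gap v es \<otimes> ed f = (if f \<in> set es then \<zero> else ed f)"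
  using assms(2,3)
proof (induct es)
  case Nil then show ?case using assms outD[OF assms(4)] by (simp add: vx_ed)
next
  case (Cons e es)
  have e: "e \<in> R" "f \<in> R" using Cons outD assms(4) by auto
  have c: "gap v es \<in> carrier A" using Cons assms(1) by auto
  have "gap v (e # es) \<otimes> ed f = gap v es \<otimes> ed f \<ominus> ed e \<otimes> (gh e \<otimes> ed f)"
    using c e by (simp add: a_minus_def l_distr l_minus m_assoc)
  then show ?case using Cons e ed_head[of f] by (auto simp: gh_ed a_minus_def r_neg)
qed

lemma gh_gap:
  assumes "v \<in> V" "distinct es" "set es \<subseteq> out v" "f \<in> out v"
  shows "gh f \<otimes> gap v es = (if f \<in> set es then \<zero> else gh f)"
  using assms(2,3)
proof (induct es)
  case Nil then show ?case using assms outD[OF assms(4)] by (simp add: gh_vx)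
next
  case (Cons e es)
  have e: "e \<in> R" "f \<in> R" using Cons outD assms(4) by auto
  have c: "gap v es \<in> carrier A" using Cons assms(1) by auto
  have "gh f \<otimes> gap v (e # es) = gh f \<otimes> gap v es \<ominus> (gh f \<otimes> ed e) \<otimes> gh e"
    using c e by (simp add: a_minus_def r_distr r_minus m_assoc)
  then show ?case using Cons e head_gh[of f] by (auto simp: gh_ed a_minus_def r_neg)
qed

lemma vx_gap: "v \<in> V \<Longrightarrow> set es \<subseteq> out v \<Longrightarrow> w \<in> V \<Longrightarrow> vx w \<otimes> gap v es = (if w = v then gap v es else \<zero>)"
proof (induct es)
  case (Cons e es)
  have e: "e \<in> R" "tail E e = v" using Cons outD by auto
  have "vx w \<otimes> gap v (e # es) = vx w \<otimes> gap v es \<ominus> (vx w \<otimes> ed e) \<otimes> gh e"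
    using Cons e by (simp add: a_minus_def r_distr r_minus m_assoc)
  then show ?case using Cons e by (simp add: vx_ed a_minus_def)
qed (simp add: vx_idem vx_orth V_verts)

lemma gap_vx: "v \<in> V \<Longrightarrow> set es \<subseteq> out v \<Longrightarrow> w \<in> V \<Longrightarrow> gap v es \<otimes> vx w = (if w = v then gap v es else \<zero>)"
proof (induct es)
  case (Cons e es)
  have e: "e \<in> R" "tail E e = v" using Cons outD by auto
  have "gap v (e # es) \<otimes> vx w = gap v es \<otimes> vx w \<ominus> ed e \<otimes> (gh e \<otimes> vx w)"
    using Cons e by (simp add: a_minus_def l_distr l_minus m_assoc)
  then show ?case using Cons e by (simp add: gh_vx a_minus_def)
qed (auto simp: vx_idem vx_orth V_verts)

lemma mult_gap:
  assumes "v \<in> V" "set es \<subseteq> out v" "a \<in> carrier A" "a \<otimes> vx v = a" "\<And>e. e \<in> set es \<Longrightarrow> a \<otimes> ed e = \<zero>"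
  shows "a \<otimes> gap v es = a"
  using assms(2,5)
proof (induct es)
  case (Cons e es)
  have e: "e \<in> R" "tail E e = v" "a \<otimes> ed e = \<zero>" "gap v es \<in> carrier A" using Cons outD assms(1) by auto
  have "a \<otimes> gap v (e # es) = a \<otimes> gap v es \<ominus> a \<otimes> (ed e \<otimes> gh e)"
    using e(1,2,4) assms(3) by (simp add: a_minus_def r_distr r_minus)
  also have "a \<otimes> (ed e \<otimes> gh e) = (a \<otimes> ed e) \<otimes> gh e"
    using e(1,2,4) assms(3) by (simp add: m_assoc)
  finally have "a \<otimes> gap v (e # es) = a \<otimes> gap v es \<ominus> (a \<otimes> ed e) \<otimes> gh e" .
  then show ?case using Cons e assms(3) by (simp add: a_minus_def)
qed (use assms(4) in simp)

text \<open>
  The gap over all edges starting in \<open>v\<close> is annihilated by every edge on the right and every ghost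
  edge on the left. Hence only the monomial \<open>v\<close> survives between two copies of it, and the corner is
  one dimensional.
\<close>
lemma gap_corner:
  assumes v: "v \<in> V" and es: "distinct es" "set es = out v" and nz: "gap v es \<noteq> \<zero>"
  shows "monogenic_corner A (gap v es) (gap v es)"
proof -
  let ?q = "gap v es"
  have q: "?q \<in> carrier A" using v es by auto
  have qe: "?q \<otimes> ed e = \<zero>" if e: "e \<in> R" for e
  proof (cases "tail E e = v")
    case True
    then show ?thesis using gap_ed[OF v es(1), of e] es e by (auto simp: out_def)
  next
    case False
    have "?q \<otimes> ed e = (?q \<otimes> vx v) \<otimes> ed e" using v es gap_vx[OF v _ v, of es] by simp
    also have "\<dots> = \<zero>" using False v e q by (simp add: m_assoc vx_ed)
    finally show ?thesis .
  qed
  have eq: "gh e \<otimes> ?q = \<zero>" if e: "e \<in> R" for e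
  proof (cases "tail E e = v")
    case True
    then show ?thesis using gh_gap[OF v es(1), of e] es e by (auto simp: out_def)
  next
    case False
    have "gh e \<otimes> ?q = gh e \<otimes> (vx v \<otimes> ?q)" using v es vx_gap[OF v _ v, of es] by simp
    also have "\<dots> = \<zero>" using False v e q by (simp add: m_assoc[symmetric] gh_vx)
    finally show ?thesis .
  qed
  have idem: "?q \<otimes> ?q = ?q"
    using v es q qe gap_vx[OF v _ v, of es] outD by (intro mult_gap) auto
  have q_pth: "?q \<otimes> pth \<alpha> w = \<zero> \<or> \<alpha> = [] \<and> w = v" if "walk u \<alpha> w" for u \<alpha> w
  proof (cases \<alpha>)
    case Nil then show ?thesis using that gap_vx[OF v, of es w] es walk_V[OF that] by auto
  next
    case (Cons e \<alpha>')
    then have c: "e \<in> R" "pth \<alpha>' w \<in> carrier A" using that by auto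
    then have "?q \<otimes> pth \<alpha> w = (?q \<otimes> ed e) \<otimes> pth \<alpha>' w" using Cons q by (simp add: m_assoc)
    then show ?thesis using c by (simp add: qe)
  qed
  have gpth_q: "gpth \<alpha> w \<otimes> ?q = \<zero> \<or> \<alpha> = [] \<and> w = v" if "walk u \<alpha> w" for u \<alpha> w
  proof (cases \<alpha>)
    case Nil then show ?thesis using that vx_gap[OF v, of es w] es walk_V[OF that] by auto
  next
    case (Cons e \<alpha>')
    then have c: "e \<in> R" "gpth \<alpha>' w \<in> carrier A" using that by auto
    then have "gpth \<alpha> w \<otimes> ?q = gpth \<alpha>' w \<otimes> (gh e \<otimes> ?q)" using Cons q by (simp add: m_assoc)
    then show ?thesis using c by (simp add: eq)
  qed
  have scalar: "\<exists>c. ?q \<otimes> y \<otimes> ?q = c \<odot> ?q" if y: "y \<in> carrier A" for y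
  proof -
    have "y \<in> lin_span A monomials" using y carrier_eq_span by simp
    then show ?thesis
    proof induct
      case zero then show ?case using q by (intro exI[of _ 0]) simp
    next
      case (gen s c)
      then obtain \<alpha> \<beta> u u' w where s: "s = pth \<alpha> w \<otimes> gpth \<beta> w" "walk u \<alpha> w" "walk u' \<beta> w"
        by (auto simp: monomials_def)
      have cl: "pth \<alpha> w \<in> carrier A" "gpth \<beta> w \<in> carrier A" using s by auto
      have e: "?q \<otimes> s \<otimes> ?q = (?q \<otimes> pth \<alpha> w) \<otimes> (gpth \<beta> w \<otimes> ?q)"
        using cl q s by (simp add: m_assoc)
      have "?q \<otimes> s \<otimes> ?q = \<zero> \<or> ?q \<otimes> s \<otimes> ?q = ?q"
        using q_pth[OF s(2)] gpth_q[OF s(3)] v es gap_vx[OF v _ v, of es] vx_gap[OF v _ v, of es] q cl idem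
        by (auto simp: e)
      then have "?q \<otimes> s \<otimes> ?q = 0 \<odot> ?q \<or> ?q \<otimes> s \<otimes> ?q = 1 \<odot> ?q" using q by simp
      then obtain d where "?q \<otimes> s \<otimes> ?q = d \<odot> ?q" by blast
      then have "?q \<otimes> (c \<odot> s) \<otimes> ?q = (c * d) \<odot> ?q"
        using q s cl by (simp add: smult_mult_l smult_mult_r smult_smult)
      then show ?case by blast
    next
      case (add x y)
      then obtain c d where "?q \<otimes> x \<otimes> ?q = c \<odot> ?q" "?q \<otimes> y \<otimes> ?q = d \<odot> ?q" by blast
      moreover have "x \<in> carrier A" "y \<in> carrier A" using add carrier_eq_span by auto
      ultimately have "?q \<otimes> (x \<oplus> y) \<otimes> ?q = (c + d) \<odot> ?q"
        using q by (simp add: l_distr r_distr smult_l_distr)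
      then show ?case by blast
    qed
  qed
  interpret pointed_corner A ?q ?q
    by unfold_locales (use q idem in auto)
  show ?thesis
  proof unfold_locales
    show "?q \<noteq> \<zero>" by (rule nz)
    fix y assume y: "y \<in> carrier A"
    obtain c where c: "?q \<otimes> y \<otimes> ?q = c \<odot> ?q" using scalar[OF y] by blast
    have "ev (Polynomial.monom 1 0) \<otimes> (?q \<otimes> y \<otimes> ?q) = ev [:c:]"
      using q by (simp add: c ev_pCons smult_mult_r idem)
    then show "\<exists>n p. ev (Polynomial.monom 1 n) \<otimes> (?q \<otimes> y \<otimes> ?q) = ev p" by blast
    fix z assume z: "z \<in> carrier A"
    obtain d where d: "?q \<otimes> z \<otimes> ?q = d \<odot> ?q" using scalar[OF z] by blast
    show "?q \<otimes> y \<otimes> ?q \<otimes> (?q \<otimes> z \<otimes> ?q) = ?q \<otimes> z \<otimes> ?q \<otimes> (?q \<otimes> y \<otimes> ?q)"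
      using q by (simp add: c d smult_mult_l smult_mult_r smult_smult mult.commute)
  qed
qed

text \<open>
  Besides the vertices on cycles without exits, this covers the vertices that lead into such a cycle
  without branching and those at which an infinite path without branching starts.
\<close>
definition exitless where
  "exitless u \<longleftrightarrow> (\<forall>\<sigma> \<tau> y z. walk u \<sigma> y \<longrightarrow> walk u \<tau> z \<longrightarrow> length \<sigma> = length \<tau> \<longrightarrow> \<sigma> = \<tau>)"

definition no_gaps where
  "no_gaps \<longleftrightarrow> (\<forall>v\<in>V. \<forall>es. distinct es \<longrightarrow> set es = out v \<longrightarrow> gap v es = \<zero>)"

lemma exitlessD: "exitless u \<Longrightarrow> walk u \<sigma> y \<Longrightarrow> walk u \<tau> z \<Longrightarrow> length \<sigma> = length \<tau> \<Longrightarrow> \<sigma> = \<tau>"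
  unfolding exitless_def by blast

lemma exitless_walk:
  assumes "exitless u" "walk u \<alpha> w"
  shows "exitless w"
  unfolding exitless_def
proof (intro allI impI)
  fix \<sigma> \<tau> y z assume "walk w \<sigma> y" "walk w \<tau> z" "length \<sigma> = length \<tau>"
  then have "\<alpha> @ \<sigma> = \<alpha> @ \<tau>"
    using assms by (intro exitlessD[OF assms(1), of _ y _ z]) (auto simp: walk_append)
  then show "\<sigma> = \<tau>" by simp
qed

lemma exitless_edge:
  assumes "exitless w" "no_gaps" and e: "e \<in> out w"
  shows "ed e \<otimes> gh e = vx w"
proof -
  have w: "w \<in> V" using e tail_V by (auto simp: out_def)
  have "out w = {e}"
  proof -
    have "f = e" if "f \<in> out w" for f
      using exitlessD[OF assms(1), of "[f]" "head E f" "[e]" "head E e"] that e head_V by (auto simp: out_def)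
    then show ?thesis using e by blast
  qed
  then have "gap w [e] = \<zero>" using assms(2) w unfolding no_gaps_def by (metis distinct_singleton list.set(1,2))
  then have "vx w \<ominus> ed e \<otimes> gh e = \<zero>" by simp
  from minus_zero_imp_eq[OF this] show ?thesis using w outD(1)[OF e] by auto
qed

lemma exitless_pth_gpth:
  assumes "no_gaps"
  shows "exitless u \<Longrightarrow> walk u \<tau> y \<Longrightarrow> pth \<tau> y \<otimes> gpth \<tau> y = vx u"
proof (induct \<tau> arbitrary: u)
  case Nil then show ?case by (auto simp: vx_idem V_verts)
next
  case (Cons e \<tau>)
  have w: "e \<in> R" "walk (head E e) \<tau> y" "e \<in> out u" using Cons by (auto simp: out_def)
  have c: "pth \<tau> y \<in> carrier A" "gpth \<tau> y \<in> carrier A" using w by auto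
  have "walk u [e] (head E e)" using Cons w head_V by auto
  then have "exitless (head E e)" by (rule exitless_walk[OF Cons(2)])
  then have IH: "pth \<tau> y \<otimes> gpth \<tau> y = vx (head E e)" using Cons(1) w by blast
  have "pth (e # \<tau>) y \<otimes> gpth (e # \<tau>) y = ed e \<otimes> (pth \<tau> y \<otimes> gpth \<tau> y) \<otimes> gh e"
    using w c by (simp add: m_assoc)
  also have "\<dots> = ed e \<otimes> gh e" using IH w ed_head[of e] by simp
  finally show ?case using exitless_edge[OF Cons(2) assms w(3)] by simp
qed

lemma exitless_prefix:
  assumes "exitless u" "walk u \<alpha> w" "walk u \<beta> w'" "length \<alpha> \<le> length \<beta>"
  shows "\<exists>\<kappa>. \<beta> = \<alpha> @ \<kappa> \<and> walk w \<kappa> w'"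
proof -
  have "walk u (take (length \<alpha>) \<beta> @ drop (length \<alpha>) \<beta>) w'" using assms(3) by simp
  then obtain m where m: "walk u (take (length \<alpha>) \<beta>) m" "walk m (drop (length \<alpha>) \<beta>) w'"
    by (subst (asm) walk_append) blast
  then have t: "take (length \<alpha>) \<beta> = \<alpha>" using exitlessD[OF assms(1) m(1) assms(2)] assms(4) by simp
  then have "m = w" using m(1) walk_end_unique[OF assms(2)] by auto
  then show ?thesis using m t by (metis append_take_drop_id)
qed

text \<open>
  The monomials \<open>\<alpha> \<beta>\<^sup>*\<close> of degree \<open>d = |\<alpha>| - |\<beta>|\<close> in the corner at \<open>u\<close>. At an exitless vertex there is at
  most one for each degree (\<open>shift_elem_unique\<close>), and they multiply like powers of one element.
\<close>
definition shift_elem :: "'v \<Rightarrow> int \<Rightarrow> 'a \<Rightarrow> bool" where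
  "shift_elem u d y \<longleftrightarrow> (\<exists>\<alpha> \<beta> w. walk u \<alpha> w \<and> walk u \<beta> w \<and> d = int (length \<alpha>) - int (length \<beta>) \<and>
     y = pth \<alpha> w \<otimes> gpth \<beta> w)"

context
  fixes u assumes no_gaps: "no_gaps" and u: "u \<in> V" and exl: "exitless u"
begin

lemma shift_elem_closed: "shift_elem u d y \<Longrightarrow> y \<in> carrier A"
  by (auto simp: shift_elem_def)

lemma shift_elem_zero: "shift_elem u 0 (vx u)"
  using u by (auto simp: shift_elem_def vx_idem V_verts intro!: exI[of _ "[]"] exI[of _ u])

lemma shift_elem_minus: "shift_elem u d y \<Longrightarrow> \<exists>z. shift_elem u (- d) z"
  unfolding shift_elem_def by (metis minus_diff_eq)

text \<open>
  The longer monomial arises from the shorter one by inserting \<open>\<kappa> \<kappa>\<^sup>*\<close> for a common continuation \<open>\<kappa>\<close> of the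
  two walks. Without gaps and exits, \<open>\<kappa> \<kappa>\<^sup>*\<close> is a vertex.
\<close>
lemma shift_elem_unique_aux:
  assumes "walk u \<alpha> w" "walk u \<beta> w" "walk u \<alpha>' w'" "walk u \<beta>' w'"
    "int (length \<alpha>) - int (length \<beta>) = int (length \<alpha>') - int (length \<beta>')" "length \<alpha> \<le> length \<alpha>'"
  shows "pth \<alpha> w \<otimes> gpth \<beta> w = pth \<alpha>' w' \<otimes> gpth \<beta>' w'"
proof -
  obtain \<kappa> where \<kappa>: "\<alpha>' = \<alpha> @ \<kappa>" "walk w \<kappa> w'" using exitless_prefix[OF exl assms(1,3,6)] by blast
  obtain \<nu> where \<nu>: "\<beta>' = \<beta> @ \<nu>" "walk w \<nu> w'" using exitless_prefix[OF exl assms(2,4)] assms(5,6) by auto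
  have exw: "exitless w" by (rule exitless_walk[OF exl assms(1)])
  have "\<nu> = \<kappa>" using exitlessD[OF exw \<kappa>(2) \<nu>(2)] assms(5) \<kappa> \<nu> by simp
  moreover have c: "pth \<alpha> w \<in> carrier A" "gpth \<beta> w \<in> carrier A" "pth \<kappa> w' \<in> carrier A" "gpth \<kappa> w' \<in> carrier A"
    using assms \<kappa> by auto
  ultimately have "pth \<alpha>' w' \<otimes> gpth \<beta>' w' = pth \<alpha> w \<otimes> ((pth \<kappa> w' \<otimes> gpth \<kappa> w') \<otimes> gpth \<beta> w)"
    using \<kappa> \<nu> by (simp add: pth_append[OF assms(1) \<kappa>(2)] gpth_append[OF assms(2) \<kappa>(2)] m_assoc)
  also have "\<dots> = pth \<alpha> w \<otimes> gpth \<beta> w"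
    using exitless_pth_gpth[OF no_gaps exw \<kappa>(2)] vx_gpth[OF assms(2)] by simp
  finally show ?thesis by simp
qed

lemma shift_elem_unique:
  assumes "shift_elem u d y" "shift_elem u d z"
  shows "y = z"
proof -
  obtain \<alpha> \<beta> w where a: "walk u \<alpha> w" "walk u \<beta> w" "d = int (length \<alpha>) - int (length \<beta>)"
    "y = pth \<alpha> w \<otimes> gpth \<beta> w" using assms(1) by (auto simp: shift_elem_def)
  obtain \<alpha>' \<beta>' w' where b: "walk u \<alpha>' w'" "walk u \<beta>' w'" "d = int (length \<alpha>') - int (length \<beta>')"
    "z = pth \<alpha>' w' \<otimes> gpth \<beta>' w'" using assms(2) by (auto simp: shift_elem_def)
  show ?thesis
    using shift_elem_unique_aux[OF a(1,2) b(1,2)] shift_elem_unique_aux[OF b(1,2) a(1,2)] a b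
    by (cases "length \<alpha> \<le> length \<alpha>'") auto
qed

lemma shift_elem_mult:
  assumes "shift_elem u d y" "shift_elem u d' z"
  shows "shift_elem u (d + d') (y \<otimes> z)"
proof -
  obtain \<alpha> \<beta> w where a: "walk u \<alpha> w" "walk u \<beta> w" "d = int (length \<alpha>) - int (length \<beta>)"
    "y = pth \<alpha> w \<otimes> gpth \<beta> w" using assms(1) by (auto simp: shift_elem_def)
  obtain \<alpha>' \<beta>' w' where b: "walk u \<alpha>' w'" "walk u \<beta>' w'" "d' = int (length \<alpha>') - int (length \<beta>')"
    "z = pth \<alpha>' w' \<otimes> gpth \<beta>' w'" using assms(2) by (auto simp: shift_elem_def)
  have c: "pth \<alpha> w \<in> carrier A" "gpth \<beta> w \<in> carrier A" "pth \<alpha>' w' \<in> carrier A" "gpth \<beta>' w' \<in> carrier A"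
    using a b by auto
  have yz: "y \<otimes> z = pth \<alpha> w \<otimes> (gpth \<beta> w \<otimes> pth \<alpha>' w') \<otimes> gpth \<beta>' w'"
    using a b c by (simp add: m_assoc)
  show ?thesis
  proof (cases "length \<beta> \<le> length \<alpha>'")
    case True
    then obtain \<kappa> where \<kappa>: "\<alpha>' = \<beta> @ \<kappa>" "walk w \<kappa> w'" using exitless_prefix[OF exl a(2) b(1)] by blast
    have "y \<otimes> z = pth (\<alpha> @ \<kappa>) w' \<otimes> gpth \<beta>' w'"
      using yz gpth_pth_append(1)[OF a(2) \<kappa>(2)] \<kappa> by (simp add: pth_append[OF a(1) \<kappa>(2)])
    moreover have "walk u (\<alpha> @ \<kappa>) w'" using a \<kappa> by (auto simp: walk_append)
    ultimately show ?thesis using a b \<kappa> unfolding shift_elem_def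
      by (intro exI[of _ "\<alpha> @ \<kappa>"] exI[of _ \<beta>'] exI[of _ w']) auto
  next
    case False
    then obtain \<kappa> where \<kappa>: "\<beta> = \<alpha>' @ \<kappa>" "walk w' \<kappa> w" using exitless_prefix[OF exl b(1) a(2)] by auto
    have "y \<otimes> z = pth \<alpha> w \<otimes> (gpth \<kappa> w \<otimes> gpth \<beta>' w')"
      using yz gpth_pth_append(2)[OF b(1) \<kappa>(2)] \<kappa> c gpth_closed[OF \<kappa>(2)] by (simp add: m_assoc)
    then have "y \<otimes> z = pth \<alpha> w \<otimes> gpth (\<beta>' @ \<kappa>) w"
      by (simp add: gpth_append[OF b(2) \<kappa>(2)])
    moreover have "walk u (\<beta>' @ \<kappa>) w" using b \<kappa> by (auto simp: walk_append)
    ultimately show ?thesis using a b \<kappa> unfolding shift_elem_def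
      by (intro exI[of _ \<alpha>] exI[of _ "\<beta>' @ \<kappa>"] exI[of _ w]) auto
  qed
qed

lemma corner_in_shift_span:
  assumes "y \<in> carrier A"
  shows "vx u \<otimes> y \<otimes> vx u \<in> lin_span A {z. \<exists>d. shift_elem u d z}" (is "_ \<in> lin_span A ?S")
proof -
  have S: "?S \<subseteq> carrier A" using shift_elem_closed by auto
  have "y \<in> lin_span A monomials" using assms carrier_eq_span by simp
  then show ?thesis
  proof induct
    case zero then show ?case using u by (simp add: lin_span.zero)
  next
    case (gen s c)
    then obtain \<alpha> \<beta> v v' w where s: "s = pth \<alpha> w \<otimes> gpth \<beta> w" "walk v \<alpha> w" "walk v' \<beta> w"
      by (auto simp: monomials_def)
    have cl: "pth \<alpha> w \<in> carrier A" "gpth \<beta> w \<in> carrier A" using s by auto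
    have e: "vx u \<otimes> (c \<odot> s) \<otimes> vx u = c \<odot> ((vx u \<otimes> pth \<alpha> w) \<otimes> (gpth \<beta> w \<otimes> vx u))"
      using cl u s by (simp add: m_assoc smult_mult_l smult_mult_r)
    show ?case
    proof (cases "v = u \<and> v' = u")
      case True
      then have "s \<in> ?S" using s by (auto simp: shift_elem_def)
      moreover have "(vx u \<otimes> pth \<alpha> w) \<otimes> (gpth \<beta> w \<otimes> vx u) = s"
        using True s u by (simp add: vx_pth gpth_vx)
      ultimately show ?thesis using e by (metis lin_span.gen)
    next
      case False
      then have "(vx u \<otimes> pth \<alpha> w) \<otimes> (gpth \<beta> w \<otimes> vx u) = \<zero>"
        using s u cl vx_pth[OF s(2) u] gpth_vx[OF s(3) u] by auto
      then show ?thesis using e by (simp add: lin_span.zero)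
    qed
  next
    case (add x y)
    then have "x \<in> carrier A" "y \<in> carrier A" using carrier_eq_span by auto
    then show ?case using add u by (simp add: l_distr r_distr lin_span.add)
  qed
qed

text \<open>
  The degrees of monomials at \<open>u\<close> form a subgroup \<open>m \<int>\<close> of the integers. The monomial \<open>x\<close> of degree \<open>m\<close>
  generates the corner, together with its inverse. For \<open>m = 0\<close> the corner is \<open>K u\<close>.
\<close>
lemma exitless_corner: "\<exists>x. monogenic_corner A (vx u) x"
proof -
  let ?D = "{d. \<exists>y. shift_elem u d y}"
  let ?S = "{z. \<exists>d. shift_elem u d z}"
  have S: "?S \<subseteq> carrier A" using shift_elem_closed by auto
  have "\<exists>m\<in>?D. \<forall>a\<in>?D. m dvd a"
    by (rule int_subgroup_cyclic) (use shift_elem_zero shift_elem_mult shift_elem_minus in blast)+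
  then obtain m x where x: "shift_elem u m x" and m: "\<And>d y. shift_elem u d y \<Longrightarrow> m dvd d" by blast
  have xc: "x \<in> carrier A" using x by (rule shift_elem_closed)
  have x0: "x \<noteq> \<zero>"
  proof
    assume x_zero: "x = \<zero>"
    obtain z where z: "shift_elem u (- m) z" using shift_elem_minus[OF x] by blast
    have "x \<otimes> z = vx u"
      using shift_elem_unique[OF shift_elem_mult[OF x z]] shift_elem_zero by simp
    then show False using x_zero shift_elem_closed[OF z] V_nonzero[OF u] by simp
  qed
  have vu: "vx u \<otimes> x = x" "x \<otimes> vx u = x"
    using shift_elem_unique[OF shift_elem_mult[OF shift_elem_zero x], of x]
      shift_elem_unique[OF shift_elem_mult[OF x shift_elem_zero], of x] x by simp_all
  interpret pointed_corner A "vx u" x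
    by unfold_locales (use u xc vu in \<open>auto simp: vx_idem V_verts\<close>)
  have pow: "shift_elem u (m * int n) (ev (Polynomial.monom 1 n))" for n
  proof (induct n)
    case 0 then show ?case using shift_elem_zero by simp
  next
    case (Suc n)
    have "ev (Polynomial.monom 1 (Suc n)) = x \<otimes> ev (Polynomial.monom 1 n)"
      using u by (simp add: monom_Suc ev_pCons)
    then show ?case using shift_elem_mult[OF x Suc] by (simp add: distrib_left)
  qed
  have frac: "\<exists>n p. ev (Polynomial.monom 1 n) \<otimes> y = ev p" if "y \<in> lin_span A ?S" for y
    using that
  proof induct
    case zero
    have "ev (Polynomial.monom 1 0) \<otimes> \<zero> = ev 0" by simp
    then show ?case by blast
  next
    case (gen s c)
    then obtain d where d: "shift_elem u d s" by blast
    obtain j where j: "d = m * j" using m[OF d] by (auto simp: dvd_def)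
    \<comment> \<open>The power \<open>n\<close> is large enough to make the degree a nonnegative multiple of \<open>m\<close>.\<close>
    define n where "n = nat \<bar>j\<bar>"
    define l where "l = nat (int n + j)"
    have l: "m * int n + d = m * int l" by (simp add: j n_def l_def distrib_left)
    have "ev (Polynomial.monom 1 n) \<otimes> s = ev (Polynomial.monom 1 l)"
      using shift_elem_unique[OF shift_elem_mult[OF pow d, of n]] pow[of l] by (simp add: l)
    then have "ev (Polynomial.monom 1 n) \<otimes> (c \<odot> s) = ev (Polynomial.smult c (Polynomial.monom 1 l))"
      using shift_elem_closed[OF d] by (simp only: smult_mult_r ev_smult ev_closed)
    then show ?case by blast
  next
    case (add y z)
    then obtain n p n' p' where np: "ev (Polynomial.monom 1 n) \<otimes> y = ev p" "ev (Polynomial.monom 1 n') \<otimes> z = ev p'"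
      by blast
    have c: "y \<in> carrier A" "z \<in> carrier A" using add lin_span_closed[OF S] by auto
    have 1: "ev (Polynomial.monom 1 (n' + n)) \<otimes> y = ev (Polynomial.monom 1 n' * p)"
      using c np by (simp add: ev_monom_add m_assoc ev_mult)
    have 2: "ev (Polynomial.monom 1 (n + n')) \<otimes> z = ev (Polynomial.monom 1 n * p')"
      using c np by (simp only: ev_monom_add m_assoc ev_mult ev_closed)
    have "ev (Polynomial.monom 1 (n' + n)) \<otimes> (y \<oplus> z) = ev (Polynomial.monom 1 n' * p + Polynomial.monom 1 n * p')"
      using c 1 2 by (simp only: r_distr ev_add ev_closed add.commute[of n' n])
    then show ?case by blast
  qed
  have "monogenic_corner A (vx u) x"
  proof unfold_locales
    show "vx u \<noteq> \<zero>" "x \<noteq> \<zero>" using V_nonzero[OF u] x0 by auto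
    fix y assume y: "y \<in> carrier A"
    show "\<exists>n p. ev (Polynomial.monom 1 n) \<otimes> (vx u \<otimes> y \<otimes> vx u) = ev p"
      by (rule frac[OF corner_in_shift_span[OF y]])
    fix z assume z: "z \<in> carrier A"
    show "vx u \<otimes> y \<otimes> vx u \<otimes> (vx u \<otimes> z \<otimes> vx u) = vx u \<otimes> z \<otimes> vx u \<otimes> (vx u \<otimes> y \<otimes> vx u)"
    proof (rule lin_span_commute[OF S _ corner_in_shift_span[OF y] corner_in_shift_span[OF z]])
      fix s t assume "s \<in> ?S" "t \<in> ?S"
      then obtain c d where cd: "shift_elem u c s" "shift_elem u d t" by blast
      show "s \<otimes> t = t \<otimes> s"
        using shift_elem_unique[OF shift_elem_mult[OF cd]] shift_elem_mult[OF cd(2,1)]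
        by (simp add: add.commute)
    qed
  qed
  then show ?thesis by blast
qed

end

end

section \<open>Reduction of elements to vertices\<close>
text \<open>
  Both lists are the initial segment, of their common length, of the periodic sequence \<open>\<alpha> \<alpha> \<alpha> \<dots>\<close>.
\<close>
lemma append_prefix_unique:
  assumes "\<alpha> \<noteq> []" "\<alpha> @ \<beta> = \<beta> @ z" "\<alpha> @ \<beta>' = \<beta>' @ z'" "length \<beta> = length \<beta>'"
  shows "\<beta> = \<beta>'"
proof (rule nth_equalityI[OF assms(4)])
  fix i assume "i < length \<beta>"
  then show "\<beta> ! i = \<beta>' ! i"
  proof (induct i rule: less_induct)
    case (less i)
    have i': "i < length \<beta>'" using less assms(4) by simp
    have 1: "\<beta> ! i = (\<alpha> @ \<beta>) ! i" using less(2) assms(2) by (simp add: nth_append)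
    have 2: "\<beta>' ! i = (\<alpha> @ \<beta>') ! i" using i' assms(3) by (simp add: nth_append)
    show ?case
    proof (cases "i < length \<alpha>")
      case True then show ?thesis using 1 2 by (simp add: nth_append)
    next
      case False
      have "\<beta> ! (i - length \<alpha>) = \<beta>' ! (i - length \<alpha>)"
      proof (rule less(1))
        have "0 < length \<alpha>" using assms(1) by simp
        then show "i - length \<alpha> < i" using False by linarith
        show "i - length \<alpha> < length \<beta>" using less(2) by simp
      qed
      then show ?thesis using 1 2 False by (simp add: nth_append)
    qed
  qed
qed

context path_algebra
begin

text \<open>
  The numbers bound the lengths on which the inductions run. Multiplication by an edge on the right
  lowers the level in \<open>mixed_mons\<close>, and multiplication by a ghost edge on the left leads from
  \<open>pos_mons\<close> to a lower level of \<open>real_mons\<close>.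
\<close>
definition real_mons where "real_mons w n = {pth \<alpha> w | \<alpha> u. walk u \<alpha> w \<and> length \<alpha> \<le> n}"
definition pos_mons where "pos_mons w n = {pth \<alpha> w | \<alpha> u. walk u \<alpha> w \<and> \<alpha> \<noteq> [] \<and> length \<alpha> \<le> n}"
definition mixed_mons where
  "mixed_mons v n = {pth \<alpha> w \<otimes> gpth \<beta> w | \<alpha> \<beta> u w. walk u \<alpha> w \<and> walk v \<beta> w \<and> length \<beta> \<le> n}"
definition closed_mons where "closed_mons w = {pth \<alpha> w | \<alpha>. walk w \<alpha> w \<and> \<alpha> \<noteq> []}"

abbreviation "Real w n \<equiv> lin_span A (real_mons w n)"
abbreviation "Pos w n \<equiv> lin_span A (pos_mons w n)"
abbreviation "Mixed v n \<equiv> lin_span A (mixed_mons v n)"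
abbreviation "Closed w \<equiv> lin_span A (closed_mons w)"

lemma mons_closed:
  "real_mons w n \<subseteq> carrier A" "pos_mons w n \<subseteq> carrier A" "mixed_mons v n \<subseteq> carrier A" "closed_mons w \<subseteq> carrier A"
  by (auto simp: real_mons_def pos_mons_def mixed_mons_def closed_mons_def)

lemma Real_closed: "p \<in> Real w n \<Longrightarrow> p \<in> carrier A"
  and Pos_closed: "p \<in> Pos w n \<Longrightarrow> p \<in> carrier A"
  and Mixed_closed: "p \<in> Mixed v n \<Longrightarrow> p \<in> carrier A"
  and Closed_closed: "p \<in> Closed w \<Longrightarrow> p \<in> carrier A"
  using lin_span_closed[OF mons_closed(1)] lin_span_closed[OF mons_closed(2)]
    lin_span_closed[OF mons_closed(3)] lin_span_closed[OF mons_closed(4)] by blast+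

lemma Real_mono: "p \<in> Real w n \<Longrightarrow> n \<le> m \<Longrightarrow> p \<in> Real w m"
  by (erule lin_span_mono) (force simp: real_mons_def)

lemma Mixed_mono: "p \<in> Mixed w n \<Longrightarrow> n \<le> m \<Longrightarrow> p \<in> Mixed w m"
  by (erule lin_span_mono) (fastforce simp: mixed_mons_def)

lemma Mixed_vx:
  assumes "v \<in> V" "a \<in> Mixed v n"
  shows "a \<otimes> vx v = a"
  using assms(2)
proof induct
  case zero then show ?case using assms(1) by auto
next
  case (gen s c)
  then obtain \<alpha> \<beta> u w where s: "s = pth \<alpha> w \<otimes> gpth \<beta> w" "walk u \<alpha> w" "walk v \<beta> w"
    by (auto simp: mixed_mons_def)
  have "pth \<alpha> w \<in> carrier A" "gpth \<beta> w \<in> carrier A" using s by auto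
  then show ?case using s assms(1) by (simp add: smult_mult_l m_assoc gpth_vx)
next
  case (add x y)
  then show ?case using Mixed_closed assms(1) by (simp add: l_distr)
qed

lemma Mixed_ed:
  assumes e: "e \<in> out v" and a: "a \<in> Mixed v (Suc n)"
  shows "a \<otimes> ed e \<in> Mixed (head E e) n"
proof (rule lin_span_mult_right[OF mons_closed(3) mons_closed(3) _ _ a])
  have eR: "e \<in> R" "tail E e = v" using e by (auto simp: out_def)
  then show "ed e \<in> carrier A" by simp
  have h: "walk (head E e) [] (head E e)" using head_V[OF eR(1)] by simp
  fix s assume "s \<in> mixed_mons v (Suc n)"
  then obtain \<alpha> \<beta> u w where s: "s = pth \<alpha> w \<otimes> gpth \<beta> w" "walk u \<alpha> w" "walk v \<beta> w" "length \<beta> \<le> Suc n"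
    by (auto simp: mixed_mons_def)
  have c: "pth \<alpha> w \<in> carrier A" "gpth \<beta> w \<in> carrier A" using s by auto
  have base: "t \<in> Mixed (head E e) n" if "t \<in> mixed_mons (head E e) n" for t
    using lin_span_base[OF mons_closed(3) that] .
  show "s \<otimes> ed e \<in> Mixed (head E e) n"
  proof (cases \<beta>)
    case Nil
    then have w: "w = v" using s by simp
    have we: "walk v [e] (head E e)" using eR h by simp
    have "s \<otimes> ed e = pth \<alpha> v \<otimes> pth [e] (head E e) \<otimes> gpth [] (head E e)"
      using s c w Nil eR head_V[OF eR(1)] by (simp add: pth_vx m_assoc ed_head)
    also have "\<dots> = pth (\<alpha> @ [e]) (head E e) \<otimes> gpth [] (head E e)"
      using s w we by (simp add: pth_append[of u \<alpha> v "[e]" "head E e"])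
    finally have "s \<otimes> ed e = pth (\<alpha> @ [e]) (head E e) \<otimes> gpth [] (head E e)" .
    moreover have "walk u (\<alpha> @ [e]) (head E e)" using s w we by (auto simp: walk_append)
    ultimately have "s \<otimes> ed e \<in> mixed_mons (head E e) n" using h unfolding mixed_mons_def by fastforce
    then show ?thesis by (rule base)
  next
    case (Cons f \<beta>')
    then have f: "f \<in> R" "walk (head E f) \<beta>' w" "length \<beta>' \<le> n" using s by auto
    have c': "gpth \<beta>' w \<in> carrier A" using f by auto
    have eq: "s \<otimes> ed e = pth \<alpha> w \<otimes> (gpth \<beta>' w \<otimes> (gh f \<otimes> ed e))"
      using s c c' Cons f eR by (simp add: m_assoc)
    show ?thesis
    proof (cases "f = e")
      case True
      then have "s \<otimes> ed e = pth \<alpha> w \<otimes> gpth \<beta>' w"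
        using eq f head_V[OF eR(1)] by (simp add: gh_ed gpth_vx)
      then have "s \<otimes> ed e \<in> mixed_mons (head E e) n" using f s True unfolding mixed_mons_def by blast
      then show ?thesis by (rule base)
    next
      case False
      then show ?thesis using eq c c' f eR by (simp add: gh_ed lin_span.zero)
    qed
  qed
qed

lemma Mixed_zero_Real: "a \<in> Mixed v 0 \<Longrightarrow> \<exists>n. a \<in> Real v n"
proof (induct rule: lin_span.induct)
  case zero then show ?case using lin_span.zero by blast
next
  case (gen s c)
  then obtain \<alpha> u where "s = pth \<alpha> v \<otimes> vx v" "walk u \<alpha> v" by (auto simp: mixed_mons_def)
  then have "s \<in> real_mons v (length \<alpha>)" by (auto simp: real_mons_def pth_vx)
  then show ?case by (blast intro: lin_span.gen)
next
  case (add x y)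
  then obtain m n where "x \<in> Real v m" "y \<in> Real v n" by blast
  then have "x \<oplus> y \<in> Real v (max m n)" by (intro lin_span.add) (auto intro: Real_mono)
  then show ?case by blast
qed

text \<open>
  Multiplication by a gap over sufficiently many edges kills all monomials with a ghost part of
  positive length. The set \<open>T\<close> consists of the first edges of these ghost parts.
\<close>
lemma Mixed_real_part:
  assumes v: "v \<in> V" and a: "a \<in> Mixed v n"
  shows "\<exists>p m T. p \<in> Real v m \<and> finite T \<and> T \<subseteq> out v \<and>
    (\<forall>es. distinct es \<longrightarrow> T \<subseteq> set es \<longrightarrow> set es \<subseteq> out v \<longrightarrow> a \<otimes> gap v es = p \<otimes> gap v es)"
  using a
proof induct
  case zero
  show ?case by (intro exI[of _ \<zero>] exI[of _ 0] exI[of _ "{}"]) (auto simp: lin_span.zero)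
next
  case (gen s c)
  then obtain \<alpha> \<beta> u w where s: "s = pth \<alpha> w \<otimes> gpth \<beta> w" "walk u \<alpha> w" "walk v \<beta> w"
    by (auto simp: mixed_mons_def)
  have c: "pth \<alpha> w \<in> carrier A" "gpth \<beta> w \<in> carrier A" using s by auto
  show ?case
  proof (cases \<beta>)
    case Nil
    then have "s = pth \<alpha> v" using s by (auto simp: pth_vx)
    then have "s \<in> real_mons v (length \<alpha>)" using s Nil by (auto simp: real_mons_def)
    then have "c \<odot> s \<in> Real v (length \<alpha>)" by (rule lin_span.gen)
    then show ?thesis by blast
  next
    case (Cons f \<beta>')
    then have f: "f \<in> out v" "f \<in> R" "gpth \<beta>' w \<in> carrier A" using s by (auto simp: out_def)
    have "(c \<odot> s) \<otimes> gap v es = \<zero> \<otimes> gap v es"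
      if es: "distinct es" "{f} \<subseteq> set es" "set es \<subseteq> out v" for es
    proof -
      have "s \<otimes> gap v es = pth \<alpha> w \<otimes> (gpth \<beta>' w \<otimes> (gh f \<otimes> gap v es))"
        using s c f Cons v es by (simp add: m_assoc)
      then show ?thesis using gh_gap[OF v es(1,3) f(1)] es s c f v by (simp add: smult_mult_l)
    qed
    then show ?thesis using f lin_span.zero
      by (intro exI[of _ \<zero>] exI[of _ 0] exI[of _ "{f}"]) auto
  qed
next
  case (add x y)
  obtain p m T where p: "p \<in> Real v m" "finite T" "T \<subseteq> out v"
    "\<And>es. distinct es \<Longrightarrow> T \<subseteq> set es \<Longrightarrow> set es \<subseteq> out v \<Longrightarrow> x \<otimes> gap v es = p \<otimes> gap v es"
    using add(2) by blast
  obtain q n U where q: "q \<in> Real v n" "finite U" "U \<subseteq> out v"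
    "\<And>es. distinct es \<Longrightarrow> U \<subseteq> set es \<Longrightarrow> set es \<subseteq> out v \<Longrightarrow> y \<otimes> gap v es = q \<otimes> gap v es"
    using add(4) by blast
  have "p \<oplus> q \<in> Real v (max m n)" using p q by (intro lin_span.add) (auto intro: Real_mono)
  moreover have "(x \<oplus> y) \<otimes> gap v es = (p \<oplus> q) \<otimes> gap v es"
    if "distinct es" "T \<union> U \<subseteq> set es" "set es \<subseteq> out v" for es
    using p(4)[of es] q(4)[of es] that add Mixed_closed Real_closed[OF p(1)] Real_closed[OF q(1)] v
    by (simp add: l_distr)
  ultimately show ?case using p q
    by (intro exI[of _ "p \<oplus> q"] exI[of _ "max m n"] exI[of _ "T \<union> U"]) blast
qed

lemma Real_decompose:
  assumes w: "w \<in> V" and p: "p \<in> Real w n"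
  shows "\<exists>k q. q \<in> Pos w n \<and> p = k \<odot> vx w \<oplus> q"
  using p
proof induct
  case zero
  have "\<zero> = 0 \<odot> vx w \<oplus> \<zero>" using w by simp
  then show ?case using lin_span.zero by blast
next
  case (gen s c)
  then obtain \<alpha> u where s: "s = pth \<alpha> w" "walk u \<alpha> w" "length \<alpha> \<le> n" by (auto simp: real_mons_def)
  show ?case
  proof (cases "\<alpha> = []")
    case True
    then have "c \<odot> s = c \<odot> vx w \<oplus> \<zero>" using s w by simp
    then show ?thesis using lin_span.zero by blast
  next
    case False
    then have "s \<in> pos_mons w n" using s by (auto simp: pos_mons_def)
    then have "c \<odot> s \<in> Pos w n" by (rule lin_span.gen)
    moreover have "c \<odot> s = 0 \<odot> vx w \<oplus> c \<odot> s" using s w by auto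
    ultimately show ?thesis by blast
  qed
next
  case (add x y)
  then obtain k q l r where d: "q \<in> Pos w n" "x = k \<odot> vx w \<oplus> q" "r \<in> Pos w n" "y = l \<odot> vx w \<oplus> r" by blast
  have "x \<oplus> y = (k + l) \<odot> vx w \<oplus> (q \<oplus> r)"
    using d Pos_closed w by (simp add: smult_l_distr a_ac)
  then show ?case using lin_span.add[OF d(1,3)] by blast
qed

lemma Pos_gh:
  assumes e: "e \<in> R" and p: "p \<in> Pos w (Suc n)"
  shows "gh e \<otimes> p \<in> Real w n"
proof (rule lin_span_mult_left[OF mons_closed(2) mons_closed(1) _ _ p])
  show "gh e \<in> carrier A" using e by simp
  fix s assume "s \<in> pos_mons w (Suc n)"
  then obtain f \<alpha> where s: "s = ed f \<otimes> pth \<alpha> w" "f \<in> R" "walk (head E f) \<alpha> w" "length \<alpha> \<le> n"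
    by (auto simp: pos_mons_def neq_Nil_conv)
  have c: "pth \<alpha> w \<in> carrier A" using s by auto
  have eq: "gh e \<otimes> s = (gh e \<otimes> ed f) \<otimes> pth \<alpha> w" using s e c by (simp add: m_assoc)
  show "gh e \<otimes> s \<in> Real w n"
  proof (cases "e = f")
    case True
    then have "gh e \<otimes> s = pth \<alpha> w" using eq s head_V[OF s(2)] by (simp add: gh_ed vx_pth)
    then have "gh e \<otimes> s \<in> real_mons w n" using s by (auto simp: real_mons_def)
    then show ?thesis by (rule lin_span_base[OF mons_closed(1)])
  next
    case False
    then show ?thesis using eq s e c by (simp add: gh_ed lin_span.zero)
  qed
qed

lemma Pos_finite_first_edges:
  "p \<in> Pos w n \<Longrightarrow> \<exists>T. finite T \<and> (\<forall>f\<in>R - T. gh f \<otimes> p = \<zero>)"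
proof (induct rule: lin_span.induct)
  case zero then show ?case by (intro exI[of _ "{}"]) auto
next
  case (gen s c)
  then obtain e \<alpha> where s: "s = ed e \<otimes> pth \<alpha> w" "e \<in> R" "walk (head E e) \<alpha> w"
    by (auto simp: pos_mons_def neq_Nil_conv)
  have cl: "pth \<alpha> w \<in> carrier A" using s by auto
  have "gh f \<otimes> (c \<odot> s) = \<zero>" if "f \<in> R - {e}" for f
  proof -
    have "gh f \<otimes> s = (gh f \<otimes> ed e) \<otimes> pth \<alpha> w" using s that cl by (simp add: m_assoc)
    also have "\<dots> = \<zero>" using s that cl by (auto simp: gh_ed)
    finally show ?thesis using s that cl by (simp add: smult_mult_r)
  qed
  then show ?case by (intro exI[of _ "{e}"]) auto
next
  case (add x y)
  then obtain T U where "finite T" "finite U" and z: "\<forall>f\<in>R - T. gh f \<otimes> x = \<zero>" "\<forall>f\<in>R - U. gh f \<otimes> y = \<zero>" by blast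
  then show ?case using add Pos_closed by (intro exI[of _ "T \<union> U"]) (auto simp: r_distr)
qed

text \<open>
  The operator \<open>p \<mapsto> \<Sum> e e\<^sup>* p\<close>. It fixes a combination of paths of positive length if the list contains
  their first edges.
\<close>
primrec edge_proj :: "'e list \<Rightarrow> 'a \<Rightarrow> 'a" where
  "edge_proj [] p = \<zero>"
| "edge_proj (e # es) p = ed e \<otimes> (gh e \<otimes> p) \<oplus> edge_proj es p"

lemma edge_proj_closed: "set es \<subseteq> R \<Longrightarrow> p \<in> carrier A \<Longrightarrow> edge_proj es p \<in> carrier A"
  by (induct es) auto

lemma edge_proj_add:
  "set es \<subseteq> R \<Longrightarrow> p \<in> carrier A \<Longrightarrow> q \<in> carrier A \<Longrightarrow> edge_proj es (p \<oplus> q) = edge_proj es p \<oplus> edge_proj es q"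
  by (induct es) (auto simp: r_distr edge_proj_closed a_ac)

lemma edge_proj_smult:
  "set es \<subseteq> R \<Longrightarrow> p \<in> carrier A \<Longrightarrow> edge_proj es (c \<odot> p) = c \<odot> edge_proj es p"
  by (induct es) (auto simp: smult_r_distr edge_proj_closed smult_mult_r)

lemma edge_proj_ed:
  assumes "f \<in> R" "p \<in> carrier A"
  shows "set es \<subseteq> R \<Longrightarrow> distinct es \<Longrightarrow> edge_proj es (ed f \<otimes> p) = (if f \<in> set es then ed f \<otimes> p else \<zero>)"
proof (induct es)
  case (Cons e es)
  have "ed e \<otimes> (gh e \<otimes> (ed f \<otimes> p)) = ed e \<otimes> (gh e \<otimes> ed f) \<otimes> p"
    using assms Cons by (simp add: m_assoc)
  also have "\<dots> = (if e = f then ed f \<otimes> p else \<zero>)"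
    using assms Cons ed_head[of f] by (auto simp: gh_ed)
  finally show ?case using Cons assms by auto
qed simp

lemma Pos_reconstruct:
  "p \<in> Pos w n \<Longrightarrow> \<exists>T. finite T \<and> T \<subseteq> R \<and>
     (\<forall>es. distinct es \<longrightarrow> T \<subseteq> set es \<longrightarrow> set es \<subseteq> R \<longrightarrow> edge_proj es p = p)"
proof (induct rule: lin_span.induct)
  case zero
  have "edge_proj es \<zero> = \<zero>" if "set es \<subseteq> R" for es using that by (induct es) auto
  then show ?case by (intro exI[of _ "{}"]) auto
next
  case (gen s c)
  then obtain e \<alpha> where s: "s = ed e \<otimes> pth \<alpha> w" "e \<in> R" "walk (head E e) \<alpha> w"
    by (auto simp: pos_mons_def neq_Nil_conv)
  have cl: "pth \<alpha> w \<in> carrier A" using s by auto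
  then show ?case using s
    by (intro exI[of _ "{e}"]) (auto simp: edge_proj_smult edge_proj_ed)
next
  case (add x y)
  then obtain T U where TU: "finite T" "T \<subseteq> R" "finite U" "U \<subseteq> R"
    and z: "\<And>es. distinct es \<Longrightarrow> T \<subseteq> set es \<Longrightarrow> set es \<subseteq> R \<Longrightarrow> edge_proj es x = x"
      "\<And>es. distinct es \<Longrightarrow> U \<subseteq> set es \<Longrightarrow> set es \<subseteq> R \<Longrightarrow> edge_proj es y = y"
    by blast
  have "edge_proj es (x \<oplus> y) = x \<oplus> y" if "distinct es" "T \<union> U \<subseteq> set es" "set es \<subseteq> R" for es
    using z[of es] that add(1,3) Pos_closed by (simp add: edge_proj_add)
  then show ?case using TU by (intro exI[of _ "T \<union> U"]) auto
qed

lemma Pos_zero: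
  assumes "p \<in> Pos w n" "\<And>e. e \<in> R \<Longrightarrow> gh e \<otimes> p = \<zero>"
  shows "p = \<zero>"
proof -
  obtain T where T: "finite T" "T \<subseteq> R"
    "\<And>es. distinct es \<Longrightarrow> T \<subseteq> set es \<Longrightarrow> set es \<subseteq> R \<Longrightarrow> edge_proj es p = p"
    using Pos_reconstruct[OF assms(1)] by blast
  obtain es where es: "set es = T" "distinct es" using finite_distinct_list[OF T(1)] by blast
  have "edge_proj es p = \<zero>" if "set es \<subseteq> R" for es using that assms(2) by (induct es) auto
  then show ?thesis using T es by auto
qed

lemma Pos_0: "p \<in> Pos w 0 \<Longrightarrow> p = \<zero>"
  using lin_span_empty by (auto simp: pos_mons_def)

text \<open>
  This replaces linear independence of paths, which can fail in \<open>A\<close>: a cycle without exits may satisfy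
  a polynomial equation. Write \<open>p = k v + q\<close> with paths of positive length in \<open>q\<close>. For all but finitely
  many edges \<open>f\<close> starting in \<open>v\<close> one has \<open>f\<^sup>* p f = k r(f)\<close>, so \<open>k = 0\<close>. The same then applies to the shorter
  combinations \<open>e\<^sup>* p\<close>.
\<close>
lemma Real_zero_infinite_emitter:
  assumes v: "v \<in> V" and inf: "infinite (out v)" and T: "finite T"
  shows "p \<in> Real v n \<Longrightarrow> (\<And>f. f \<in> out v - T \<Longrightarrow> p \<otimes> ed f = \<zero>) \<Longrightarrow> p = \<zero>"
proof (induct n arbitrary: p rule: less_induct)
  case (less n)
  obtain k q where q: "q \<in> Pos v n" "p = k \<odot> vx v \<oplus> q" using Real_decompose[OF v less(2)] by blast
  have qc: "q \<in> carrier A" using q Pos_closed by blast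
  obtain U where U: "finite U" "\<And>f. f \<in> R - U \<Longrightarrow> gh f \<otimes> q = \<zero>"
    using Pos_finite_first_edges[OF q(1)] by blast
  have "infinite (out v - (T \<union> U))" using inf T U by simp
  then obtain f where "f \<in> out v - (T \<union> U)" using infinite_imp_nonempty by blast
  then have f: "f \<in> out v" "f \<notin> T" "f \<notin> U" "f \<in> R" "tail E f = v" by (auto simp: out_def)
  have "k \<odot> vx (head E f) = gh f \<otimes> (p \<otimes> ed f)"
  proof -
    have "gh f \<otimes> (p \<otimes> ed f) = (gh f \<otimes> p) \<otimes> ed f" using f q qc v by (simp add: m_assoc)
    also have "gh f \<otimes> p = k \<odot> gh f" using f q qc v U(2)[of f] by (simp add: r_distr smult_mult_r gh_vx)
    finally show ?thesis using f by (simp add: smult_mult_l gh_ed)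
  qed
  then have "k \<odot> vx (head E f) = \<zero>" using less(3)[of f] f by simp
  then have "k = 0" using smult_eq_zero[of "vx (head E f)" k] V_nonzero[OF head_V[OF f(4)]] f head_V by auto
  then have p: "p \<in> Pos v n" "p \<in> carrier A" using q qc v by auto
  show ?case
  proof (cases n)
    case 0 then show ?thesis using p Pos_0 by simp
  next
    case (Suc m)
    show ?thesis
    proof (rule Pos_zero[OF p(1)])
      fix e assume e: "e \<in> R"
      show "gh e \<otimes> p = \<zero>"
      proof (rule less(1)[of m])
        show "gh e \<otimes> p \<in> Real v m" using Pos_gh[OF e] p Suc by simp
        fix g assume g: "g \<in> out v - T"
        then have "g \<in> R" by (auto simp: out_def)
        then show "gh e \<otimes> p \<otimes> ed g = \<zero>" using less(3)[OF g] e p by (simp add: m_assoc)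
      qed (use Suc in simp)
    qed
  qed
qed

text \<open>
  If \<open>a e \<noteq> 0\<close> for an edge \<open>e\<close>, then \<open>a e\<close> has shorter ghost parts. If \<open>a\<close> kills all edges starting in \<open>v\<close>, then
  \<open>a\<close> is unchanged by multiplication with gaps. At a finite emitter the complete gap is zero, and at an
  infinite emitter \<open>Real_zero_infinite_emitter\<close> applies. In both cases \<open>a = 0\<close>.
\<close>
lemma reduce_right:
  assumes ng: "no_gaps"
  shows "a \<in> Mixed v n \<Longrightarrow> a \<noteq> \<zero> \<Longrightarrow> v \<in> V \<Longrightarrow>
    \<exists>\<nu> w m. walk v \<nu> w \<and> a \<otimes> pth \<nu> w \<in> Real w m \<and> a \<otimes> pth \<nu> w \<noteq> \<zero>"
proof (induct n arbitrary: a v)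
  case 0
  then have "a \<otimes> pth [] v = a" "walk v [] v" using Mixed_vx by auto
  then show ?case using Mixed_zero_Real[OF 0(1)] 0 by metis
next
  case (Suc n)
  have ac: "a \<in> carrier A" "a \<otimes> vx v = a" using Suc Mixed_closed Mixed_vx by auto
  show ?case
  proof (cases "\<exists>e\<in>out v. a \<otimes> ed e \<noteq> \<zero>")
    case True
    then obtain e where e: "e \<in> out v" "a \<otimes> ed e \<noteq> \<zero>" by blast
    have eR: "e \<in> R" "tail E e = v" using e by (auto simp: out_def)
    obtain \<nu> w m where \<nu>: "walk (head E e) \<nu> w" "a \<otimes> ed e \<otimes> pth \<nu> w \<in> Real w m" "a \<otimes> ed e \<otimes> pth \<nu> w \<noteq> \<zero>"
      using Suc(1)[OF Mixed_ed[OF e(1) Suc(2)] e(2) head_V[OF eR(1)]] by blast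
    have "pth \<nu> w \<in> carrier A" using \<nu> by auto
    then have "a \<otimes> pth (e # \<nu>) w = a \<otimes> ed e \<otimes> pth \<nu> w" using ac eR by (simp add: m_assoc)
    moreover have "walk v (e # \<nu>) w" using \<nu> eR by simp
    ultimately show ?thesis using \<nu> by metis
  next
    case False
    then have ann: "a \<otimes> ed e = \<zero>" if "e \<in> out v" for e using that by blast
    have "a = \<zero>"
    proof (cases "finite (out v)")
      case True
      then obtain es where es: "set es = out v" "distinct es" using finite_distinct_list by blast
      then have "gap v es = \<zero>" using ng Suc(4) by (auto simp: no_gaps_def)
      moreover have "a \<otimes> gap v es = a" by (rule mult_gap[OF Suc(4) _ ac]) (use es ann in auto)
      ultimately show ?thesis using ac by simp
    next
      case inf: False
      obtain p m T where p: "p \<in> Real v m" and T: "finite T" "T \<subseteq> out v"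
        and eq: "\<And>es. distinct es \<Longrightarrow> T \<subseteq> set es \<Longrightarrow> set es \<subseteq> out v \<Longrightarrow> a \<otimes> gap v es = p \<otimes> gap v es"
        using Mixed_real_part[OF Suc(4,2)] by blast
      obtain es where es: "set es = T" "distinct es" using finite_distinct_list[OF T(1)] by blast
      have g: "gap v es \<in> carrier A" using es T Suc(4) by auto
      have "a \<otimes> gap v es = a" by (rule mult_gap[OF Suc(4) _ ac]) (use es ann T in auto)
      then have apg: "a = p \<otimes> gap v es" using eq[of es] es T by simp
      have pc: "p \<in> carrier A" using Real_closed[OF p] .
      have "p = \<zero>"
      proof (rule Real_zero_infinite_emitter[OF Suc(4) inf T(1) p])
        fix f assume f: "f \<in> out v - T"
        then have fR: "f \<in> R" by (auto simp: out_def)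
        from f have "p \<otimes> ed f = p \<otimes> (gap v es \<otimes> ed f)"
          using gap_ed[OF Suc(4) es(2), of f] es T by simp
        also have "\<dots> = a \<otimes> ed f" unfolding apg using pc g fR by (simp add: m_assoc)
        finally show "p \<otimes> ed f = \<zero>" using ann f by simp
      qed
      then show ?thesis using apg g by simp
    qed
    then show ?thesis using Suc by blast
  qed
qed

text \<open>
  Strip first edges by \<open>e\<^sup>*\<close> until a constant term appears. A nonzero combination without constant term
  has a nonzero \<open>e\<^sup>* p\<close>. The start vertex \<open>x\<close> is fixed to keep the stripped edges composable.
\<close>
lemma reduce_left:
  assumes w: "w \<in> V"
  shows "p \<in> Real w n \<Longrightarrow> p \<noteq> \<zero> \<Longrightarrow> x \<in> V \<Longrightarrow> vx x \<otimes> p = p \<Longrightarrow>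
    \<exists>\<mu> k \<gamma>. walk x \<mu> w \<and> k \<noteq> 0 \<and> \<gamma> \<in> Closed w \<and> gpth \<mu> w \<otimes> p = k \<odot> vx w \<oplus> \<gamma>"
proof (induct n arbitrary: p x rule: less_induct)
  case (less n)
  obtain k q where q: "q \<in> Pos w n" "p = k \<odot> vx w \<oplus> q" using Real_decompose[OF w less(2)] by blast
  have qc: "q \<in> carrier A" "p \<in> carrier A" using q Pos_closed w by auto
  show ?case
  proof (cases "x = w \<and> k \<noteq> 0")
    case True
    have "vx w \<otimes> q \<in> Closed w"
    proof (rule lin_span_mult_left[OF mons_closed(2) mons_closed(4) _ _ q(1)])
      fix s assume "s \<in> pos_mons w n"
      then obtain \<alpha> u where s: "s = pth \<alpha> w" "walk u \<alpha> w" "\<alpha> \<noteq> []" by (auto simp: pos_mons_def)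
      have "vx w \<otimes> s = \<zero> \<or> vx w \<otimes> s \<in> closed_mons w"
        using s vx_pth[OF s(2) w] by (auto simp: closed_mons_def)
      then show "vx w \<otimes> s \<in> Closed w" using lin_span.zero lin_span_base[OF mons_closed(4)] by metis
    qed (use w in auto)
    moreover have "gpth [] w \<otimes> p = k \<odot> vx w \<oplus> vx w \<otimes> q"
      using q qc w by (simp add: r_distr smult_mult_r vx_idem V_verts)
    moreover have "walk x [] w" using True w by simp
    ultimately show ?thesis using True by blast
  next
    case False
    have pP: "p \<in> Pos w n"
    proof (cases "k = 0")
      case True then show ?thesis using q qc w by simp
    next
      case k: False
      have "p = vx x \<otimes> q"
        using less(4,5) q qc w False k vx_orth[of x w] by (auto simp: r_distr smult_mult_r V_verts)
      moreover have "vx x \<otimes> q \<in> Pos w n"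
      proof (rule lin_span_mult_left[OF mons_closed(2) mons_closed(2) _ _ q(1)])
        fix s assume s: "s \<in> pos_mons w n"
        then obtain \<alpha> u where "s = pth \<alpha> w" "walk u \<alpha> w" by (auto simp: pos_mons_def)
        then have "vx x \<otimes> s = \<zero> \<or> vx x \<otimes> s = s" using vx_pth less(4) by auto
        then show "vx x \<otimes> s \<in> Pos w n" using lin_span.zero lin_span_base[OF mons_closed(2) s] by metis
      qed (use less(4) in auto)
      ultimately show ?thesis by simp
    qed
    then obtain e where e: "e \<in> R" "gh e \<otimes> p \<noteq> \<zero>" using Pos_zero less(3) by blast
    have "n \<noteq> 0" using pP Pos_0[of p w] less(3) by metis
    then obtain m where m: "n = Suc m" by (cases n) auto
    have te: "tail E e = x"
    proof (rule ccontr)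
      assume "tail E e \<noteq> x"
      then have "(gh e \<otimes> vx x) \<otimes> p = \<zero>" using gh_vx[OF e(1) less(4)] qc by simp
      then show False using e less(4,5) qc by (simp add: m_assoc)
    qed
    have hh: "vx (head E e) \<otimes> (gh e \<otimes> p) = gh e \<otimes> p"
      using e qc head_gh[of e] by (simp add: m_assoc[symmetric])
    have "gh e \<otimes> p \<in> Real w m" using Pos_gh[OF e(1)] pP m by simp
    then obtain \<mu> k \<gamma> where \<mu>: "walk (head E e) \<mu> w" "k \<noteq> 0" "\<gamma> \<in> Closed w"
      "gpth \<mu> w \<otimes> (gh e \<otimes> p) = k \<odot> vx w \<oplus> \<gamma>"
      using less(1)[of m "gh e \<otimes> p" "head E e"] m e head_V[OF e(1)] hh by blast
    have "gpth \<mu> w \<in> carrier A" using \<mu> by auto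
    then have "gpth (e # \<mu>) w \<otimes> p = k \<odot> vx w \<oplus> \<gamma>" using \<mu> e qc by (simp add: m_assoc)
    moreover have "walk x (e # \<mu>) w" using \<mu> e te by simp
    ultimately show ?thesis using \<mu> by blast
  qed
qed

lemma in_Mixed:
  assumes u: "u \<in> V" and a: "a \<in> carrier A" "a \<otimes> vx u = a"
  shows "\<exists>n. a \<in> Mixed u n"
proof -
  have "a \<in> lin_span A monomials" using a carrier_eq_span by simp
  then have "\<exists>n. a \<otimes> vx u \<in> Mixed u n"
  proof induct
    case zero then show ?case using u lin_span.zero by auto
  next
    case (gen s c)
    then obtain \<alpha> \<beta> v v' w where s: "s = pth \<alpha> w \<otimes> gpth \<beta> w" "walk v \<alpha> w" "walk v' \<beta> w"
      by (auto simp: monomials_def)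
    have cl: "pth \<alpha> w \<in> carrier A" "gpth \<beta> w \<in> carrier A" using s by auto
    have e: "(c \<odot> s) \<otimes> vx u = c \<odot> (pth \<alpha> w \<otimes> (gpth \<beta> w \<otimes> vx u))"
      using cl u s by (simp add: m_assoc smult_mult_l)
    show ?case
    proof (cases "v' = u")
      case True
      then have "s \<in> mixed_mons u (length \<beta>)" using s by (auto simp: mixed_mons_def)
      then have "c \<odot> s \<in> Mixed u (length \<beta>)" by (rule lin_span.gen)
      then show ?thesis using e True s u by (auto simp: gpth_vx)
    next
      case False
      then show ?thesis using e cl s u lin_span.zero gpth_vx[OF s(3) u] by auto
    qed
  next
    case (add x y)
    then obtain m n where mn: "x \<otimes> vx u \<in> Mixed u m" "y \<otimes> vx u \<in> Mixed u n" by blast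
    have "x \<otimes> vx u \<oplus> y \<otimes> vx u \<in> Mixed u (max m n)"
      using mn by (intro lin_span.add) (auto intro: Mixed_mono)
    moreover have "x \<in> carrier A" "y \<in> carrier A" using add carrier_eq_span by auto
    ultimately show ?case using u by (auto simp: l_distr)
  qed
  then show ?thesis using a by simp
qed

theorem reduction:
  assumes ng: "no_gaps" and x: "x \<in> V" and u: "u \<in> V"
    and a: "a \<in> carrier A" "a \<noteq> \<zero>" "vx x \<otimes> a = a" "a \<otimes> vx u = a"
  obtains \<mu> \<nu> s k \<gamma> where "walk x \<mu> s" "walk u \<nu> s" "k \<noteq> 0" "\<gamma> \<in> Closed s"
    "gpth \<mu> s \<otimes> a \<otimes> pth \<nu> s = k \<odot> vx s \<oplus> \<gamma>"
proof -
  obtain n where "a \<in> Mixed u n" using in_Mixed[OF u a(1,4)] by blast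
  then obtain \<nu> s m where \<nu>: "walk u \<nu> s" "a \<otimes> pth \<nu> s \<in> Real s m" "a \<otimes> pth \<nu> s \<noteq> \<zero>"
    using reduce_right[OF ng _ a(2) u] by blast
  have p: "pth \<nu> s \<in> carrier A" using \<nu> by auto
  have "vx x \<otimes> (a \<otimes> pth \<nu> s) = a \<otimes> pth \<nu> s" using x a p by (simp add: m_assoc[symmetric])
  moreover have "s \<in> V" using walk_V[OF \<nu>(1)] by simp
  ultimately obtain \<mu> k \<gamma> where \<mu>: "walk x \<mu> s" "k \<noteq> 0" "\<gamma> \<in> Closed s"
    "gpth \<mu> s \<otimes> (a \<otimes> pth \<nu> s) = k \<odot> vx s \<oplus> \<gamma>"
    using reduce_left[OF _ \<nu>(2,3) x] by blast
  have "gpth \<mu> s \<in> carrier A" using \<mu> by auto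
  then have "gpth \<mu> s \<otimes> a \<otimes> pth \<nu> s = k \<odot> vx s \<oplus> \<gamma>" using \<mu> a p by (simp add: m_assoc)
  then show ?thesis using that \<mu> \<nu> by blast
qed

lemma ex_vertex_left:
  assumes a: "a \<in> carrier A" "a \<noteq> \<zero>"
  shows "\<exists>x\<in>V. vx x \<otimes> a \<noteq> \<zero>"
proof (rule ccontr)
  assume none: "\<not> ?thesis"
  have "b \<otimes> a = \<zero>" if "b \<in> carrier A" for b
  proof -
    have "b \<in> lin_span A monomials" using that carrier_eq_span by simp
    then show ?thesis
    proof induct
      case (gen s c)
      then obtain \<alpha> \<beta> v v' w where s: "s = pth \<alpha> w \<otimes> gpth \<beta> w" "walk v \<alpha> w" "walk v' \<beta> w"
        by (auto simp: monomials_def)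
      have cl: "pth \<alpha> w \<in> carrier A" "gpth \<beta> w \<in> carrier A" "v' \<in> V" using s walk_V by auto
      have "gpth \<beta> w \<otimes> a = (gpth \<beta> w \<otimes> vx v') \<otimes> a" using cl s by (simp add: gpth_vx)
      also have "\<dots> = \<zero>" using none cl a by (simp add: m_assoc)
      finally show ?case using cl a s by (simp add: smult_mult_l m_assoc)
    next
      case (add x y)
      then have "x \<in> carrier A" "y \<in> carrier A" using carrier_eq_span by auto
      then show ?case using add a by (simp add: l_distr)
    qed (use a in auto)
  qed
  then show False using elementwise_prime[OF a(1) a(1)] a by (simp add: m_assoc)
qed

lemma ex_vertex_right:
  assumes a: "a \<in> carrier A" "a \<noteq> \<zero>"
  shows "\<exists>x\<in>V. a \<otimes> vx x \<noteq> \<zero>"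
proof (rule ccontr)
  assume none: "\<not> ?thesis"
  have "a \<otimes> b = \<zero>" if "b \<in> carrier A" for b
  proof -
    have "b \<in> lin_span A monomials" using that carrier_eq_span by simp
    then show ?thesis
    proof induct
      case (gen s c)
      then obtain \<alpha> \<beta> v v' w where s: "s = pth \<alpha> w \<otimes> gpth \<beta> w" "walk v \<alpha> w" "walk v' \<beta> w"
        by (auto simp: monomials_def)
      have cl: "pth \<alpha> w \<in> carrier A" "gpth \<beta> w \<in> carrier A" "v \<in> V" using s walk_V by auto
      have "a \<otimes> pth \<alpha> w = a \<otimes> (vx v \<otimes> pth \<alpha> w)" using cl s by (simp add: vx_pth)
      also have "\<dots> = \<zero>" using none cl a by (simp add: m_assoc[symmetric])
      finally show ?case using cl a s by (simp add: smult_mult_r m_assoc[symmetric])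
    next
      case (add x y)
      then have "x \<in> carrier A" "y \<in> carrier A" using carrier_eq_span by auto
      then show ?case using add a by (simp add: r_distr)
    qed (use a in auto)
  qed
  then show False using elementwise_prime[OF a(1) a(1)] a by simp
qed

text \<open>
  Compression of \<open>\<delta>\<close> to the end of the path \<open>\<beta>\<close>. It maps the start vertex of \<open>\<beta>\<close> to the end vertex, so it
  preserves the constant term of \<open>k s + \<gamma>\<close> when it kills \<open>\<gamma>\<close>.
\<close>
definition killed :: "'e list \<Rightarrow> 'v \<Rightarrow> 'a \<Rightarrow> bool" where
  "killed \<beta> y \<delta> \<longleftrightarrow> gpth \<beta> y \<otimes> \<delta> \<otimes> pth \<beta> y = \<zero>"

lemma killed_extend:
  assumes "walk w \<beta> y" "walk y \<tau> y'" "\<delta> \<in> carrier A" "killed \<beta> y \<delta>"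
  shows "killed (\<beta> @ \<tau>) y' \<delta>"
proof -
  have c: "gpth \<beta> y \<in> carrier A" "pth \<beta> y \<in> carrier A" "gpth \<tau> y' \<in> carrier A" "pth \<tau> y' \<in> carrier A"
    using assms by auto
  have "gpth (\<beta> @ \<tau>) y' \<otimes> \<delta> \<otimes> pth (\<beta> @ \<tau>) y' =
      gpth \<tau> y' \<otimes> (gpth \<beta> y \<otimes> \<delta> \<otimes> pth \<beta> y) \<otimes> pth \<tau> y'"
    using c assms(3) by (simp add: pth_append[OF assms(1,2)] gpth_append[OF assms(1,2)] m_assoc)
  then show ?thesis using assms(4) c by (simp add: killed_def)
qed

text \<open>
  If \<open>\<beta>\<^sup>* \<alpha> \<beta> \<noteq> 0\<close>, then \<open>\<beta>\<close> is a prefix of \<open>\<alpha> \<beta>\<close>, that is, \<open>\<beta>\<close> runs around \<open>\<alpha>\<close>. Of two different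
  continuations of the same length at most one does so.
\<close>
lemma kill_closed_path:
  assumes \<alpha>: "walk w \<alpha> w" "\<alpha> \<noteq> []" and \<beta>: "walk w \<beta> x" and ne: "\<not> exitless x"
  shows "\<exists>\<tau> y. walk x \<tau> y \<and> killed (\<beta> @ \<tau>) y (pth \<alpha> w) \<and> killed (\<beta> @ \<tau>) y (gpth \<alpha> w)"
proof -
  obtain \<sigma> \<tau> y z where st: "walk x \<sigma> y" "walk x \<tau> z" "length \<sigma> = length \<tau>" "\<sigma> \<noteq> \<tau>"
    using ne by (auto simp: exitless_def)
  have "\<exists>\<tau> y. walk x \<tau> y \<and> (\<nexists>zs. \<alpha> @ (\<beta> @ \<tau>) = (\<beta> @ \<tau>) @ zs)"
  proof (rule ccontr)
    assume "\<not> ?thesis"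
    then obtain zs zs' where "\<alpha> @ (\<beta> @ \<sigma>) = (\<beta> @ \<sigma>) @ zs" "\<alpha> @ (\<beta> @ \<tau>) = (\<beta> @ \<tau>) @ zs'" using st by blast
    then have "\<beta> @ \<sigma> = \<beta> @ \<tau>" by (rule append_prefix_unique[OF \<alpha>(2)]) (simp add: st(3))
    then show False using st(4) by simp
  qed
  then obtain \<tau> y where \<tau>: "walk x \<tau> y" and np: "\<nexists>zs. \<alpha> @ (\<beta> @ \<tau>) = (\<beta> @ \<tau>) @ zs" by blast
  let ?b = "\<beta> @ \<tau>"
  have b: "walk w ?b y" using \<beta> \<tau> by (auto simp: walk_append)
  have ab: "walk w (\<alpha> @ ?b) y" using \<alpha> b by (auto simp del: append_assoc simp: walk_append)
  have np': "\<nexists>zs. ?b = (\<alpha> @ ?b) @ zs"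
  proof
    assume "\<exists>zs. ?b = (\<alpha> @ ?b) @ zs"
    then obtain zs where "?b = (\<alpha> @ ?b) @ zs" by blast
    then have "length ?b = length ((\<alpha> @ ?b) @ zs)" by (rule arg_cong)
    then show False using \<alpha>(2) by simp
  qed
  have c: "pth \<alpha> w \<in> carrier A" "gpth \<alpha> w \<in> carrier A" "pth ?b y \<in> carrier A" "gpth ?b y \<in> carrier A"
    using \<alpha> b by auto
  have "gpth ?b y \<otimes> pth \<alpha> w \<otimes> pth ?b y = gpth ?b y \<otimes> pth (\<alpha> @ ?b) y"
    using c by (simp only: pth_append[OF \<alpha>(1) b] m_assoc)
  also have "\<dots> = \<zero>" using gpth_pth_cases[OF b ab] np np' by blast
  finally have 1: "killed ?b y (pth \<alpha> w)" by (simp only: killed_def)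
  have "gpth ?b y \<otimes> gpth \<alpha> w \<otimes> pth ?b y = gpth (\<alpha> @ ?b) y \<otimes> pth ?b y"
    by (simp only: gpth_append[OF \<alpha>(1) b])
  also have "\<dots> = \<zero>" using gpth_pth_cases[OF ab b] np np' by blast
  finally have "killed ?b y (gpth \<alpha> w)" by (simp only: killed_def)
  then show ?thesis using 1 \<tau> by blast
qed

lemma kill_closed_span:
  assumes ne: "\<And>u. u \<in> V \<Longrightarrow> \<not> exitless u"
  shows "\<gamma> \<in> Closed w \<Longrightarrow> walk w \<beta> x \<Longrightarrow> \<exists>\<tau> y. walk x \<tau> y \<and> killed (\<beta> @ \<tau>) y \<gamma>"
proof (induct arbitrary: \<beta> x rule: lin_span.induct)
  case zero
  have x: "walk x [] x" using walk_V[OF zero] by simp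
  have "gpth \<beta> x \<in> carrier A" "pth \<beta> x \<in> carrier A" using zero by auto
  then have "killed (\<beta> @ []) x \<zero>" by (simp add: killed_def)
  then show ?case using x by blast
next
  case (gen s c)
  then obtain \<alpha> where \<alpha>: "s = pth \<alpha> w" "walk w \<alpha> w" "\<alpha> \<noteq> []" by (auto simp: closed_mons_def)
  obtain \<tau> y where \<tau>: "walk x \<tau> y" "killed (\<beta> @ \<tau>) y s"
    using kill_closed_path[OF \<alpha>(2,3) gen(2) ne] walk_V[OF gen(2)] \<alpha>(1) by blast
  have "walk w (\<beta> @ \<tau>) y" using gen(2) \<tau> by (auto simp: walk_append)
  then have "gpth (\<beta> @ \<tau>) y \<in> carrier A" "pth (\<beta> @ \<tau>) y \<in> carrier A" "s \<in> carrier A" using \<alpha> by auto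
  then have "killed (\<beta> @ \<tau>) y (c \<odot> s)" using \<tau>(2) by (simp add: killed_def smult_mult_l smult_mult_r)
  then show ?case using \<tau>(1) by blast
next
  case (add p q)
  obtain \<tau> y where \<tau>: "walk x \<tau> y" "killed (\<beta> @ \<tau>) y p" using add(2)[OF add(5)] by blast
  have w1: "walk w (\<beta> @ \<tau>) y" using add(5) \<tau> by (auto simp: walk_append)
  obtain \<sigma> z where \<sigma>: "walk y \<sigma> z" "killed ((\<beta> @ \<tau>) @ \<sigma>) z q" using add(4)[OF w1] by blast
  have w2: "walk w ((\<beta> @ \<tau>) @ \<sigma>) z" using w1 \<sigma> by (subst walk_append) blast
  have "killed ((\<beta> @ \<tau>) @ \<sigma>) z p" by (rule killed_extend[OF w1 \<sigma>(1) Closed_closed[OF add(1)] \<tau>(2)])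
  then have "killed ((\<beta> @ \<tau>) @ \<sigma>) z (p \<oplus> q)"
    using \<sigma>(2) gpth_closed[OF w2] pth_closed[OF w2] Closed_closed add(1,3)
    by (simp add: killed_def r_distr l_distr del: append_assoc)
  moreover have "walk x (\<tau> @ \<sigma>) z" using \<tau> \<sigma> by (auto simp: walk_append)
  ultimately show ?case by (metis append_assoc)
qed

text \<open>
  Reduction of an element of \<open>I\<close> puts a vertex \<open>v\<close> into \<open>I\<close>. Reduction of \<open>f v\<close>, unless it is zero, yields \<open>f \<delta> = k s + \<gamma>\<close>
  with \<open>\<delta> = \<mu>\<^sup>* \<nu>\<close>, which is zero, the vertex \<open>s\<close>, or a closed path or ghost path of positive length. A path
  \<open>\<beta>\<close> that kills \<open>\<gamma>\<close> gives \<open>f (\<beta>\<^sup>* \<delta> \<beta>) = k r(\<beta>) \<noteq> 0\<close>, so no such path kills \<open>\<delta>\<close>. This leaves \<open>\<delta> = s\<close>, where the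
  equation says that \<open>f\<close> multiplies the vertex \<open>r(\<beta>)\<close> by \<open>k\<close>.
\<close>
theorem algebraic_action_no_exitless:
  assumes ng: "no_gaps" and ne: "\<And>u. u \<in> V \<Longrightarrow> \<not> exitless u"
    and I: "two_sided_ideal I A" "I \<noteq> {\<zero>}" and f: "f \<in> bimodule_homs A I"
  shows "algebraic_action A I f"
proof -
  note fD = bimodule_homsD[OF f]
  have kill: "\<exists>\<beta> y. walk s \<beta> y \<and> killed \<beta> y \<gamma>" if s: "s \<in> V" and g: "\<gamma> \<in> Closed s" for s \<gamma>
    using kill_closed_span[OF ne g, of "[]" s] s by auto
  have corner: "gpth \<beta> y \<otimes> (k \<odot> vx s \<oplus> \<gamma>) \<otimes> pth \<beta> y = k \<odot> vx y"
    if b: "walk s \<beta> y" and \<gamma>: "killed \<beta> y \<gamma>" "\<gamma> \<in> carrier A" for \<beta> y s k \<gamma>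
  proof -
    have c: "gpth \<beta> y \<in> carrier A" "pth \<beta> y \<in> carrier A" "s \<in> V" "y \<in> V" using b walk_V by auto
    have "gpth \<beta> y \<otimes> (k \<odot> vx s \<oplus> \<gamma>) \<otimes> pth \<beta> y =
        k \<odot> (gpth \<beta> y \<otimes> vx s \<otimes> pth \<beta> y) \<oplus> gpth \<beta> y \<otimes> \<gamma> \<otimes> pth \<beta> y"
      using c \<gamma> by (simp add: r_distr l_distr smult_mult_l smult_mult_r)
    then show ?thesis using c \<gamma> b gpth_pth_same[OF b] by (simp add: killed_def gpth_vx)
  qed
  obtain i where i: "i \<in> I" "i \<noteq> \<zero>" using ideal_ex_nonzero[OF I] by blast
  have ic: "i \<in> carrier A" using i ideal_carrier[OF I(1)] by blast
  obtain x where x: "x \<in> V" "vx x \<otimes> i \<noteq> \<zero>" using ex_vertex_left[OF ic i(2)] by blast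
  obtain u where u: "u \<in> V" "vx x \<otimes> i \<otimes> vx u \<noteq> \<zero>"
    using ex_vertex_right[of "vx x \<otimes> i"] x ic by auto
  define a where "a = vx x \<otimes> i \<otimes> vx u"
  have a: "a \<in> carrier A" "a \<noteq> \<zero>" "vx x \<otimes> a = a" "a \<otimes> vx u = a"
  proof -
    show "a \<in> carrier A" "a \<noteq> \<zero>" using x u ic by (auto simp: a_def)
    have "vx x \<otimes> a = (vx x \<otimes> vx x) \<otimes> (i \<otimes> vx u)" using x u ic by (simp add: a_def m_assoc)
    then show "vx x \<otimes> a = a" using x u ic by (simp add: vx_idem V_verts a_def m_assoc)
    show "a \<otimes> vx u = a" using x u ic by (simp add: vx_idem V_verts a_def m_assoc)
  qed
  have aI: "a \<in> I" unfolding a_def using x u i by (intro ideal_mult_l[OF I(1)] ideal_mult_r[OF I(1)]) auto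
  obtain \<mu> \<nu> s k \<gamma> where r: "walk x \<mu> s" "walk u \<nu> s" "k \<noteq> 0" "\<gamma> \<in> Closed s"
    "gpth \<mu> s \<otimes> a \<otimes> pth \<nu> s = k \<odot> vx s \<oplus> \<gamma>"
    by (rule reduction[OF ng x(1) u(1) a])
  obtain \<beta> v where b: "walk s \<beta> v" "killed \<beta> v \<gamma>" using kill[OF _ r(4)] walk_V[OF r(1)] by blast
  have v: "v \<in> V" using walk_V[OF b(1)] by simp
  have "gpth \<mu> s \<otimes> a \<otimes> pth \<nu> s \<in> I"
    by (intro ideal_mult_r[OF I(1) ideal_mult_l[OF I(1) aI]] gpth_closed[OF r(1)] pth_closed[OF r(2)])
  then have "gpth \<beta> v \<otimes> (gpth \<mu> s \<otimes> a \<otimes> pth \<nu> s) \<otimes> pth \<beta> v \<in> I"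
    by (rule ideal_mult_r[OF I(1) ideal_mult_l[OF I(1) _ gpth_closed[OF b(1)]] pth_closed[OF b(1)]])
  then have "k \<odot> vx v \<in> I" unfolding r(5) using corner[OF b Closed_closed[OF r(4)]] by simp
  then have "((inverse k) \<odot> vx v) \<otimes> (k \<odot> vx v) \<in> I" using v by (intro ideal_mult_l[OF I(1)]) auto
  then have vI: "vx v \<in> I"
    using v r(3) by (simp add: smult_mult_l smult_mult_r smult_smult vx_idem V_verts)
  define w where "w = f (vx v)"
  have w: "w \<in> carrier A" "vx v \<otimes> w = w" "w \<otimes> vx v = w"
    using fD(1)[OF vI] fD(3)[OF vI, of "vx v"] fD(4)[OF vI, of "vx v"] v by (auto simp: w_def vx_idem V_verts)
  show ?thesis
  proof (cases "w = \<zero>")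
    case True
    then have "acts A I f (vx v) (0 \<odot> vx v)" using acts_self[OF I(1) f vI] v by (simp add: w_def)
    then show ?thesis by (rule algebraic_action_scalar[OF V_nonzero[OF v]])
  next
    case False
    obtain \<mu> \<nu> s k \<gamma> where r: "walk v \<mu> s" "walk v \<nu> s" "k \<noteq> 0" "\<gamma> \<in> Closed s"
      "gpth \<mu> s \<otimes> w \<otimes> pth \<nu> s = k \<odot> vx s \<oplus> \<gamma>"
      by (rule reduction[OF ng v v w(1) False w(2,3)])
    have s: "s \<in> V" using walk_V[OF r(1)] by simp
    define \<delta> where "\<delta> = gpth \<mu> s \<otimes> pth \<nu> s"
    have c: "gpth \<mu> s \<in> carrier A" "pth \<nu> s \<in> carrier A" "\<gamma> \<in> carrier A" "\<delta> \<in> carrier A"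
      using r Closed_closed by (auto simp: \<delta>_def)
    have \<delta>: "\<delta> = gpth \<mu> s \<otimes> vx v \<otimes> pth \<nu> s" using r v by (simp add: \<delta>_def gpth_vx)
    have dI: "\<delta> \<in> I" unfolding \<delta> using c by (intro ideal_mult_r[OF I(1) ideal_mult_l[OF I(1) vI]])
    have f\<delta>: "f \<delta> = k \<odot> vx s \<oplus> \<gamma>"
      unfolding \<delta> r(5)[symmetric] w_def using c vI ideal_mult_l[OF I(1) vI c(1)] by (simp add: fD)
    obtain \<beta> y where b: "walk s \<beta> y" "killed \<beta> y \<gamma>" using kill[OF s r(4)] by blast
    have fb: "f (gpth \<beta>' y' \<otimes> \<delta> \<otimes> pth \<beta>' y') = k \<odot> vx y'"
      if b': "walk s \<beta>' y'" "killed \<beta>' y' \<gamma>" for \<beta>' y'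
    proof -
      have "f (gpth \<beta>' y' \<otimes> \<delta> \<otimes> pth \<beta>' y') = gpth \<beta>' y' \<otimes> f \<delta> \<otimes> pth \<beta>' y'"
        using b' dI ideal_mult_l[OF I(1) dI gpth_closed[OF b'(1)]] by (simp add: fD gpth_closed[OF b'(1)] pth_closed[OF b'(1)])
      then show ?thesis using corner[OF b' c(3)] f\<delta> by simp
    qed
    have f0: "f \<zero> = \<zero>"
      using fD(3)[OF ideal_zero[OF I(1)], of \<zero>] fD(1)[OF ideal_zero[OF I(1)]] by simp
    have not_killed: "\<not> (walk s \<beta>' y' \<and> killed \<beta>' y' \<gamma> \<and> killed \<beta>' y' \<delta>)" for \<beta>' y'
    proof
      assume h: "walk s \<beta>' y' \<and> killed \<beta>' y' \<gamma> \<and> killed \<beta>' y' \<delta>"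
      then have "k \<odot> vx y' = \<zero>" using fb[of \<beta>' y'] f0 by (simp add: killed_def)
      moreover have "y' \<in> V" using h walk_V by blast
      ultimately show False using r(3) V_nonzero smult_eq_zero[of "vx y'" k] by auto
    qed
    have "\<delta> = vx s"
    proof (rule ccontr)
      assume nv: "\<delta> \<noteq> vx s"
      consider "\<delta> = \<zero>" | zs where "walk s zs s" "\<delta> = pth zs s \<or> \<delta> = gpth zs s"
        using gpth_pth_cases[OF r(1,2)] \<delta>_def by auto
      then show False
      proof cases
        case 1
        then have "killed \<beta> y \<delta>" using gpth_closed[OF b(1)] pth_closed[OF b(1)] by (simp add: killed_def)
        then show False using not_killed b by blast
      next
        case 2
        then have "zs \<noteq> []" using nv by auto
        then obtain \<tau> z where \<tau>: "walk y \<tau> z" "killed (\<beta> @ \<tau>) z \<delta>"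
          using kill_closed_path[OF 2(1) _ b(1) ne] 2(2) walk_V[OF b(1)] by blast
        moreover have "killed (\<beta> @ \<tau>) z \<gamma>" by (rule killed_extend[OF b(1) \<tau>(1) c(3) b(2)])
        moreover have "walk s (\<beta> @ \<tau>) z" using b \<tau> by (auto simp: walk_append)
        ultimately show False using not_killed by blast
      qed
    qed
    then have "gpth \<beta> y \<otimes> \<delta> \<otimes> pth \<beta> y = vx y" using b s gpth_pth_same[OF b(1)] by (simp add: gpth_vx)
    then have fy: "f (vx y) = k \<odot> vx y" and yI: "vx y \<in> I"
      using fb[OF b] ideal_mult_r[OF I(1) ideal_mult_l[OF I(1) dI gpth_closed[OF b(1)]] pth_closed[OF b(1)]]
      by auto
    have "acts A I f (vx y) (k \<odot> vx y)" using acts_self[OF I(1) f yI] fy by simp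
    then show ?thesis using algebraic_action_scalar V_nonzero walk_V[OF b(1)] by blast
  qed
qed

end

section \<open>Free algebras and quotients\<close>
definition word_fun :: "'x list \<Rightarrow> 'x list \<Rightarrow> 'k :: field" where
  "word_fun u = (\<lambda>w. if w = u then 1 else 0)"

lemma free_algebra_simps:
  "carrier (free_algebra S) = {f. finite {w. f w \<noteq> 0} \<and> {w. f w \<noteq> 0} \<subseteq> lists S - {[]}}"
  "f \<otimes>\<^bsub>free_algebra S\<^esub> g = (\<lambda>w. \<Sum>i\<le>length w. f (take i w) * g (drop i w))"
  "\<zero>\<^bsub>free_algebra S\<^esub> = (\<lambda>w. 0)"
  "f \<oplus>\<^bsub>free_algebra S\<^esub> g = (\<lambda>w. f w + g w)"
  "c \<odot>\<^bsub>free_algebra S\<^esub> f = (\<lambda>w. c * f w)"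
  by (simp_all add: free_algebra_def)

lemma free_algebra_carrierI:
  assumes "finite B" "B \<subseteq> lists S - {[]}" "\<And>w. f w \<noteq> 0 \<Longrightarrow> w \<in> B"
  shows "f \<in> carrier (free_algebra S)"
  unfolding free_algebra_simps using assms by (auto intro: finite_subset[of _ B])

lemma free_algebra_assoc:
  fixes f g h :: "'x list \<Rightarrow> 'k :: field"
  shows "(\<Sum>i\<le>length w. (\<Sum>j\<le>length (take i w). f (take j (take i w)) * g (drop j (take i w))) * h (drop i w)) =
    (\<Sum>j\<le>length w. f (take j w) * (\<Sum>i\<le>length (drop j w). g (take i (drop j w)) * h (drop i (drop j w))))"
proof -
  define \<phi> where "\<phi> a b c = f (take a w) * g (take b (drop a w)) * h (drop (a + b) w)" for a b c :: nat
  let ?n = "length w"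
  have "(\<Sum>i\<le>?n. (\<Sum>j\<le>length (take i w). f (take j (take i w)) * g (drop j (take i w))) * h (drop i w)) =
      (\<Sum>i=0..?n. \<Sum>j=0..i. \<phi> j (i - j) (?n - i))"
    by (auto simp: \<phi>_def sum_distrib_right atLeast0AtMost drop_take min_def intro!: sum.cong)
  also have "\<dots> = (\<Sum>j=0..?n. \<Sum>i=0..?n - j. \<phi> j i (?n - j - i))"
    by (rule fps_mult_assoc_lemma)
  also have "\<dots> = (\<Sum>j\<le>length w. f (take j w) * (\<Sum>i\<le>length (drop j w). g (take i (drop j w)) * h (drop i (drop j w))))"
    by (auto simp: \<phi>_def sum_distrib_left atLeast0AtMost mult.assoc add.commute intro!: sum.cong)
  finally show ?thesis .
qed

lemma nonunital_algebra_free_algebra: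
  "nonunital_algebra (free_algebra S :: ('k :: field, 'x list \<Rightarrow> 'k) module)"
proof -
  let ?F = "free_algebra S :: ('k, 'x list \<Rightarrow> 'k) module"
  have add: "f \<oplus>\<^bsub>?F\<^esub> g \<in> carrier ?F" if "f \<in> carrier ?F" "g \<in> carrier ?F" for f g
    using that by (intro free_algebra_carrierI[of "{w. f w \<noteq> 0} \<union> {w. g w \<noteq> 0}"])
      (auto simp: free_algebra_simps)
  have smult: "c \<odot>\<^bsub>?F\<^esub> f \<in> carrier ?F" if "f \<in> carrier ?F" for c f
    using that by (intro free_algebra_carrierI[of "{w. f w \<noteq> 0}"]) (auto simp: free_algebra_simps)
  have mult: "f \<otimes>\<^bsub>?F\<^esub> g \<in> carrier ?F" if f: "f \<in> carrier ?F" and g: "g \<in> carrier ?F" for f g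
  proof (rule free_algebra_carrierI[of "(\<lambda>(u, v). u @ v) ` ({w. f w \<noteq> 0} \<times> {w. g w \<noteq> 0})"])
    fix w assume "(f \<otimes>\<^bsub>?F\<^esub> g) w \<noteq> 0"
    then have "(\<Sum>i\<le>length w. f (take i w) * g (drop i w)) \<noteq> 0" unfolding free_algebra_simps .
    then obtain i where i: "f (take i w) * g (drop i w) \<noteq> 0"
      by (rule sum.not_neutral_contains_not_neutral)
    then show "w \<in> (\<lambda>(u, v). u @ v) ` ({w. f w \<noteq> 0} \<times> {w. g w \<noteq> 0})"
      by (intro image_eqI[of _ _ "(take i w, drop i w)"]) auto
  next
    have fg: "f w \<noteq> 0 \<Longrightarrow> w \<in> lists S - {[]}" "g w \<noteq> 0 \<Longrightarrow> w \<in> lists S - {[]}" for w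
      using f g by (auto simp only: free_algebra_simps)
    show "(\<lambda>(u, v). u @ v) ` ({w. f w \<noteq> 0} \<times> {w. g w \<noteq> 0}) \<subseteq> lists S - {[]}"
      using fg by fastforce
  qed (use f g in \<open>simp add: free_algebra_simps\<close>)
  have ab: "abelian_group ?F"
  proof (rule abelian_groupI)
    show "\<exists>y\<in>carrier ?F. y \<oplus>\<^bsub>?F\<^esub> x = \<zero>\<^bsub>?F\<^esub>" if "x \<in> carrier ?F" for x
    proof
      show "(- 1) \<odot>\<^bsub>?F\<^esub> x \<in> carrier ?F" by (rule smult[OF that])
      show "(- 1) \<odot>\<^bsub>?F\<^esub> x \<oplus>\<^bsub>?F\<^esub> x = \<zero>\<^bsub>?F\<^esub>" by (simp add: free_algebra_simps)
    qed
  qed (use add in \<open>auto simp: free_algebra_simps add_ac\<close>)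
  show ?thesis
    unfolding nonunital_algebra_def nonunital_algebra_axioms_def
  proof (intro conjI ab allI impI)
    fix x y z :: "'x list \<Rightarrow> 'k" assume xyz: "x \<in> carrier ?F" "y \<in> carrier ?F" "z \<in> carrier ?F"
    show "x \<otimes>\<^bsub>?F\<^esub> y \<otimes>\<^bsub>?F\<^esub> z = x \<otimes>\<^bsub>?F\<^esub> (y \<otimes>\<^bsub>?F\<^esub> z)"
      unfolding free_algebra_simps by (rule ext) (rule free_algebra_assoc)
    show "(x \<oplus>\<^bsub>?F\<^esub> y) \<otimes>\<^bsub>?F\<^esub> z = x \<otimes>\<^bsub>?F\<^esub> z \<oplus>\<^bsub>?F\<^esub> y \<otimes>\<^bsub>?F\<^esub> z"
      by (simp add: free_algebra_simps distrib_right sum.distrib)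
    show "z \<otimes>\<^bsub>?F\<^esub> (x \<oplus>\<^bsub>?F\<^esub> y) = z \<otimes>\<^bsub>?F\<^esub> x \<oplus>\<^bsub>?F\<^esub> z \<otimes>\<^bsub>?F\<^esub> y"
      by (simp add: free_algebra_simps distrib_left sum.distrib)
  qed (use mult smult in \<open>auto simp: free_algebra_simps algebra_simps sum_distrib_left\<close>)
qed

lemma word_fun_mult: "(word_fun a :: 'a list \<Rightarrow> 'b :: field) \<otimes>\<^bsub>free_algebra S\<^esub> word_fun b = word_fun (a @ b)"
proof
  fix u
  have "((word_fun a :: 'a list \<Rightarrow> 'b) \<otimes>\<^bsub>free_algebra S\<^esub> word_fun b) u =
      (\<Sum>i\<le>length u. if i = length a then (if u = a @ b then 1 else 0) else 0)"
    unfolding free_algebra_simps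
  proof (rule sum.cong[OF refl])
    fix i assume i: "i \<in> {..length u}"
    have eq: "take i u = a \<and> drop i u = b \<longleftrightarrow> i = length a \<and> u = a @ b"
      using i append_take_drop_id[of i u] by (auto simp: min_def)
    have "word_fun a (take i u) * word_fun b (drop i u) =
        (if take i u = a \<and> drop i u = b then 1 else (0 :: 'b))"
      by (simp add: word_fun_def)
    then show "word_fun a (take i u) * word_fun b (drop i u) =
        (if i = length a then if u = a @ b then 1 else 0 else (0 :: 'b))"
      unfolding eq by simp
  qed
  then show "((word_fun a :: 'a list \<Rightarrow> 'b) \<otimes>\<^bsub>free_algebra S\<^esub> word_fun b) u = word_fun (a @ b) u"
    by (auto simp: word_fun_def)
qed

lemma free_gen_closed: "x \<in> S \<Longrightarrow> free_gen x \<in> carrier (free_algebra S)"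
  by (rule free_algebra_carrierI[of "{[x]}"]) (auto simp: free_gen_def split: if_splits)

text \<open>
  Induction on the support, a finite set of words. Each word is a product of generators.
\<close>
lemma free_algebra_generated:
  fixes T :: "('x list \<Rightarrow> 'k :: field) set"
  assumes zero: "\<zero>\<^bsub>free_algebra S\<^esub> \<in> T" and gen: "\<And>x. x \<in> S \<Longrightarrow> free_gen x \<in> T"
    and add: "\<And>x y. x \<in> T \<Longrightarrow> y \<in> T \<Longrightarrow> x \<oplus>\<^bsub>free_algebra S\<^esub> y \<in> T"
    and mult: "\<And>x y. x \<in> T \<Longrightarrow> y \<in> T \<Longrightarrow> x \<otimes>\<^bsub>free_algebra S\<^esub> y \<in> T"
    and smult: "\<And>c x. x \<in> T \<Longrightarrow> c \<odot>\<^bsub>free_algebra S\<^esub> x \<in> T"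
  shows "carrier (free_algebra S) \<subseteq> T"
proof
  have word: "word_fun w \<in> T" if "w \<noteq> []" "set w \<subseteq> S" for w
    using that
  proof (induct w rule: list_nonempty_induct)
    case (single x)
    have "(word_fun [x] :: 'x list \<Rightarrow> 'k) = free_gen x" by (simp add: word_fun_def free_gen_def)
    then show ?case using gen single by simp
  next
    case (cons x w)
    have "free_gen x \<otimes>\<^bsub>free_algebra S\<^esub> word_fun w \<in> T" using cons gen by (intro mult) auto
    moreover have "free_gen x = (word_fun [x] :: 'x list \<Rightarrow> 'k)" by (simp add: word_fun_def free_gen_def)
    ultimately show ?case by (simp add: word_fun_mult)
  qed
  have "\<forall>f. {w. f w \<noteq> 0} = B \<longrightarrow> f \<in> T" if "finite B" "B \<subseteq> lists S - {[]}" for B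
    using that
  proof (induct rule: finite_induct)
    case empty
    have "f = \<zero>\<^bsub>free_algebra S\<^esub>" if "{w. f w \<noteq> 0} = {}" for f :: "'x list \<Rightarrow> 'k"
      using that by (auto simp: free_algebra_simps)
    then show ?case using zero by metis
  next
    case (insert w B)
    show ?case
    proof (intro allI impI)
      fix f :: "'x list \<Rightarrow> 'k" assume f: "{v. f v \<noteq> 0} = insert w B"
      let ?g = "f(w := 0)"
      have "{v. ?g v \<noteq> 0} = {v. f v \<noteq> 0} - {w}" by (auto split: if_splits)
      then have "{v. ?g v \<noteq> 0} = B" unfolding f using insert(2) by blast
      then have g: "?g \<in> T" using insert by auto
      have w: "word_fun w \<in> T" using insert(4) by (intro word) auto
      have "f = ?g \<oplus>\<^bsub>free_algebra S\<^esub> (f w \<odot>\<^bsub>free_algebra S\<^esub> word_fun w)"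
        by (auto simp: free_algebra_simps word_fun_def)
      then show "f \<in> T" using add[OF g smult[OF w]] by metis
    qed
  qed
  then show "f \<in> T" if "f \<in> carrier (free_algebra S)" for f
    using that by (auto simp: free_algebra_simps)
qed

locale quotient_by_ideal = nonunital_algebra A
  for A :: "('k :: field, 'a, 'm) module_scheme" (structure) +
  fixes I
  assumes I: "two_sided_ideal I A"
    and I_smult: "x \<in> I \<Longrightarrow> c \<odot> x \<in> I"
begin

definition cls where "cls x = I +> x"

abbreviation Q where "Q \<equiv> quotient_algebra A I"

lemma mem_cls: "x \<in> carrier A \<Longrightarrow> y \<in> cls x \<longleftrightarrow> (\<exists>i\<in>I. y = i \<oplus> x)"
  by (auto simp: cls_def a_r_coset_def')

lemma cls_self: "x \<in> carrier A \<Longrightarrow> x \<in> cls x"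
  using mem_cls ideal_zero[OF I] l_zero by metis

lemma cls_memD: "x \<in> carrier A \<Longrightarrow> y \<in> cls x \<Longrightarrow> y \<in> carrier A \<and> y \<ominus> x \<in> I"
  using ideal_carrier[OF I] by (auto simp: mem_cls a_minus_def a_assoc r_neg)

lemma cls_eq_iff:
  assumes x: "x \<in> carrier A" and y: "y \<in> carrier A"
  shows "cls x = cls y \<longleftrightarrow> x \<ominus> y \<in> I"
proof
  assume "cls x = cls y"
  then have "x \<in> cls y" using cls_self[OF x] by simp
  then show "x \<ominus> y \<in> I" using cls_memD[OF y] by blast
next
  have sub: "cls x \<subseteq> cls y" if xy: "x \<in> carrier A" "y \<in> carrier A" "x \<ominus> y \<in> I" for x y
  proof
    fix z assume "z \<in> cls x"
    then obtain i where i: "i \<in> I" "z = i \<oplus> x" using xy by (auto simp: mem_cls)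
    have "z = (i \<oplus> (x \<ominus> y)) \<oplus> y"
      using i xy ideal_carrier[OF I] by (simp add: a_minus_def a_assoc l_neg)
    then show "z \<in> cls y" using ideal_add[OF I i(1) xy(3)] xy(2) by (auto simp: mem_cls)
  qed
  assume xy: "x \<ominus> y \<in> I"
  have "y \<ominus> x = \<ominus> (x \<ominus> y)" using x y by (simp add: a_minus_def minus_add a_comm)
  then have "y \<ominus> x \<in> I" using ideal_uminus[OF I xy] by simp
  then show "cls x = cls y" using sub[OF x y xy] sub[OF y x] by blast
qed

lemma Q_carrier: "carrier Q = cls ` carrier A"
  by (auto simp: quotient_algebra_def FactRing_def A_RCOSETS_def' cls_def)

lemma Q_cases:
  assumes "u \<in> carrier Q"
  obtains x where "x \<in> carrier A" "u = cls x"
  using assms Q_carrier by auto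

lemma cls_closed [simp]: "x \<in> carrier A \<Longrightarrow> cls x \<in> carrier Q"
  by (auto simp: Q_carrier)

lemma cls_add:
  assumes "x \<in> carrier A" "y \<in> carrier A"
  shows "cls x \<oplus>\<^bsub>Q\<^esub> cls y = cls (x \<oplus> y)"
proof -
  interpret additive_subgroup I A by (rule ideal_additive_subgroup[OF I])
  interpret abelian_subgroup I A by (rule abelian_subgroupI3) unfold_locales
  show ?thesis using a_rcos_sum[OF assms] by (simp add: quotient_algebra_def FactRing_def cls_def)
qed

lemma cls_zero: "\<zero>\<^bsub>Q\<^esub> = cls \<zero>"
proof -
  have "cls \<zero> = I" using ideal_carrier[OF I] by (auto simp: cls_def a_r_coset_def')
  then show ?thesis by (simp add: quotient_algebra_def FactRing_def)
qed

lemma cls_mult: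
  assumes x: "x \<in> carrier A" and y: "y \<in> carrier A"
  shows "cls x \<otimes>\<^bsub>Q\<^esub> cls y = cls (x \<otimes> y)"
proof -
  have eq: "cls (a \<otimes> b) = cls (x \<otimes> y)" if ab: "a \<in> cls x" "b \<in> cls y" for a b
  proof -
    have a: "a \<in> carrier A" "a \<ominus> x \<in> I" and b: "b \<in> carrier A" "b \<ominus> y \<in> I"
      using cls_memD[OF x ab(1)] cls_memD[OF y ab(2)] by auto
    have "a \<otimes> b \<ominus> x \<otimes> y = (a \<ominus> x) \<otimes> b \<oplus> x \<otimes> (b \<ominus> y)"
    proof -
      have "(a \<ominus> x) \<otimes> b \<oplus> x \<otimes> (b \<ominus> y) = (a \<otimes> b \<oplus> (\<ominus> (x \<otimes> b) \<oplus> x \<otimes> b)) \<ominus> x \<otimes> y"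
        using a b x y by (simp add: a_minus_def l_distr r_distr l_minus r_minus a_assoc)
      then show ?thesis using a b x y by (simp add: l_neg)
    qed
    also have "\<dots> \<in> I" using a b x y by (intro ideal_add[OF I] ideal_mult_l[OF I] ideal_mult_r[OF I])
    finally show ?thesis using a b x y by (simp add: cls_eq_iff)
  qed
  have "cls x \<otimes>\<^bsub>Q\<^esub> cls y = (\<Union>a\<in>cls x. \<Union>b\<in>cls y. cls (a \<otimes> b))"
    by (simp add: quotient_algebra_def FactRing_def rcoset_mult_def cls_def)
  also have "\<dots> = (\<Union>a\<in>cls x. \<Union>b\<in>cls y. cls (x \<otimes> y))" using eq by simp
  also have "\<dots> = cls (x \<otimes> y)" using cls_self[OF x] cls_self[OF y] by auto
  finally show ?thesis .
qed

lemma cls_smult: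
  assumes x: "x \<in> carrier A"
  shows "c \<odot>\<^bsub>Q\<^esub> cls x = cls (c \<odot> x)"
proof -
  have eq: "cls (c \<odot> a) = cls (c \<odot> x)" if "a \<in> cls x" for a
  proof -
    have a: "a \<in> carrier A" "a \<ominus> x \<in> I" using cls_memD[OF x that] by auto
    have "c \<odot> a \<ominus> c \<odot> x = c \<odot> (a \<ominus> x)"
      using a x by (simp add: a_minus_def smult_r_distr uminus_smult smult_smult mult.commute)
    then show ?thesis using a x I_smult by (simp add: cls_eq_iff)
  qed
  have "c \<odot>\<^bsub>Q\<^esub> cls x = (\<Union>a\<in>cls x. cls (c \<odot> a))"
    by (simp add: quotient_algebra_def cls_def)
  also have "\<dots> = (\<Union>a\<in>cls x. cls (c \<odot> x))" using eq by simp
  finally show ?thesis using cls_self[OF x] by auto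
qed

lemma cls_eq_zero: "x \<in> carrier A \<Longrightarrow> cls x = \<zero>\<^bsub>Q\<^esub> \<longleftrightarrow> x \<in> I"
  by (simp add: cls_zero cls_eq_iff a_minus_def uminus_smult)

lemmas cls_ops = cls_add cls_mult cls_smult

lemma nonunital_algebra_quotient: "nonunital_algebra Q"
proof -
  have ab: "abelian_group Q"
  proof (rule abelian_groupI)
    fix u assume "u \<in> carrier Q"
    then obtain x where x: "x \<in> carrier A" "u = cls x" by (rule Q_cases)
    show "\<zero>\<^bsub>Q\<^esub> \<oplus>\<^bsub>Q\<^esub> u = u" using x by (simp add: cls_zero cls_add)
    have "cls (\<ominus> x) \<oplus>\<^bsub>Q\<^esub> u = \<zero>\<^bsub>Q\<^esub>" using x by (simp add: cls_zero cls_add l_neg)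
    then show "\<exists>v\<in>carrier Q. v \<oplus>\<^bsub>Q\<^esub> u = \<zero>\<^bsub>Q\<^esub>" using x cls_closed by blast
  qed (auto elim!: Q_cases simp: cls_add cls_zero a_ac)
  show ?thesis
    unfolding nonunital_algebra_def nonunital_algebra_axioms_def
    by (intro conjI ab allI impI)
      (auto elim!: Q_cases simp: cls_ops m_assoc l_distr r_distr smult_l_distr smult_r_distr
         smult_smult smult_mult_l smult_mult_r)
qed

sublocale Q: nonunital_algebra Q
  by (rule nonunital_algebra_quotient)

lemma cls_uminus: "x \<in> carrier A \<Longrightarrow> \<ominus>\<^bsub>Q\<^esub> cls x = cls (\<ominus> x)"
  by (intro Q.minus_equality) (auto simp: cls_add cls_zero l_neg)

lemma cls_eq_if_minus_mem:
  "x \<in> carrier A \<Longrightarrow> y \<in> carrier A \<Longrightarrow> x \<ominus> y \<in> I \<Longrightarrow> cls x = cls y"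
  by (simp add: cls_eq_iff)

lemma image_ideal:
  assumes J: "two_sided_ideal J A"
  shows "two_sided_ideal (cls ` J) Q"
proof (rule Q.two_sided_idealI)
  note Jc = ideal_carrier[OF J]
  show "cls ` J \<subseteq> carrier Q" using Jc by auto
  show "\<zero>\<^bsub>Q\<^esub> \<in> cls ` J" using ideal_zero[OF J] by (simp add: cls_zero)
  show "u \<oplus>\<^bsub>Q\<^esub> v \<in> cls ` J" if "u \<in> cls ` J" "v \<in> cls ` J" for u v
    using that ideal_add[OF J] Jc by (auto simp: cls_add)
  show "\<ominus>\<^bsub>Q\<^esub> u \<in> cls ` J" if "u \<in> cls ` J" for u
    using that ideal_uminus[OF J] Jc by (auto simp: cls_uminus)
  show "a \<otimes>\<^bsub>Q\<^esub> u \<in> cls ` J" if "u \<in> cls ` J" "a \<in> carrier Q" for u a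
    using that ideal_mult_l[OF J] Jc by (auto simp: cls_mult elim!: Q_cases)
  show "u \<otimes>\<^bsub>Q\<^esub> a \<in> cls ` J" if "u \<in> cls ` J" "a \<in> carrier Q" for u a
    using that ideal_mult_r[OF J] Jc by (auto simp: cls_mult elim!: Q_cases)
qed

lemma preimage_prime_ideal:
  assumes M: "prime_two_sided_ideal M Q"
  shows "prime_two_sided_ideal {x \<in> carrier A. cls x \<in> M} A" (is "prime_two_sided_ideal ?N A")
  unfolding prime_two_sided_ideal_def
proof (intro conjI allI impI)
  have Mi: "two_sided_ideal M Q" using M by (simp add: prime_two_sided_ideal_def)
  show "two_sided_ideal ?N A"
    by (rule two_sided_idealI)
      (use Q.ideal_zero[OF Mi] Q.ideal_add[OF Mi] Q.ideal_uminus[OF Mi] Q.ideal_mult_l[OF Mi] Q.ideal_mult_r[OF Mi]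
        in \<open>auto simp: cls_zero[symmetric] cls_add[symmetric] cls_mult[symmetric] cls_uminus[symmetric]\<close>)
  show "?N \<noteq> carrier A"
  proof
    assume eq: "?N = carrier A"
    have "carrier Q \<subseteq> M" using eq by (auto simp: Q_carrier)
    then have "M = carrier Q" using Q.ideal_carrier[OF Mi] by blast
    then show False using M by (simp add: prime_two_sided_ideal_def)
  qed
  fix J H assume J: "two_sided_ideal J A" and H: "two_sided_ideal H A" and JH: "J \<cdot> H \<subseteq> ?N"
  have "(cls ` J) \<cdot>\<^bsub>Q\<^esub> (cls ` H) \<subseteq> M"
  proof
    fix u assume "u \<in> (cls ` J) \<cdot>\<^bsub>Q\<^esub> (cls ` H)"
    then show "u \<in> M"
    proof induct
      case (prod p q)
      then obtain j h where jh: "j \<in> J" "h \<in> H" "p = cls j" "q = cls h" by blast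
      have "j \<otimes> h \<in> ?N" by (rule subsetD[OF JH ideal_prod.prod[OF jh(1,2)]])
      then show ?case using jh ideal_carrier[OF J] ideal_carrier[OF H] by (simp add: cls_mult)
    next
      case (sum p q)
      then show ?case using Q.ideal_add[OF Mi] by blast
    qed
  qed
  then have "cls ` J \<subseteq> M \<or> cls ` H \<subseteq> M"
    using M image_ideal[OF J] image_ideal[OF H] unfolding prime_two_sided_ideal_def by blast
  then show "J \<subseteq> ?N \<or> H \<subseteq> ?N" using ideal_carrier[OF J] ideal_carrier[OF H] by blast
qed

text \<open>
  The preimage of a nonzero prime ideal of the quotient is a prime ideal properly containing \<open>I\<close>. If
  each nonzero element of the quotient is avoided by one of them, then these preimages intersect in \<open>I\<close>.
\<close>
lemma not_locally_closed_if_avoidable: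
  assumes avoid: "\<And>a. a \<in> carrier Q \<Longrightarrow> a \<noteq> \<zero>\<^bsub>Q\<^esub> \<Longrightarrow>
      \<exists>M. prime_two_sided_ideal M Q \<and> M \<noteq> {\<zero>\<^bsub>Q\<^esub>} \<and> a \<notin> M"
  shows "\<not> locally_closed_ideal I A"
proof -
  have "carrier A \<inter> \<Inter>{M. prime_two_sided_ideal M A \<and> I \<subset> M} \<subseteq> I"
  proof
    fix x assume x: "x \<in> carrier A \<inter> \<Inter>{M. prime_two_sided_ideal M A \<and> I \<subset> M}"
    show "x \<in> I"
    proof (rule ccontr)
      assume "x \<notin> I"
      then have "cls x \<in> carrier Q" "cls x \<noteq> \<zero>\<^bsub>Q\<^esub>" using x by (auto simp: cls_eq_zero)
      then obtain M where M: "prime_two_sided_ideal M Q" "M \<noteq> {\<zero>\<^bsub>Q\<^esub>}" "cls x \<notin> M" using avoid by blast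
      have Mi: "two_sided_ideal M Q" using M by (simp add: prime_two_sided_ideal_def)
      let ?N = "{x \<in> carrier A. cls x \<in> M}"
      obtain u where u: "u \<in> M" "u \<noteq> \<zero>\<^bsub>Q\<^esub>" using Q.ideal_ex_nonzero[OF Mi M(2)] by blast
      then obtain y where y: "y \<in> carrier A" "u = cls y" using Q.ideal_carrier[OF Mi] Q_cases by blast
      have "y \<in> ?N" "y \<notin> I" using u y by (auto simp: cls_eq_zero)
      moreover have "I \<subseteq> ?N"
      proof
        fix i assume i: "i \<in> I"
        then have ic: "i \<in> carrier A" using ideal_carrier[OF I] by blast
        then have "cls i = \<zero>\<^bsub>Q\<^esub>" using i by (simp add: cls_eq_zero)
        then show "i \<in> ?N" using ic Q.ideal_zero[OF Mi] by simp
      qed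
      ultimately have "I \<subset> ?N" by blast
      then have "x \<in> ?N" using x preimage_prime_ideal[OF M(1)] by blast
      then show False using M(3) by simp
    qed
  qed
  then have "I = carrier A \<inter> \<Inter>{M. prime_two_sided_ideal M A \<and> I \<subset> M}"
    using ideal_carrier[OF I] by blast
  then show ?thesis by (simp add: locally_closed_ideal_def)
qed

end

context nonunital_algebra
begin

text \<open>
  Without a unit, \<open>x \<otimes> a \<otimes> y \<in> P\<close> for all \<open>a\<close> does not directly bound the product of the generated ideals.
  Under the additional hypothesis \<open>x \<otimes> y \<in> P\<close>, the ideals \<open>I\<close> and \<open>J\<close> below are annihilators modulo \<open>P\<close> that
  contain \<open>x\<close> and \<open>y\<close>. That case is applied to the products \<open>x \<otimes> a\<close>, and then to \<open>x\<close> and \<open>x\<close>.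
\<close>
lemma prime_ideal_elementwise:
  assumes P: "prime_two_sided_ideal P A" and x: "x \<in> carrier A" and y: "y \<in> carrier A"
    and xy: "\<And>a. a \<in> carrier A \<Longrightarrow> x \<otimes> a \<otimes> y \<in> P"
  shows "x \<in> P \<or> y \<in> P"
proof -
  have Pi: "two_sided_ideal P A" using P by (simp add: prime_two_sided_ideal_def)
  have aux: "x \<in> P \<or> y \<in> P"
    if x: "x \<in> carrier A" and y: "y \<in> carrier A" and xy: "x \<otimes> y \<in> P"
      and xay: "\<And>a. a \<in> carrier A \<Longrightarrow> x \<otimes> a \<otimes> y \<in> P" for x y
  proof -
    define I where "I = {i \<in> carrier A. i \<otimes> y \<in> P \<and> (\<forall>a\<in>carrier A. i \<otimes> a \<otimes> y \<in> P)}"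
    define J where "J = {j \<in> carrier A. \<forall>i\<in>I. i \<otimes> j \<in> P}"
    have I: "two_sided_ideal I A"
    proof (rule two_sided_idealI)
      show "\<zero> \<in> I" using y ideal_zero[OF Pi] by (simp add: I_def)
      show "i \<oplus> j \<in> I" if "i \<in> I" "j \<in> I" for i j
        using that y ideal_add[OF Pi] by (simp add: I_def l_distr)
      show "\<ominus> i \<in> I" if "i \<in> I" for i
        using that y ideal_uminus[OF Pi] by (simp add: I_def l_minus)
      show "b \<otimes> i \<in> I" if "i \<in> I" "b \<in> carrier A" for i b
      proof -
        have "b \<otimes> (i \<otimes> y) \<in> P" "\<And>a. a \<in> carrier A \<Longrightarrow> b \<otimes> (i \<otimes> a \<otimes> y) \<in> P"
          using that ideal_mult_l[OF Pi] by (auto simp: I_def)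
        then show ?thesis using that y by (simp add: I_def m_assoc)
      qed
      show "i \<otimes> b \<in> I" if "i \<in> I" "b \<in> carrier A" for i b
      proof -
        have "i \<otimes> b \<otimes> y \<in> P" "\<And>a. a \<in> carrier A \<Longrightarrow> i \<otimes> (b \<otimes> a) \<otimes> y \<in> P"
          using that by (auto simp: I_def)
        then show ?thesis using that y by (simp add: I_def m_assoc)
      qed
    qed (auto simp: I_def)
    have J: "two_sided_ideal J A"
    proof (rule two_sided_idealI)
      note Ic = ideal_carrier[OF I]
      show "\<zero> \<in> J" using Ic ideal_zero[OF Pi] by (simp add: J_def)
      show "i \<oplus> j \<in> J" if "i \<in> J" "j \<in> J" for i j
        using that Ic ideal_add[OF Pi] by (simp add: J_def r_distr)
      show "\<ominus> i \<in> J" if "i \<in> J" for i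
        using that Ic ideal_uminus[OF Pi] by (simp add: J_def r_minus)
      show "b \<otimes> j \<in> J" if j: "j \<in> J" and b: "b \<in> carrier A" for j b
      proof -
        have "i \<otimes> (b \<otimes> j) \<in> P" if i: "i \<in> I" for i
        proof -
          have "(i \<otimes> b) \<otimes> j \<in> P" using j ideal_mult_r[OF I i b] by (simp add: J_def)
          then show ?thesis using i j b Ic by (simp add: m_assoc J_def)
        qed
        then show ?thesis using j b by (simp add: J_def)
      qed
      show "j \<otimes> b \<in> J" if j: "j \<in> J" and b: "b \<in> carrier A" for j b
      proof -
        have "i \<otimes> (j \<otimes> b) \<in> P" if i: "i \<in> I" for i
        proof -
          have "(i \<otimes> j) \<otimes> b \<in> P" using i j b ideal_mult_r[OF Pi] by (simp add: J_def)
          then show ?thesis using i j b Ic by (simp add: m_assoc J_def)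
        qed
        then show ?thesis using j b by (simp add: J_def)
      qed
    qed (auto simp: J_def)
    have "I \<cdot> J \<subseteq> P"
    proof
      fix u assume "u \<in> I \<cdot> J"
      then show "u \<in> P"
        by induct (auto simp: J_def intro: ideal_add[OF Pi])
    qed
    then have "I \<subseteq> P \<or> J \<subseteq> P" using P I J unfolding prime_two_sided_ideal_def by blast
    moreover have "x \<in> I" using x xy xay by (simp add: I_def)
    moreover have "y \<in> J" using y by (simp add: I_def J_def)
    ultimately show ?thesis by blast
  qed
  show ?thesis
  proof (rule ccontr)
    assume n: "\<not> ?thesis"
    have xa: "x \<otimes> a \<in> P" if a: "a \<in> carrier A" for a
    proof -
      have "x \<otimes> a \<otimes> b \<otimes> y \<in> P" if b: "b \<in> carrier A" for b
        using xy[of "a \<otimes> b"] a b x y by (simp add: m_assoc)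
      then have "x \<otimes> a \<in> P \<or> y \<in> P" using a x y xy by (intro aux) auto
      then show ?thesis using n by blast
    qed
    have "x \<in> P \<or> x \<in> P"
    proof (rule aux[OF x x xa[OF x]])
      fix a assume "a \<in> carrier A"
      then show "x \<otimes> a \<otimes> x \<in> P" using xa[of "a \<otimes> x"] x by (simp add: m_assoc)
    qed
    then show False using n by blast
  qed
qed

text \<open>
  A ring ideal of an algebra without unit need not be a subspace. A prime one is, because the scalars in
  \<open>(c x) a (c x) = x (a (c\<^sup>2 x))\<close> can be moved away from the first factor.
\<close>
lemma prime_ideal_smult:
  assumes P: "prime_two_sided_ideal P A" and x: "x \<in> P"
  shows "c \<odot> x \<in> P"
proof -
  have Pi: "two_sided_ideal P A" using P by (simp add: prime_two_sided_ideal_def)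
  have xc: "x \<in> carrier A" using ideal_carrier[OF Pi x] .
  have "(c \<odot> x) \<otimes> a \<otimes> (c \<odot> x) \<in> P" if a: "a \<in> carrier A" for a
  proof -
    have "x \<otimes> (a \<otimes> (c \<odot> (c \<odot> x))) \<in> P" using xc a by (intro ideal_mult_r[OF Pi x]) auto
    then show ?thesis using xc a by (simp add: smult_mult_l smult_mult_r m_assoc)
  qed
  then show ?thesis using prime_ideal_elementwise[OF P, of "c \<odot> x" "c \<odot> x"] xc by auto
qed

lemma quotient_by_prime_ideal:
  assumes P: "prime_two_sided_ideal P A"
  shows "quotient_by_ideal A P"
proof
  show "two_sided_ideal P A" using P by (simp add: prime_two_sided_ideal_def)
  show "c \<odot> x \<in> P" if "x \<in> P" for c x by (rule prime_ideal_smult[OF P that])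
qed

lemma prime_nonunital_algebra_quotient:
  assumes P: "prime_two_sided_ideal P A"
  shows "prime_nonunital_algebra (quotient_algebra A P)"
proof -
  interpret quotient_by_ideal A P by (rule quotient_by_prime_ideal[OF P])
  show ?thesis
  proof (intro prime_nonunital_algebra.intro nonunital_algebra_quotient prime_nonunital_algebra_axioms.intro)
    have "P \<noteq> carrier A" using P by (simp add: prime_two_sided_ideal_def)
    then obtain x where "x \<in> carrier A" "x \<notin> P" using ideal_carrier[OF I] by blast
    then have "cls x \<in> carrier Q" "cls x \<noteq> \<zero>\<^bsub>Q\<^esub>" by (auto simp: cls_eq_zero)
    then show "carrier Q \<noteq> {\<zero>\<^bsub>Q\<^esub>}" by blast
    fix u v assume u: "u \<in> carrier Q" and v: "v \<in> carrier Q"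
      and uv: "\<And>a. a \<in> carrier Q \<Longrightarrow> u \<otimes>\<^bsub>Q\<^esub> a \<otimes>\<^bsub>Q\<^esub> v = \<zero>\<^bsub>Q\<^esub>"
    obtain x where x: "x \<in> carrier A" "u = cls x" using u by (rule Q_cases)
    obtain y where y: "y \<in> carrier A" "v = cls y" using v by (rule Q_cases)
    have "x \<otimes> a \<otimes> y \<in> P" if "a \<in> carrier A" for a
      using uv[of "cls a"] that x y by (simp add: cls_mult cls_eq_zero)
    then show "u = \<zero>\<^bsub>Q\<^esub> \<or> v = \<zero>\<^bsub>Q\<^esub>" using prime_ideal_elementwise[OF P x(1) y(1)] x y by (simp add: cls_eq_zero)
  qed
qed

lemma quotient_by_generated_ideal:
  "quotient_by_ideal A (algebra_ideal_generated A S)"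
proof
  let ?N = "algebra_ideal_generated A S"
  have N: "x \<in> ?N \<longleftrightarrow> x \<in> carrier A \<and>
      (\<forall>I. two_sided_ideal I A \<longrightarrow> (\<forall>c. \<forall>x\<in>I. c \<odot> x \<in> I) \<longrightarrow> S \<subseteq> I \<longrightarrow> x \<in> I)" for x
    by (auto simp: algebra_ideal_generated_def)
  show "two_sided_ideal ?N A"
    by (rule two_sided_idealI)
      (auto simp: N ideal_zero ideal_add ideal_uminus ideal_mult_l ideal_mult_r)
  show "c \<odot> x \<in> ?N" if "x \<in> ?N" for c x using that by (auto simp: N)
qed

end

section \<open>Prime quotients of Leavitt path algebras\<close>
lemma leavitt_path_algebra_quotient:
  fixes E :: "('v, 'e) pre_digraph"
    and P :: "(('v, 'e) lpa_gen list \<Rightarrow> 'k :: field) set set"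
  assumes wf: "wf_digraph E" and P: "prime_two_sided_ideal P (leavitt_path_algebra E)"
  shows "\<exists>vx ed gh. path_algebra (quotient_algebra (leavitt_path_algebra E) P) E vx ed gh"
proof -
  define F where "F = (free_algebra (lpa_gens E) :: ('k, ('v, 'e) lpa_gen list \<Rightarrow> 'k) module)"
  define N where "N = algebra_ideal_generated F (lpa_relators E)"
  have L: "leavitt_path_algebra E = quotient_algebra F N"
    by (simp add: leavitt_path_algebra_def F_def N_def)
  interpret F: nonunital_algebra F unfolding F_def by (rule nonunital_algebra_free_algebra)
  interpret N: quotient_by_ideal F N unfolding N_def by (rule F.quotient_by_generated_ideal)
  note P' = P[unfolded L]
  interpret P: quotient_by_ideal "quotient_algebra F N" P by (rule N.Q.quotient_by_prime_ideal[OF P'])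
  interpret A: prime_nonunital_algebra P.Q by (rule N.Q.prime_nonunital_algebra_quotient[OF P'])
  define \<psi> where "\<psi> x = P.cls (N.cls x)" for x
  have gen_closed: "free_gen x \<in> carrier F" if "x \<in> lpa_gens E" for x
    unfolding F_def by (rule free_gen_closed[OF that])
  have vc [simp]: "free_gen (Vertex v) \<in> carrier F" if "v \<in> verts E" for v
    using that by (intro gen_closed) (auto simp: lpa_gens_def)
  have ec [simp]: "free_gen (Edge e) \<in> carrier F" "free_gen (Ghost e) \<in> carrier F" if "e \<in> arcs E" for e
    using that by (auto intro!: gen_closed simp: lpa_gens_def)
  have ht [simp]: "head E e \<in> verts E" "tail E e \<in> verts E" if "e \<in> arcs E" for e
    using wf that by (auto simp: wf_digraph_def)
  have \<psi>_closed: "\<psi> x \<in> carrier P.Q" if "x \<in> carrier F" for x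
    using that by (simp add: \<psi>_def)
  have \<psi>_mult: "\<psi> x \<otimes>\<^bsub>P.Q\<^esub> \<psi> y = \<psi> (x \<otimes>\<^bsub>F\<^esub> y)" if "x \<in> carrier F" "y \<in> carrier F" for x y
    using that by (simp add: \<psi>_def P.cls_mult N.cls_mult)
  have \<psi>_add: "\<psi> x \<oplus>\<^bsub>P.Q\<^esub> \<psi> y = \<psi> (x \<oplus>\<^bsub>F\<^esub> y)" if "x \<in> carrier F" "y \<in> carrier F" for x y
    using that by (simp add: \<psi>_def P.cls_add N.cls_add)
  have \<psi>_smult: "c \<odot>\<^bsub>P.Q\<^esub> \<psi> x = \<psi> (c \<odot>\<^bsub>F\<^esub> x)" if "x \<in> carrier F" for c x
    using that by (simp add: \<psi>_def P.cls_smult N.cls_smult)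
  have \<psi>_zero: "\<psi> \<zero>\<^bsub>F\<^esub> = \<zero>\<^bsub>P.Q\<^esub>"
    by (simp add: \<psi>_def P.cls_zero N.cls_zero)
  have N_base: "r \<in> N" if "r \<in> lpa_relators E" "r \<in> carrier F" for r
    using that by (auto simp: N_def algebra_ideal_generated_def)
  have rel_eq: "\<psi> x = \<psi> y" if "x \<ominus>\<^bsub>F\<^esub> y \<in> lpa_relators E" "x \<in> carrier F" "y \<in> carrier F" for x y
    unfolding \<psi>_def by (rule arg_cong[OF N.cls_eq_if_minus_mem]) (use that N_base in auto)
  have rel_zero: "\<psi> x = \<zero>\<^bsub>P.Q\<^esub>" if "x \<in> lpa_relators E" "x \<in> carrier F" for x
    using N_base[OF that] that by (simp add: \<psi>_def N.cls_eq_zero[symmetric] P.cls_zero)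
  note rels = lpa_relators.intros[where E = E, where 'k = 'k, folded F_def]
  have "path_algebra P.Q E (\<lambda>v. \<psi> (free_gen (Vertex v))) (\<lambda>e. \<psi> (free_gen (Edge e))) (\<lambda>e. \<psi> (free_gen (Ghost e)))"
  proof (intro path_algebra.intro A.prime_nonunital_algebra_axioms path_algebra_axioms.intro)
    show "wf_digraph E" by (rule wf)
    fix e assume e: "e \<in> arcs E"
    show "\<psi> (free_gen (Vertex (tail E e))) \<otimes>\<^bsub>P.Q\<^esub> \<psi> (free_gen (Edge e)) = \<psi> (free_gen (Edge e))"
      using e by (simp add: \<psi>_mult rel_eq[OF rels(3)])
    show "\<psi> (free_gen (Edge e)) \<otimes>\<^bsub>P.Q\<^esub> \<psi> (free_gen (Vertex (head E e))) = \<psi> (free_gen (Edge e))"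
      using e by (simp add: \<psi>_mult rel_eq[OF rels(4)])
    show "\<psi> (free_gen (Vertex (head E e))) \<otimes>\<^bsub>P.Q\<^esub> \<psi> (free_gen (Ghost e)) = \<psi> (free_gen (Ghost e))"
      using e by (simp add: \<psi>_mult rel_eq[OF rels(5)])
    show "\<psi> (free_gen (Ghost e)) \<otimes>\<^bsub>P.Q\<^esub> \<psi> (free_gen (Vertex (tail E e))) = \<psi> (free_gen (Ghost e))"
      using e by (simp add: \<psi>_mult rel_eq[OF rels(6)])
    show "\<psi> (free_gen (Ghost e)) \<otimes>\<^bsub>P.Q\<^esub> \<psi> (free_gen (Edge e)) = \<psi> (free_gen (Vertex (head E e)))"
      using e by (simp add: \<psi>_mult rel_eq[OF rels(7)])
  next
    fix T assume T: "\<zero>\<^bsub>P.Q\<^esub> \<in> T" "(\<lambda>v. \<psi> (free_gen (Vertex v))) ` verts E \<subseteq> T"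
      "(\<lambda>e. \<psi> (free_gen (Edge e))) ` arcs E \<subseteq> T" "(\<lambda>e. \<psi> (free_gen (Ghost e))) ` arcs E \<subseteq> T"
      and Tadd: "\<And>x y. x \<in> T \<Longrightarrow> y \<in> T \<Longrightarrow> x \<oplus>\<^bsub>P.Q\<^esub> y \<in> T"
      and Tmult: "\<And>x y. x \<in> T \<Longrightarrow> y \<in> T \<Longrightarrow> x \<otimes>\<^bsub>P.Q\<^esub> y \<in> T"
      and Tsmult: "\<And>c x. x \<in> T \<Longrightarrow> c \<odot>\<^bsub>P.Q\<^esub> x \<in> T"
    have "carrier F \<subseteq> {x \<in> carrier F. \<psi> x \<in> T}"
      unfolding F_def
    proof (rule free_algebra_generated, unfold F_def[symmetric])
      show "\<zero>\<^bsub>F\<^esub> \<in> {x \<in> carrier F. \<psi> x \<in> T}" using T(1) by (simp add: \<psi>_zero)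
      show "free_gen x \<in> {x \<in> carrier F. \<psi> x \<in> T}" if "x \<in> lpa_gens E" for x
        using that gen_closed[OF that] T by (auto simp: lpa_gens_def)
      show "x \<oplus>\<^bsub>F\<^esub> y \<in> {x \<in> carrier F. \<psi> x \<in> T}"
        if "x \<in> {x \<in> carrier F. \<psi> x \<in> T}" "y \<in> {x \<in> carrier F. \<psi> x \<in> T}" for x y
        using that Tadd[of "\<psi> x" "\<psi> y"] by (simp add: \<psi>_add)
      show "x \<otimes>\<^bsub>F\<^esub> y \<in> {x \<in> carrier F. \<psi> x \<in> T}"
        if "x \<in> {x \<in> carrier F. \<psi> x \<in> T}" "y \<in> {x \<in> carrier F. \<psi> x \<in> T}" for x y
        using that Tmult[of "\<psi> x" "\<psi> y"] by (simp add: \<psi>_mult)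
      show "c \<odot>\<^bsub>F\<^esub> x \<in> {x \<in> carrier F. \<psi> x \<in> T}" if "x \<in> {x \<in> carrier F. \<psi> x \<in> T}" for c x
        using that Tsmult[of "\<psi> x" c] by (simp add: \<psi>_smult)
    qed
    then show "carrier P.Q \<subseteq> T"
      by (auto simp: P.Q_carrier N.Q_carrier \<psi>_def)
  qed (simp_all add: \<psi>_closed \<psi>_mult rel_eq[OF rels(1)] rel_zero[OF rels(2)] rel_zero[OF rels(8)])
  then show ?thesis unfolding L by blast
qed

theorem (in path_algebra) centroid_alternative:
  "(\<exists>g x. monogenic_corner A g x) \<or>
   (\<forall>I f. two_sided_ideal I A \<longrightarrow> I \<noteq> {\<zero>} \<longrightarrow> f \<in> bimodule_homs A I \<longrightarrow> algebraic_action A I f)"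
proof (cases "no_gaps")
  case False
  then show ?thesis using gap_corner unfolding no_gaps_def by blast
next
  case True
  then show ?thesis using exitless_corner[OF True] algebraic_action_no_exitless[OF True] by blast
qed

theorem proposition3p16:
  fixes E :: "('v, 'e) pre_digraph"
    and P :: "(('v, 'e) lpa_gen list \<Rightarrow> 'k :: field) set set"
  assumes "wf_digraph E"
    and "prime_two_sided_ideal P (leavitt_path_algebra E)"
    and "locally_closed_ideal P (leavitt_path_algebra E)"
  shows "rational_ideal P (leavitt_path_algebra E)"
proof -
  let ?L = "leavitt_path_algebra E :: ('k, (('v, 'e) lpa_gen list \<Rightarrow> 'k) set) module"
  let ?A = "quotient_algebra ?L P"
  obtain vx ed gh where "path_algebra ?A E vx ed gh"
    using leavitt_path_algebra_quotient[OF assms(1,2)] by blast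
  then interpret A: path_algebra ?A E vx ed gh .
  have L: "nonunital_algebra ?L"
  proof -
    interpret F: nonunital_algebra "free_algebra (lpa_gens E) :: ('k, ('v, 'e) lpa_gen list \<Rightarrow> 'k) module"
      by (rule nonunital_algebra_free_algebra)
    show ?thesis unfolding leavitt_path_algebra_def
      by (rule quotient_by_ideal.nonunital_algebra_quotient[OF F.quotient_by_generated_ideal])
  qed
  interpret P: quotient_by_ideal ?L P
    by (rule nonunital_algebra.quotient_by_prime_ideal[OF L assms(2)])
  have algebraic: "algebraic_action ?A I f"
    if I: "two_sided_ideal I ?A" "I \<noteq> {\<zero>\<^bsub>?A\<^esub>}" and f: "f \<in> bimodule_homs ?A I" for I f
  proof (cases "\<exists>g x. monogenic_corner ?A g x")
    case False
    then show ?thesis using A.centroid_alternative I f by blast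
  next
    case True
    then obtain g x where "monogenic_corner ?A g x" by blast
    then interpret C: monogenic_corner ?A g x .
    show ?thesis
    proof (cases "\<exists>p. p \<noteq> 0 \<and> C.ev p = \<zero>\<^bsub>?A\<^esub>")
      case True
      then show ?thesis using C.algebraic_action_if_algebraic I f by blast
    next
      case False
      then have "\<not> locally_closed_ideal P ?L"
        by (intro P.not_locally_closed_if_avoidable C.ex_prime_avoiding_if_transcendental) blast+
      then show ?thesis using assms(3) by simp
    qed
  qed
  show ?thesis
    unfolding rational_ideal_def using A.extended_centroid_algebraic[OF algebraic] by blast
qed

end
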